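(* Let $K$ be an algebraically closed field of characteristic zero, let $n\ge2$ and $d\ge2$, and let $X=\nu_d(\mathbb{P}^n)\subset\mathbb{P}^N$, $N=\binom{n+d}{n}-1$, be the $d$-uple Veronese embedding of $\mathbb{P}^n$. Let $q\in\mathrm{Sec}(X)$ be a closed point outside of $X$. (1) When $d=2$, $\Sigma_q(X)$ is a smooth plane conic curve. Therefore $\mathrm{Sec}(X)=\mathrm{Tan}(X)$ and $\dim\mathrm{Tan}(X)=2n$. The secant stratification of $X$ is $$\mathbb{P}^N=SL_{-1}(X)\cup SL_1(X)\cup X,$$ where $SL_1(X)=\mathrm{Sec}(X)\setminus X$ and $SL_n(X)=X$. (2) When $d\ge3$, $\Sigma_q(X)$ is the union of two distinct points if $q\in\mathrm{Sec}(X)\setminus\mathrm{Tan}(X)$, and a double point if $q\in\mathrm{Tan}(X)$. Then the secant stratification of $X$ is $$\mathbb{P}^N=SL_{-1}(X)\cup SL_0(X)\cup X,$$ where $SL_0(X)=\mathrm{Sec}(X)\setminus X$ and $SL_n(X)=X$.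
   Context: For a projective variety $X\subset\mathbb{P}^N$ of dimension $n$ and a closed point $q\in\mathbb{P}^N\setminus X$, let $\pi_q:X\to\mathbb{P}^{N-1}$ be the linear projection from $q$. The secant locus $\Sigma_q(X)$ is the set of all points of $X$ spanning secant lines through $q$, i.e. points $x\in X$ such that the line $\langle q,x\rangle$ meets $X$ in a scheme of length at least $2$ (tangent lines included); it carries the scheme structure of the intersection of $X$ with the cone with vertex $q$ over $\pi_q(\Sigma_q(X))$. For $-1\le s\le n$, $SL_s(X)$ is the set of closed points $q\in\mathbb{P}^N$ with $\dim\Sigma_q(X)=s$, with the conventions $\dim\Sigma_q(X)=-1$ if $\Sigma_q(X)=\emptyset$ and $\dim\Sigma_q(X)=n$ if $q\in X$. The decomposition $\mathbb{P}^N=\bigcup_{-1\le s\le n}SL_s(X)$ is the secant stratification of $X$; strata not listed are empty unless they coincide with one that is listed. $\mathrm{Tan}(X)=\bigcup_{x\in X}T_xX\subset\mathbb{P}^N$ is the union of embedded projective tangent spaces, and $\mathrm{Sec}(X)=\overline{\bigcup_{x_1\ne x_2\in X}\langle x_1,x_2\rangle}\subset\mathbb{P}^N$ is the secant variety. A double point is a non-reduced scheme of length $2$ supported at one point. *)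

theory Defs
  imports
    "HOL-Analysis.Cartesian_Space"
    "HOL-Analysis.Function_Topology"
    "HOL-Library.Poly_Mapping"
    "HOL-Library.Extended_Nat"
    "HOL-Library.Liminf_Limsup"
    "HOL-Computational_Algebra.Polynomial"
begin

section \<open>Multivariate polynomials\<close>

text \<open>
  The polynomial ring with coefficients in \<^typ>\<open>'a\<close> and one variable for each element of the
  finite type \<^typ>\<open>'m\<close>.
\<close>

type_synonym 'm monom = "'m \<Rightarrow>\<^sub>0 nat"
type_synonym ('a, 'm) mpoly = "'m monom \<Rightarrow>\<^sub>0 'a"

definition mdegree :: "'m::finite monom \<Rightarrow> nat" where
  "mdegree m = (\<Sum>i\<in>UNIV. Poly_Mapping.lookup m i)"

definition monom_eval :: "('m::finite \<Rightarrow> 'b::comm_monoid_mult) \<Rightarrow> 'm monom \<Rightarrow> 'b" where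
  "monom_eval g m = (\<Prod>i\<in>UNIV. g i ^ Poly_Mapping.lookup m i)"

definition mpoly_const :: "'a::zero \<Rightarrow> ('a, 'm) mpoly" where
  "mpoly_const c = Poly_Mapping.single 0 c"

text \<open>Apply \<open>h\<close> to the coefficients and substitute \<open>g i\<close> for the \<open>i\<close>-th variable.\<close>

definition mpoly_subst ::
    "('a::comm_ring_1 \<Rightarrow> 'b::comm_ring_1) \<Rightarrow> ('m::finite \<Rightarrow> 'b) \<Rightarrow> ('a, 'm) mpoly \<Rightarrow> 'b" where
  "mpoly_subst h g F =
     (\<Sum>m\<in>Poly_Mapping.keys F. h (Poly_Mapping.lookup F m) * monom_eval g m)"

definition mpoly_eval :: "('a::comm_ring_1, 'm::finite) mpoly \<Rightarrow> 'a ^ 'm \<Rightarrow> 'a" where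
  "mpoly_eval F v = mpoly_subst (\<lambda>c. c) (($) v) F"

definition mpoly_pderiv :: "'m \<Rightarrow> ('a::comm_ring_1, 'm) mpoly \<Rightarrow> ('a, 'm) mpoly" where
  "mpoly_pderiv i F =
     (\<Sum>m\<in>Poly_Mapping.keys F.
        Poly_Mapping.single (m - Poly_Mapping.single i 1)
          (of_nat (Poly_Mapping.lookup m i) * Poly_Mapping.lookup F m))"

definition homogeneous :: "nat \<Rightarrow> ('a::zero, 'm::finite) mpoly \<Rightarrow> bool" where
  "homogeneous t F \<longleftrightarrow> (\<forall>m\<in>Poly_Mapping.keys F. mdegree m = t)"

definition mpoly_scale :: "'a::field \<Rightarrow> ('a, 'm) mpoly \<Rightarrow> ('a, 'm) mpoly" where
  "mpoly_scale c F = mpoly_const c * F"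

interpretation mpoly: vector_space mpoly_scale
  by standard
    (simp_all add: mpoly_scale_def mpoly_const_def distrib_left distrib_right single_add
      mult_single mult.assoc [symmetric])


section \<open>Projective space and its Zariski topology\<close>

text \<open>
  The closed points of the projective space with homogeneous coordinates indexed by \<^typ>\<open>'m\<close>
  are the lines through the origin; its dimension is \<open>CARD('m) - 1\<close>.
\<close>

definition proj_space :: "('a::field ^ 'm::finite) set set" where
  "proj_space = {vec.span {v} | v. v \<noteq> 0}"

text \<open>The linear subspace of projective space spanned by a set of points.\<close>

definition proj_span :: "('a::field ^ 'm::finite) set set \<Rightarrow> ('a ^ 'm) set set" where
  "proj_span A = {p \<in> proj_space. p \<subseteq> vec.span (\<Union>A)}"

definition vanishes_at :: "('a::field, 'm::finite) mpoly \<Rightarrow> ('a ^ 'm) set \<Rightarrow> bool" where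
  "vanishes_at F p \<longleftrightarrow> (\<forall>v\<in>p. mpoly_eval F v = 0)"

definition zariski :: "('a::field ^ 'm::finite) set topology" where
  "zariski = topology_generated_by
     {{p \<in> proj_space. \<not> vanishes_at F p} | F. \<exists>t. homogeneous t F}"

definition irreducible_closedin :: "'x topology \<Rightarrow> 'x set \<Rightarrow> bool" where
  "irreducible_closedin T Z \<longleftrightarrow> closedin T Z \<and> Z \<noteq> {} \<and>
     (\<forall>A B. closedin T A \<and> closedin T B \<and> Z \<subseteq> A \<union> B \<longrightarrow> Z \<subseteq> A \<or> Z \<subseteq> B)"

text \<open>
  The Krull dimension of a set of points of projective space, with its subspace topology; it is
  \<open>-1\<close> for the empty set. The lengths of the chains are bounded by the dimension of the ambient
  projective space, so that the supremum in \<^typ>\<open>int\<close> is a genuine one.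
\<close>

definition krull_dim :: "('a::field ^ 'm::finite) set set \<Rightarrow> int" where
  "krull_dim A = Sup (insert (-1)
     {int k | k. \<exists>Z. (\<forall>i\<le>k. irreducible_closedin (subtopology zariski A) (Z i)) \<and>
                    (\<forall>i<k. Z i \<subset> Z (Suc i))})"


section \<open>Closed subschemes of projective space\<close>

text \<open>
  A closed subscheme is given by a homogeneous ideal \<open>J\<close> of the coordinate ring; two homogeneous
  ideals define the same subscheme iff they have the same saturation with respect to the
  irrelevant ideal.
\<close>

definition saturation :: "('a::field, 'm::finite) mpoly set \<Rightarrow> ('a, 'm) mpoly set" where
  "saturation J = {F. \<exists>k. \<forall>m. mdegree m = k \<longrightarrow> Poly_Mapping.single m 1 * F \<in> J}"

definition same_subscheme ::
    "('a::field, 'm::finite) mpoly set \<Rightarrow> ('a, 'm) mpoly set \<Rightarrow> bool" where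
  "same_subscheme I J \<longleftrightarrow> saturation I = saturation J"

text \<open>
  The ideal of the closure of \<open>A\<close> with its reduced structure. It consists of the polynomials
  vanishing on the affine cone over \<open>A\<close>, which is a homogeneous ideal over an infinite field.
\<close>

definition vanishing_ideal :: "('a::field ^ 'm::finite) set set \<Rightarrow> ('a, 'm) mpoly set" where
  "vanishing_ideal A = {F. \<forall>p\<in>A. vanishes_at F p}"

definition zero_locus :: "('a::field, 'm::finite) mpoly set \<Rightarrow> ('a ^ 'm) set set" where
  "zero_locus J = {p \<in> proj_space. \<forall>F\<in>J. vanishes_at F p}"

text \<open>The scheme-theoretic intersection is defined by the sum of the two ideals.\<close>

definition scheme_inter ::
    "('a::field, 'm::finite) mpoly set \<Rightarrow> ('a, 'm) mpoly set \<Rightarrow> ('a, 'm) mpoly set" where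
  "scheme_inter I J = {F + G | F G. F \<in> I \<and> G \<in> J}"

definition reduced_subscheme :: "('a::field, 'm::finite) mpoly set \<Rightarrow> bool" where
  "reduced_subscheme J \<longleftrightarrow> (\<forall>F k. F ^ k \<in> saturation J \<longrightarrow> F \<in> saturation J)"

text \<open>The dimension of the degree \<open>t\<close> part of the coordinate ring modulo \<open>J\<close>.\<close>

definition hilbert_function :: "('a::field, 'm::finite) mpoly set \<Rightarrow> nat \<Rightarrow> nat" where
  "hilbert_function J t =
     mpoly.dim {F :: ('a, 'm) mpoly. homogeneous t F} - mpoly.dim {F \<in> J. homogeneous t F}"

text \<open>
  The length of a closed subscheme: the constant Hilbert polynomial, i.e. the eventual value of
  the Hilbert function, if the subscheme is finite. Otherwise the Hilbert function tends to
  infinity and so the length is \<open>\<infinity>\<close>.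
\<close>

definition scheme_length :: "('a::field, 'm::finite) mpoly set \<Rightarrow> enat" where
  "scheme_length J = liminf (\<lambda>t. enat (hilbert_function J t))"

definition two_distinct_points :: "('a::field, 'm::finite) mpoly set \<Rightarrow> bool" where
  "two_distinct_points J \<longleftrightarrow>
     (\<exists>x1\<in>proj_space. \<exists>x2\<in>proj_space. x1 \<noteq> x2 \<and> same_subscheme J (vanishing_ideal {x1, x2}))"

definition double_point :: "('a::field, 'm::finite) mpoly set \<Rightarrow> bool" where
  "double_point J \<longleftrightarrow>
     (\<exists>x. zero_locus J = {x}) \<and> scheme_length J = 2 \<and> \<not> reduced_subscheme J"

definition mpoly_pullback ::
    "'a::field ^ 'k::finite ^ 'm::finite \<Rightarrow> ('a, 'm) mpoly \<Rightarrow> ('a, 'k) mpoly" where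
  "mpoly_pullback A F =
     mpoly_subst mpoly_const
       (\<lambda>i. \<Sum>j\<in>UNIV. Poly_Mapping.single (Poly_Mapping.single j 1) (A $ i $ j)) F"

text \<open>
  A smooth plane conic is the image, under the linear embedding of a plane given by an injective
  matrix \<open>A\<close>, of the subscheme defined by a quadratic form \<open>Q\<close> that satisfies the Jacobian
  criterion at all of its zeros.
\<close>

definition smooth_plane_conic :: "('a::field, 'm::finite) mpoly set \<Rightarrow> bool" where
  "smooth_plane_conic J \<longleftrightarrow>
     (\<exists>(A :: 'a ^ 3 ^ 'm) Q.
        inj ((*v) A) \<and> homogeneous 2 Q \<and>
        (\<forall>v. v \<noteq> 0 \<and> mpoly_eval Q v = 0 \<longrightarrow> (\<exists>j. mpoly_eval (mpoly_pderiv j Q) v \<noteq> 0)) \<and>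
        same_subscheme J {F. Q dvd mpoly_pullback A F})"


section \<open>Secants, tangents and the secant stratification\<close>

text \<open>In this section \<open>X\<close> is the set of closed points of a projective variety.\<close>

definition secant_variety :: "('a::field ^ 'm::finite) set set \<Rightarrow> ('a ^ 'm) set set" where
  "secant_variety X =
     zariski closure_of (\<Union>{proj_span {x1, x2} | x1 x2. x1 \<in> X \<and> x2 \<in> X \<and> x1 \<noteq> x2})"

definition tangent_space ::
    "('a::field ^ 'm::finite) set set \<Rightarrow> ('a ^ 'm) set \<Rightarrow> ('a ^ 'm) set set" where
  "tangent_space X x =
     {y \<in> proj_space. \<forall>F\<in>vanishing_ideal X. \<forall>v\<in>x. \<forall>w\<in>y.
        (\<Sum>i\<in>UNIV. mpoly_eval (mpoly_pderiv i F) v * w $ i) = 0}"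

definition tangent_variety :: "('a::field ^ 'm::finite) set set \<Rightarrow> ('a ^ 'm) set set" where
  "tangent_variety X = (\<Union>x\<in>X. tangent_space X x)"

definition secant_locus ::
    "('a::field ^ 'm::finite) set set \<Rightarrow> ('a ^ 'm) set \<Rightarrow> ('a ^ 'm) set set" where
  "secant_locus X q =
     {x \<in> X. scheme_length
       (scheme_inter (vanishing_ideal X) (vanishing_ideal (proj_span {q, x}))) \<ge> 2}"

text \<open>
  The target of the linear projection from \<open>q\<close> is the projective space of the quotient of
  \<^typ>\<open>'a ^ 'm\<close> by \<open>q\<close>. Its points are represented by the planes through the origin
  containing \<open>q\<close>, i.e. by the projective lines through \<open>q\<close>.
\<close>

definition proj_from :: "('a::field ^ 'm::finite) set \<Rightarrow> ('a ^ 'm) set \<Rightarrow> ('a ^ 'm) set" where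
  "proj_from q x = vec.span (q \<union> x)"

definition cone_over ::
    "('a::field ^ 'm::finite) set \<Rightarrow> ('a ^ 'm) set set \<Rightarrow> ('a ^ 'm) set set" where
  "cone_over q B = insert q {p \<in> proj_space. p \<noteq> q \<and> proj_from q p \<in> B}"

text \<open>
  The secant locus of a point \<open>q\<close> outside of \<open>X\<close> as a closed subscheme: the scheme-theoretic
  intersection of \<open>X\<close> with the cone, where the cone carries its reduced structure.
\<close>

definition secant_scheme ::
    "('a::field ^ 'm::finite) set set \<Rightarrow> ('a ^ 'm) set \<Rightarrow> ('a, 'm) mpoly set" where
  "secant_scheme X q =
     scheme_inter (vanishing_ideal X)
       (vanishing_ideal (cone_over q (proj_from q ` secant_locus X q)))"

definition secant_locus_dim :: "('a::field ^ 'm::finite) set set \<Rightarrow> ('a ^ 'm) set \<Rightarrow> int" where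
  "secant_locus_dim X q = (if q \<in> X then krull_dim X else krull_dim (secant_locus X q))"

definition SL :: "int \<Rightarrow> ('a::field ^ 'm::finite) set set \<Rightarrow> ('a ^ 'm) set set" where
  "SL s X = {q \<in> proj_space. secant_locus_dim X q = s}"


section \<open>Veronese embeddings\<close>

text \<open>
  The map is given by the monomials \<open>mon i\<close>. It is the \<open>d\<close>-uple Veronese embedding if \<open>mon\<close>
  enumerates the monomials of degree \<open>d\<close>.
\<close>

definition monomial_map ::
    "('m::finite \<Rightarrow> 'k::finite monom) \<Rightarrow> ('a::field ^ 'k) set \<Rightarrow> ('a ^ 'm) set" where
  "monomial_map mon p = vec.span ((\<lambda>v. \<chi> i. monom_eval (($) v) (mon i)) ` p)"

definition veronese_variety :: "('m::finite \<Rightarrow> 'k::finite monom) \<Rightarrow> ('a::field ^ 'm) set set" where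
  "veronese_variety mon = monomial_map mon ` proj_space"

end

theory Submission
  imports Defs
begin

text \<open>
  A vector \<open>y\<close> of the ambient space of the Veronese variety \<open>X\<close> has one coordinate for each monomial
  of degree \<open>d\<close>, so it is a linear functional on the forms of degree \<open>d\<close>. Write \<open>\<phi> u\<close> for evaluation
  at \<open>u\<close>, so that the points of \<open>X\<close> are the lines spanned by the \<open>\<phi> u\<close>, and \<open>\<tau> u w\<close> for the derivative
  at \<open>u\<close> in direction \<open>w\<close>. In these terms the geometry becomes the algebra of functionals.

  Equations. \<open>X\<close> and its tangent spaces are cut out by the quadrics \<open>y\<^sub>i y\<^sub>j = y\<^sub>k y\<^sub>l\<close> with equal
  products of monomials (\<open>veronese_variety_cut_out_by_quadrics\<close>, \<open>tangent_cut_out_by_quadrics\<close>). The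
  secant variety is the union of the secant and the tangent lines (\<open>secant_variety_eq\<close>): the minors of
  size three of two catalecticant matrices vanish on it, and they force a functional to depend on two
  variables only and to be killed by a quadratic form in these variables, which is a product of two
  linear forms over an algebraically closed field.

  Secant loci. Restricted to the line through a point \<open>\<phi> u\<close> of \<open>X\<close> and a point \<open>q\<close> outside of \<open>X\<close>, the
  quadrics become combinations of \<open>s t\<close> and \<open>t\<^sup>2\<close>. If their span contains both forms, the line meets \<open>X\<close> in a reduced
  point; otherwise they have a second common zero or a double zero at \<open>\<phi> u\<close>, so that the line is a
  secant or a tangent line. Hence the secant locus consists of the points of \<open>X\<close> on a secant or
  tangent line through \<open>q\<close> (\<open>secant_locus_eq\<close>).

  Degree at least three. Products of three linear forms and a power separate two subschemes of
  length two with different supports, so only one secant or tangent line passes through \<open>q\<close>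
  (\<open>secant_unique\<close>, \<open>tangent_unique\<close>). The cone is this line, and its intersection with \<open>X\<close> is given on
  the line by the monomial \<open>s t\<close> or \<open>t\<^sup>2\<close> (\<open>two_distinct_points_secant\<close>, \<open>double_point_tangent\<close>).

  Degree two. A sum of two squares is a product, so every secant is a tangent and \<open>q = \<tau> z w\<close>. The
  points \<open>\<phi> (s z + t w)\<close> form a conic in the plane spanned by \<open>\<phi> z\<close>, \<open>q\<close> and \<open>\<phi> w\<close>. Every line of this
  plane through \<open>q\<close> meets the conic in length two, so the conic is the secant locus and the plane is the
  cone (\<open>secant_scheme_conic\<close>).

  Dimensions. The length of a chain of irreducible closed sets is bounded by the order of growth
  of the homogeneous coordinate ring (\<open>growth_le_drop\<close>), which for a parametrised set is bounded by a
  count of monomials. Chains that attain the bound come from coordinate flags (\<open>krull_dim_X\<close>,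
  \<open>krull_dim_tangent_variety\<close>).
\<close>

abbreviation (input) "lookup \<equiv> Poly_Mapping.lookup"
abbreviation (input) "single \<equiv> Poly_Mapping.single"
abbreviation (input) "keys \<equiv> Poly_Mapping.keys"

section \<open>Substitution into polynomials\<close>

lemma monom_eval_0 [simp]: "monom_eval g 0 = 1"
  by (simp add: monom_eval_def)

lemma monom_eval_add: "monom_eval g (m + m') = monom_eval g m * monom_eval g m'"
  by (simp add: monom_eval_def lookup_add power_add prod.distrib)

lemma monom_eval_single [simp]: "monom_eval g (single j k) = g j ^ k"
proof -
  have "monom_eval g (single j k) = (\<Prod>i\<in>UNIV. if i = j then g j ^ k else 1)"
    unfolding monom_eval_def by (intro prod.cong) (auto simp: lookup_single when_def)
  then show ?thesis by simp
qed

lemma monom_eval_mult: "monom_eval (\<lambda>i. f i * g i) m = monom_eval f m * monom_eval g m"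
  by (simp add: monom_eval_def power_mult_distrib prod.distrib)

lemma monom_eval_const: "monom_eval (\<lambda>i. c) m = c ^ mdegree m"
  by (simp add: monom_eval_def mdegree_def power_sum)

lemma mdegree_0 [simp]: "mdegree 0 = 0"
  by (simp add: mdegree_def)

lemma mdegree_add [simp]: "mdegree (m + m') = mdegree m + mdegree m'"
  by (simp add: mdegree_def lookup_add sum.distrib)

lemma mdegree_single [simp]: "mdegree (single j k) = k"
proof -
  have "mdegree (single j k) = (\<Sum>i\<in>UNIV. if i = j then k else 0)"
    unfolding mdegree_def by (intro sum.cong) (auto simp: lookup_single when_def)
  then show ?thesis by simp
qed

lemma mdegree_eq_0_iff: "mdegree m = 0 \<longleftrightarrow> m = 0"
  by (auto simp: mdegree_def intro: poly_mapping_eqI)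

lemma lookup_le_mdegree: "lookup m i \<le> mdegree m"
  unfolding mdegree_def by (rule member_le_sum) auto

lemma monom_split_variable:
  fixes m :: "'k monom"
  assumes "lookup m j > 0"
  obtains m' where "m = single j 1 + m'"
proof
  show "m = single j 1 + (m - single j 1)"
    using assms by (intro poly_mapping_eqI) (auto simp: lookup_add lookup_minus lookup_single when_def)
qed

lemma monom_split_mdegree:
  assumes "mdegree m = Suc e"
  obtains j m' where "m = single j 1 + m'" "mdegree m' = e"
proof -
  have "\<exists>j. lookup m j > 0"
    using assms by (metis bot_nat_0.not_eq_extremum lookup_zero mdegree_eq_0_iff nat.distinct(1) poly_mapping_eqI)
  then obtain j where "lookup m j > 0" by blast
  then obtain m' where m': "m = single j 1 + m'" by (rule monom_split_variable)
  with assms show ?thesis by (intro that[of j m']) auto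
qed

lemma monom_induct [case_names 0 add]:
  assumes "P 0" and "\<And>j m. P m \<Longrightarrow> P (single j 1 + m)"
  shows "P (m :: 'k::finite monom)"
proof (induction "mdegree m" arbitrary: m)
  case 0
  then show ?case using assms(1) mdegree_eq_0_iff[of m] by simp
next
  case (Suc e)
  from Suc.hyps(2)[symmetric] obtain j m' where "m = single j 1 + m'" "mdegree m' = e"
    by (rule monom_split_mdegree)
  with Suc.hyps(1)[of m'] assms(2)[of m' j] show ?case by simp
qed

lemma mpoly_sum_singles: "F = (\<Sum>m\<in>keys F. single m (lookup F m))"
proof (rule poly_mapping_eqI)
  fix k
  have "(\<Sum>m\<in>keys F. lookup (single m (lookup F m)) k)
      = (\<Sum>m\<in>keys F. if m = k then lookup F k else 0)"
    by (intro sum.cong) (auto simp: lookup_single when_def)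
  also have "\<dots> = lookup F k"
    by (auto simp: in_keys_iff)
  finally show "lookup F k = lookup
      (\<Sum>m\<in>keys F. single m (lookup F m)) k"
    by (simp add: lookup_sum)
qed

lemma mpoly_induct [case_names single add]:
  assumes "\<And>m c. P (single m c)"
    and "\<And>F G. P F \<Longrightarrow> P G \<Longrightarrow> P (F + G)"
  shows "P (F :: 'x \<Rightarrow>\<^sub>0 'a::comm_monoid_add)"
proof -
  have "P (\<Sum>m\<in>S. single m (lookup F m))" if "finite S" for S
    using that
  proof (induction S)
    case empty
    show ?case using assms(1)[of _ 0] by simp
  next
    case (insert x S)
    then show ?case using assms by simp
  qed
  from this[of "keys F"] show ?thesis
    using mpoly_sum_singles[of F] by simp
qed

text \<open>
  Substitution is used with three coefficient maps: the identity (evaluation), the constants of a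
  polynomial ring in one variable (restriction to a curve) and the constants of another polynomial
  ring in several variables (composition).
\<close>

locale coeff_hom =
  fixes h :: "'a::comm_ring_1 \<Rightarrow> 'b::comm_ring_1"
  assumes h_add: "h (x + y) = h x + h y"
    and h_mult: "h (x * y) = h x * h y"
    and h_one: "h 1 = 1"
begin

lemma h_zero: "h 0 = 0"
  using h_add[of 0 0] by simp

lemma subst_superset:
  assumes "finite S" "keys F \<subseteq> S"
  shows "mpoly_subst h g F = (\<Sum>m\<in>S. h (lookup F m) * monom_eval g m)"
  unfolding mpoly_subst_def
  by (rule sum.mono_neutral_left) (use assms in \<open>auto simp: in_keys_iff h_zero\<close>)

lemma subst_add: "mpoly_subst h g (F + G) = mpoly_subst h g F + mpoly_subst h g G"
proof -
  let ?S = "keys F \<union> keys G"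
  have "mpoly_subst h g (F + G) = (\<Sum>m\<in>?S. h (lookup (F + G) m) * monom_eval g m)"
    using Poly_Mapping.keys_add[of F G] by (intro subst_superset) auto
  also have "\<dots> = (\<Sum>m\<in>?S. h (lookup F m) * monom_eval g m) +
      (\<Sum>m\<in>?S. h (lookup G m) * monom_eval g m)"
    by (simp add: lookup_add h_add algebra_simps sum.distrib)
  also have "\<dots> = mpoly_subst h g F + mpoly_subst h g G"
    by (simp add: subst_superset[of ?S])
  finally show ?thesis .
qed

lemma subst_single: "mpoly_subst h g (single m c) = h c * monom_eval g m"
  by (subst subst_superset[of "{m}"]) (auto simp: lookup_single h_zero)

lemma subst_zero [simp]: "mpoly_subst h g 0 = 0"
  by (simp add: mpoly_subst_def)

lemma subst_one [simp]: "mpoly_subst h g 1 = 1"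
  using subst_single[of g 0 1] by (simp add: h_one)

lemma subst_const [simp]: "mpoly_subst h g (mpoly_const c) = h c"
  by (simp add: mpoly_const_def subst_single)

lemma subst_uminus: "mpoly_subst h g (- F) = - mpoly_subst h g F"
  using subst_add[of g F "- F"] by (simp add: eq_neg_iff_add_eq_0 add.commute)

lemma subst_diff: "mpoly_subst h g (F - G) = mpoly_subst h g F - mpoly_subst h g G"
  using subst_add[of g F "- G"] by (simp add: subst_uminus)

lemma subst_sum: "mpoly_subst h g (sum F S) = (\<Sum>x\<in>S. mpoly_subst h g (F x))"
  by (induction S rule: infinite_finite_induct) (auto simp: subst_add)

lemma subst_mult: "mpoly_subst h g (F * G) = mpoly_subst h g F * mpoly_subst h g G"
proof (induction F rule: mpoly_induct)
  case (single m c)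
  show ?case
    by (induction G rule: mpoly_induct)
      (auto simp: mult_single subst_single subst_add h_mult monom_eval_add algebra_simps)
qed (auto simp: subst_add algebra_simps)

lemma subst_power: "mpoly_subst h g (F ^ n) = mpoly_subst h g F ^ n"
  by (induction n) (auto simp: subst_mult)

lemma subst_prod: "mpoly_subst h g (prod F S) = (\<Prod>x\<in>S. mpoly_subst h g (F x))"
  by (induction S rule: infinite_finite_induct) (auto simp: subst_mult)

lemma subst_monom_eval:
  "mpoly_subst h g (monom_eval \<psi> m) = monom_eval (\<lambda>i. mpoly_subst h g (\<psi> i)) m"
  by (simp add: monom_eval_def subst_prod subst_power)

end

interpretation eval: coeff_hom "\<lambda>c. c :: 'a::comm_ring_1"
  by standard auto

interpretation coeff_poly: coeff_hom "\<lambda>c. [:c :: 'a::comm_ring_1:]"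
  by standard (simp_all add: pCons_one)

interpretation coeff_const: coeff_hom "mpoly_const :: 'a::comm_ring_1 \<Rightarrow> ('a, 'k) mpoly"
  by standard (simp_all only: mpoly_const_def single_add mult_single add_0 single_one)

lemma mpoly_eval_add [simp]: "mpoly_eval (F + G) v = mpoly_eval F v + mpoly_eval G v"
  and mpoly_eval_diff [simp]: "mpoly_eval (F - G) v = mpoly_eval F v - mpoly_eval G v"
  and mpoly_eval_uminus [simp]: "mpoly_eval (- F) v = - mpoly_eval F v"
  and mpoly_eval_mult [simp]: "mpoly_eval (F * G) v = mpoly_eval F v * mpoly_eval G v"
  and mpoly_eval_power [simp]: "mpoly_eval (F ^ k) v = mpoly_eval F v ^ k"
  and mpoly_eval_zero [simp]: "mpoly_eval 0 v = 0"
  and mpoly_eval_one [simp]: "mpoly_eval 1 v = 1"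
  and mpoly_eval_const [simp]: "mpoly_eval (mpoly_const c) v = c"
  and mpoly_eval_single [simp]: "mpoly_eval (single m c) v = c * monom_eval (($) v) m"
  and mpoly_eval_sum [simp]: "mpoly_eval (sum FF S) v = (\<Sum>x\<in>S. mpoly_eval (FF x) v)"
  by (simp_all add: mpoly_eval_def eval.subst_add eval.subst_diff eval.subst_uminus eval.subst_mult
      eval.subst_power eval.subst_single eval.subst_sum)

lemma vec_nth_vec_lambda [simp]: "($) (\<chi> i. f i) = f"
  by auto

lemma mpoly_eval_scale [simp]: "mpoly_eval (mpoly_scale c F) v = c * mpoly_eval F v"
  by (simp add: mpoly_scale_def)

lemma mpoly_scale_lookup: "lookup (mpoly_scale c F) m = c * lookup F m"
  by (induction F rule: mpoly_induct)
    (auto simp: mpoly_scale_def mpoly_const_def mult_single lookup_single when_def distrib_left lookup_add)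

abbreviation along :: "('m \<Rightarrow> 'a poly) \<Rightarrow> ('a::comm_ring_1, 'm::finite) mpoly \<Rightarrow> 'a poly" where
  "along \<equiv> mpoly_subst (\<lambda>c. [:c:])"

lemma poly_monom_eval: "poly (monom_eval p m) t = monom_eval (\<lambda>i. poly (p i) t) m"
  by (simp add: monom_eval_def poly_prod poly_power)

lemma poly_along: "poly (along p F) t = mpoly_eval F (\<chi> i. poly (p i) t)"
  by (induction F rule: mpoly_induct)
    (simp_all add: coeff_poly.subst_single coeff_poly.subst_add poly_monom_eval)

abbreviation compose :: "('m \<Rightarrow> ('a, 'k) mpoly) \<Rightarrow> ('a::comm_ring_1, 'm::finite) mpoly \<Rightarrow> ('a, 'k::finite) mpoly" where
  "compose \<equiv> mpoly_subst mpoly_const"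

lemma (in coeff_hom) subst_compose:
  "mpoly_subst h g (compose \<psi> F) = mpoly_subst h (\<lambda>i. mpoly_subst h g (\<psi> i)) F"
  by (induction F rule: mpoly_induct)
    (simp_all add: coeff_const.subst_single coeff_const.subst_add subst_add subst_mult
      subst_monom_eval subst_single)

lemma mpoly_eval_compose:
  "mpoly_eval (compose \<psi> F) v = mpoly_eval F (\<chi> i. mpoly_eval (\<psi> i) v)"
  by (simp add: mpoly_eval_def eval.subst_compose del: vec_lambda_eta)

lemma mpoly_eval_homogeneous:
  assumes "homogeneous t F"
  shows "mpoly_eval F (c *s v) = c ^ t * mpoly_eval F v"
proof -
  have "mpoly_eval F (c *s v) =
      (\<Sum>m\<in>keys F. lookup F m * (c ^ mdegree m * monom_eval (($) v) m))"
    by (simp add: mpoly_eval_def mpoly_subst_def monom_eval_mult monom_eval_const vector_scalar_mult_def del: vec_lambda_eta)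
  also have "\<dots> = c ^ t * mpoly_eval F v"
    using assms by (simp add: homogeneous_def mpoly_eval_def mpoly_subst_def sum_distrib_left algebra_simps)
  finally show ?thesis .
qed

subsection \<open>Derivatives\<close>

text \<open>
  The derivative of \<open>F\<close> at \<open>v\<close> in direction \<open>w\<close> is the linear coefficient of the restriction of
  \<open>F\<close> to the line through \<open>v\<close> with direction \<open>w\<close>; this coefficient only sees the curve to first
  order, which is the chain rule. So derivatives are handled by the ring homomorphism \<open>along\<close>.
\<close>

lemma coeff_monom_eval_0: "coeff (monom_eval p m) 0 = monom_eval (\<lambda>i. coeff (p i) 0) m"
  using poly_monom_eval[of p m 0] by (simp add: poly_0_coeff_0)

lemma coeff_along_0: "coeff (along p F) 0 = mpoly_eval F (\<chi> i. coeff (p i) 0)"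
  using poly_along[of p F 0] by (simp add: poly_0_coeff_0)

lemma coeff_1_mult:
  "coeff (p * q) (Suc 0) = coeff p 0 * coeff q (Suc 0) + coeff p (Suc 0) * coeff q 0"
  by (simp add: coeff_mult)

lemma coeff_monom_eval_1_cong:
  assumes "\<And>i. coeff (p i) 0 = coeff (q i) 0" "\<And>i. coeff (p i) 1 = coeff (q i) 1"
  shows "coeff (monom_eval p m) 1 = coeff (monom_eval q m) 1"
  by (induction m rule: monom_induct)
    (use assms in \<open>simp_all add: monom_eval_add coeff_1_mult coeff_monom_eval_0\<close>)

lemma coeff_along_1_cong:
  assumes "\<And>i. coeff (p i) 0 = coeff (q i) 0" "\<And>i. coeff (p i) 1 = coeff (q i) 1"
  shows "coeff (along p F) 1 = coeff (along q F) 1"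
proof (induction F rule: mpoly_induct)
  case (single m c)
  show ?case
    using coeff_monom_eval_1_cong[of p q m] assms by (simp add: coeff_poly.subst_single)
qed (simp add: coeff_poly.subst_add)

lemma monom_eval_linear_coeff:
  fixes v w :: "'m::finite \<Rightarrow> 'a::comm_ring_1"
  shows "coeff (monom_eval (\<lambda>i. [:v i, w i:]) m) 1 =
    (\<Sum>i\<in>UNIV. of_nat (lookup m i) * monom_eval v (m - single i 1) * w i)"
proof (induction m rule: monom_induct)
  case 0
  show ?case by simp
next
  case (add j m)
  have *: "of_nat (lookup (single j 1 + m) i) *
        monom_eval v (single j 1 + m - single i 1) =
      v j * (of_nat (lookup m i) * monom_eval v (m - single i 1)) +
      (if i = j then monom_eval v m else 0)" for i
  proof (cases "lookup m i = 0")
    case True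
    then show ?thesis by (auto simp: lookup_add lookup_single when_def)
  next
    case False
    then obtain m' where m': "m = single i 1 + m'"
      by (metis gr0I monom_split_variable)
    have "single j 1 + m - single i 1 = single j 1 + m'"
      by (simp add: m' add.left_commute)
    then show ?thesis
      by (auto simp: m' lookup_add lookup_single when_def monom_eval_add algebra_simps)
  qed
  have "coeff (monom_eval (\<lambda>i. [:v i, w i:]) (single j 1 + m)) 1 =
      v j * coeff (monom_eval (\<lambda>i. [:v i, w i:]) m) 1 + w j * monom_eval v m"
    by (simp add: monom_eval_add coeff_1_mult coeff_monom_eval_0)
  also have "\<dots> = (\<Sum>i\<in>UNIV. (v j * (of_nat (lookup m i) *
      monom_eval v (m - single i 1)) + (if i = j then monom_eval v m else 0)) * w i)"
  proof -
    have "(\<Sum>i\<in>UNIV. (if i = j then monom_eval v m else 0) * w i) = (\<Sum>i\<in>UNIV. if i = j then monom_eval v m * w j else 0)"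
      by (intro sum.cong) auto
    then show ?thesis
      unfolding add.IH by (simp add: algebra_simps sum.distrib sum_distrib_left)
  qed
  finally show ?case unfolding * .
qed

lemma mpoly_pderiv_superset:
  assumes "finite S" "keys F \<subseteq> S"
  shows "mpoly_pderiv i F = (\<Sum>m\<in>S. single (m - single i 1)
          (of_nat (lookup m i) * lookup F m))"
  unfolding mpoly_pderiv_def
  by (rule sum.mono_neutral_left) (use assms in \<open>auto simp: in_keys_iff\<close>)

lemma mpoly_pderiv_add: "mpoly_pderiv i (F + G) = mpoly_pderiv i F + mpoly_pderiv i G"
proof -
  let ?S = "keys F \<union> keys G"
  show ?thesis
    using Poly_Mapping.keys_add[of F G]
    by (simp add: mpoly_pderiv_superset[of ?S] lookup_add single_add algebra_simps sum.distrib)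
qed

lemma mpoly_pderiv_single:
  "mpoly_pderiv i (single m c) =
    single (m - single i 1) (of_nat (lookup m i) * c)"
  by (subst mpoly_pderiv_superset[of "{m}"]) (auto simp: lookup_single)

lemma sum_pderiv_eq_coeff_along:
  "(\<Sum>i\<in>UNIV. mpoly_eval (mpoly_pderiv i F) v * w $ i) = coeff (along (\<lambda>i. [:v $ i, w $ i:]) F) 1"
proof (induction F rule: mpoly_induct)
  case (single m c)
  show ?case
    by (simp add: mpoly_pderiv_single coeff_poly.subst_single monom_eval_linear_coeff sum_distrib_left
        algebra_simps del: One_nat_def)
next
  case (add F G)
  then show ?case
    by (simp add: mpoly_pderiv_add coeff_poly.subst_add algebra_simps sum.distrib)
qed

subsection \<open>Polynomials are determined by their values\<close>

lemma digits_unique: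
  fixes a b :: "nat \<Rightarrow> nat"
  assumes "\<And>i. i < n \<Longrightarrow> a i < D" "\<And>i. i < n \<Longrightarrow> b i < D"
    and "(\<Sum>i<n. a i * D ^ i) = (\<Sum>i<n. b i * D ^ i)" and "i < n"
  shows "a i = b i"
  using assms
proof (induction n arbitrary: a b i)
  case (Suc n)
  have shift: "(\<Sum>i<Suc n. c i * D ^ i) = c 0 + D * (\<Sum>i<n. c (Suc i) * D ^ i)" for c :: "nat \<Rightarrow> nat"
    by (simp only: sum.lessThan_Suc_shift) (simp add: sum_distrib_left algebra_simps)
  have eq: "a 0 + D * (\<Sum>i<n. a (Suc i) * D ^ i) = b 0 + D * (\<Sum>i<n. b (Suc i) * D ^ i)"
    using Suc.prems(3) unfolding shift .
  have lt: "a 0 < D" "b 0 < D" using Suc.prems(1,2) by auto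
  have 0: "a 0 = b 0"
    using arg_cong[OF eq, of "\<lambda>x. x mod D"] lt by simp
  have 1: "(\<Sum>i<n. a (Suc i) * D ^ i) = (\<Sum>i<n. b (Suc i) * D ^ i)"
    using eq lt 0 by simp
  show ?case
  proof (cases i)
    case (Suc j)
    then show ?thesis
      using Suc.IH[of "\<lambda>i. a (Suc i)" "\<lambda>i. b (Suc i)" j] 1 Suc.prems by simp
  qed (use 0 in simp)
qed simp

text \<open>
  Kronecker's substitution: replacing the \<open>i\<close>-th variable by \<open>t ^ (D ^ i)\<close> keeps the finitely many
  monomials apart as soon as \<open>D\<close> exceeds all exponents. So the independence of the monomials as
  functions reduces to one variable.
\<close>

lemma monom_functions_independent:
  fixes c :: "'m::finite monom \<Rightarrow> 'a::{field,ring_char_0}"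
  assumes S: "finite S" and zero: "\<And>g :: 'm \<Rightarrow> 'a. (\<Sum>m\<in>S. c m * monom_eval g m) = 0" and "m0 \<in> S"
  shows "c m0 = 0"
proof -
  obtain e :: "nat \<Rightarrow> 'm" where e: "bij_betw e {..<CARD('m)} UNIV"
    using ex_bij_betw_nat_finite[OF finite_class.finite_UNIV] by (metis atLeast0LessThan)
  define D where "D = Suc (Max (mdegree ` S))"
  define k where "k m = (\<Sum>i<CARD('m). lookup m (e i) * D ^ i)" for m
  have small: "lookup m i < D" if "m \<in> S" for m i
    unfolding D_def using lookup_le_mdegree[of m i] Max_ge[of "mdegree ` S" "mdegree m"] S that
    by (simp add: le_imp_less_Suc order_trans)
  have inj: "inj_on k S"
  proof (rule inj_onI)
    fix m m' assume m: "m \<in> S" "m' \<in> S" "k m = k m'"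
    have eq: "lookup m (e i) = lookup m' (e i)" if "i < CARD('m)" for i
      using that m by (intro digits_unique[of "CARD('m)"
            "\<lambda>i. lookup m (e i)" D "\<lambda>i. lookup m' (e i)"]) (auto simp: k_def small)
    show "m = m'"
    proof (rule poly_mapping_eqI)
      fix j
      from e obtain i where "i < CARD('m)" "j = e i"
        by (metis UNIV_I bij_betw_imp_surj_on imageE lessThan_iff)
      then show "lookup m j = lookup m' j" using eq by simp
    qed
  qed
  define p where "p = (\<Sum>m\<in>S. monom (c m) (k m))"
  have "poly p t = 0" for t
  proof -
    define g where "g j = t ^ (D ^ (inv_into {..<CARD('m)} e j))" for j
    have "monom_eval g m = t ^ k m" for m
    proof -
      have "monom_eval g m = (\<Prod>i<CARD('m). g (e i) ^ lookup m (e i))"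
        unfolding monom_eval_def by (rule prod.reindex_bij_betw[OF e, symmetric])
      also have "\<dots> = (\<Prod>i<CARD('m). t ^ (lookup m (e i) * D ^ i))"
        using e by (intro prod.cong) (auto simp: g_def bij_betw_def inv_into_f_f power_mult mult.commute)
      also have "\<dots> = t ^ k m" by (simp add: k_def power_sum)
      finally show ?thesis .
    qed
    then show ?thesis using zero[of g] by (simp add: p_def poly_sum poly_monom)
  qed
  then have "p = 0" using poly_all_0_iff_0 by blast
  then have "0 = coeff p (k m0)" by simp
  also have "\<dots> = (\<Sum>m\<in>S. if m = m0 then c m0 else 0)"
    unfolding p_def coeff_sum using inj \<open>m0 \<in> S\<close> by (intro sum.cong) (auto simp: inj_on_def)
  also have "\<dots> = c m0" using S \<open>m0 \<in> S\<close> by simp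
  finally show ?thesis by simp
qed

lemma mpoly_zero_if_eval_zero:
  fixes F :: "('a::{field,ring_char_0}, 'm::finite) mpoly"
  assumes "\<And>v. mpoly_eval F v = 0"
  shows "F = 0"
proof (rule poly_mapping_eqI)
  fix m
  have "(\<Sum>m\<in>keys F. lookup F m * monom_eval g m) = 0" for g :: "'m \<Rightarrow> 'a"
  proof -
    have "(\<lambda>i. (\<chi> j. g j) $ i) = g" by auto
    with assms[of "\<chi> i. g i"] show ?thesis
      by (metis (no_types, lifting) mpoly_eval_def mpoly_subst_def sum.cong)
  qed
  note independent = monom_functions_independent[OF finite_keys this]
  show "lookup F m = lookup 0 m"
    using independent[of m] by (auto simp: in_keys_iff)
qed

lemma poly_eq_0_if_zero_cofinitely:
  fixes p :: "'a::{field,ring_char_0} poly"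
  assumes "\<And>t. t \<noteq> 0 \<Longrightarrow> poly p t = 0"
  shows "p = 0"
proof -
  have "poly ([:0, 1:] * p) t = 0" for t using assms[of t] by (cases "t = 0") simp_all
  then show ?thesis by (metis mult_eq_0_iff one_neq_zero pCons_eq_0_iff poly_all_0_iff_0)
qed

section \<open>Graded pieces\<close>

text \<open>
  Homogeneity with respect to an additive weight of the monomials; besides the degree, the two
  partial degrees of bihomogeneous forms are of this kind.
\<close>

definition graded :: "('k monom \<Rightarrow> nat) \<Rightarrow> nat \<Rightarrow> ('a::zero, 'k) mpoly \<Rightarrow> bool" where
  "graded wt t F \<longleftrightarrow> (\<forall>m\<in>keys F. wt m = t)"

lemma homogeneous_iff_graded: "homogeneous t F \<longleftrightarrow> graded mdegree t F"
  by (simp add: homogeneous_def graded_def)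

lemma graded_zero [simp]: "graded wt t 0"
  by (simp add: graded_def)

lemma graded_add: "graded wt t F \<Longrightarrow> graded wt t G \<Longrightarrow> graded wt t (F + G)"
  using Poly_Mapping.keys_add[of F G] unfolding graded_def by blast

lemma graded_sum: "(\<And>x. x \<in> S \<Longrightarrow> graded wt t (F x)) \<Longrightarrow> graded wt t (sum F S)"
  by (induction S rule: infinite_finite_induct) (auto intro: graded_add)

lemma graded_single: "wt m = t \<Longrightarrow> graded wt t (single m c)"
  by (simp add: graded_def)

lemma graded_mult:
  fixes F G :: "('a::comm_ring_1, 'k) mpoly"
  assumes "\<And>m m'. wt (m + m') = wt m + wt m'" "graded wt s F" "graded wt t G"
  shows "graded wt (s + t) (F * G)"
  unfolding graded_def
proof
  fix m assume "m \<in> keys (F * G)"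
  with Poly_Mapping.keys_mult[of F G] obtain a b where
    "m = a + b" "a \<in> keys F" "b \<in> keys G" by blast
  with assms show "wt m = s + t" by (simp add: graded_def)
qed

lemma graded_one: "wt 0 = 0 \<Longrightarrow> graded wt 0 (1 :: ('a::comm_ring_1, 'k) mpoly)"
  by (simp add: graded_def)

lemma graded_power:
  fixes F :: "('a::comm_ring_1, 'k) mpoly"
  assumes "\<And>m m'. wt (m + m') = wt m + wt m'" "wt 0 = 0" "graded wt s F"
  shows "graded wt (n * s) (F ^ n)"
  by (induction n) (simp_all add: graded_one assms(2) graded_mult[OF assms(1)] assms(3))

lemma graded_prod:
  fixes F :: "'x \<Rightarrow> ('a::comm_ring_1, 'k) mpoly"
  assumes "\<And>m m'. wt (m + m') = wt m + wt m'" "wt 0 = 0"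
    and "\<And>x. x \<in> S \<Longrightarrow> graded wt (d x) (F x)"
  shows "graded wt (sum d S) (prod F S)"
  using assms(3)
  by (induction S rule: infinite_finite_induct) (simp_all add: graded_one assms(2) graded_mult[OF assms(1)])

lemma graded_monom_eval:
  fixes \<psi> :: "'m::finite \<Rightarrow> ('a::comm_ring_1, 'k) mpoly"
  assumes "\<And>m m'. wt (m + m') = wt m + wt m'" "wt 0 = 0" and "\<And>i. graded wt e (\<psi> i)"
  shows "graded wt (mdegree m * e) (monom_eval \<psi> m)"
  unfolding monom_eval_def mdegree_def sum_distrib_right
  by (intro graded_prod graded_power assms)

lemma graded_compose:
  fixes \<psi> :: "'m::finite \<Rightarrow> ('a::comm_ring_1, 'k::finite) mpoly"
  assumes wt: "\<And>m m'. wt (m + m') = wt m + wt m'" "wt 0 = 0" and "\<And>i. graded wt e (\<psi> i)"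
    and F: "homogeneous t F"
  shows "graded wt (t * e) (compose \<psi> F)"
  unfolding mpoly_subst_def
proof (rule graded_sum)
  fix m assume m: "m \<in> keys F"
  have "graded wt (0 + mdegree m * e) (mpoly_const (lookup F m) * monom_eval \<psi> m)"
    by (intro graded_mult graded_monom_eval assms) (simp add: mpoly_const_def graded_single wt)
  then show "graded wt (t * e) (mpoly_const (lookup F m) * monom_eval \<psi> m)"
    using F m by (simp add: homogeneous_def)
qed

lemma homogeneous_mult:
  "homogeneous s F \<Longrightarrow> homogeneous t G \<Longrightarrow> homogeneous (s + t) (F * G :: ('a::comm_ring_1, 'k::finite) mpoly)"
  unfolding homogeneous_iff_graded by (rule graded_mult) simp

lemma homogeneous_power:
  "homogeneous s F \<Longrightarrow> homogeneous (n * s) (F ^ n :: ('a::comm_ring_1, 'k::finite) mpoly)"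
  unfolding homogeneous_iff_graded by (rule graded_power) simp_all

lemma homogeneous_add: "homogeneous t F \<Longrightarrow> homogeneous t G \<Longrightarrow> homogeneous t (F + G)"
  unfolding homogeneous_iff_graded by (rule graded_add)

lemma homogeneous_sum: "(\<And>x. x \<in> S \<Longrightarrow> homogeneous t (F x)) \<Longrightarrow> homogeneous t (sum F S)"
  unfolding homogeneous_iff_graded by (rule graded_sum)

lemma homogeneous_single: "mdegree m = t \<Longrightarrow> homogeneous t (single m c)"
  unfolding homogeneous_iff_graded by (rule graded_single)

lemma homogeneous_zero [simp]: "homogeneous t 0"
  by (simp add: homogeneous_def)

lemma homogeneous_one [simp]: "homogeneous 0 (1 :: ('a::comm_ring_1, 'k::finite) mpoly)"
  by (simp add: homogeneous_def)

lemma homogeneous_scale: "homogeneous t F \<Longrightarrow> homogeneous t (mpoly_scale c F)"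
  by (auto simp: homogeneous_def in_keys_iff mpoly_scale_lookup)

lemma homogeneous_diff:
  "homogeneous t F \<Longrightarrow> homogeneous t G \<Longrightarrow> homogeneous t (F - G :: ('a::comm_ring_1, 'k::finite) mpoly)"
  using homogeneous_add[of t F "- G"] by (simp add: homogeneous_def in_keys_iff)

lemma mpoly_homogeneous_induct [consumes 1, case_names zero single add]:
  assumes "homogeneous t f" and "P 0"
    and "\<And>m c. mdegree m = t \<Longrightarrow> P (single m c)"
    and "\<And>f g. P f \<Longrightarrow> P g \<Longrightarrow> P (f + g)"
  shows "P (f :: ('a::comm_ring_1, 'k::finite) mpoly)"
proof -
  have "P (\<Sum>m\<in>S. single m (lookup f m))"
    if "finite S" "S \<subseteq> keys f" for S
    using that assms by (induction S) (auto simp: homogeneous_def)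
  from this[of "keys f"] show ?thesis using mpoly_sum_singles[of f] by simp
qed

definition var :: "'m \<Rightarrow> ('a::comm_ring_1, 'm) mpoly" where
  "var i = single (single i 1) 1"

lemma mpoly_eval_var [simp]: "mpoly_eval (var i) v = v $ i"
  by (simp add: var_def)

lemma (in coeff_hom) subst_var [simp]: "mpoly_subst h g (var i) = g i"
  by (simp add: var_def subst_single h_one)

lemma homogeneous_var [simp]: "homogeneous 1 (var i)" "homogeneous (Suc 0) (var i)"
  by (simp_all add: var_def homogeneous_single)

lemma finite_bounded_monomials:
  fixes S :: "'k::finite monom set"
  assumes det: "\<And>m m'. m \<in> S \<Longrightarrow> m' \<in> S \<Longrightarrow>
      (\<And>i. i \<notin> J \<Longrightarrow> lookup m i = lookup m' i) \<Longrightarrow> m = m'"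
    and bound: "\<And>m i. m \<in> S \<Longrightarrow> i \<notin> J \<Longrightarrow> lookup m i \<le> e"
  shows "finite S \<and> card S \<le> (e + 1) ^ card (- J)"
proof -
  let ?f = "\<lambda>m. restrict (lookup m) (- J)"
  have inj: "inj_on ?f S"
  proof (rule inj_onI)
    fix m m' assume m: "m \<in> S" "m' \<in> S" "?f m = ?f m'"
    have "lookup m i = lookup m' i" if "i \<notin> J" for i
      using fun_cong[OF m(3), of i] that by simp
    with m show "m = m'" by (intro det)
  qed
  have sub: "?f ` S \<subseteq> (- J) \<rightarrow>\<^sub>E {..e}"
    using bound by (intro image_subsetI restrict_PiE) (simp add: bound)
  have fin: "finite ((- J) \<rightarrow>\<^sub>E {..e})" by (intro finite_PiE) auto
  have "card (?f ` S) \<le> card ((- J) \<rightarrow>\<^sub>E {..e})" by (rule card_mono[OF fin sub])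
  also have "\<dots> = (e + 1) ^ card (- J)" by (simp add: card_PiE)
  finally show ?thesis using finite_imageD[OF finite_subset[OF sub fin] inj] card_image[OF inj] by simp
qed

lemma finite_monomials_of_degree:
  "finite {m :: 'k::finite monom. mdegree m = e}"
  "card {m :: 'k::finite monom. mdegree m = e} \<le> (e + 1) ^ (CARD('k) - 1)"
proof -
  obtain j :: 'k where True by blast
  have split: "mdegree m = lookup m j + (\<Sum>i\<in>UNIV - {j}. lookup m i)" for m
    unfolding mdegree_def by (rule sum.remove) auto
  have "finite {m :: 'k monom. mdegree m = e} \<and> card {m :: 'k monom. mdegree m = e} \<le> (e + 1) ^ card (- {j})"
  proof (rule finite_bounded_monomials)
    fix m m' assume m: "m \<in> {m. mdegree m = e}" "m' \<in> {m. mdegree m = e}"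
      "\<And>i. i \<notin> {j} \<Longrightarrow> lookup m i = lookup m' i"
    then have "(\<Sum>i\<in>UNIV - {j}. lookup m i) = (\<Sum>i\<in>UNIV - {j}. lookup m' i)"
      by (intro sum.cong) auto
    with m(1,2) split[of m] split[of m'] have "lookup m j = lookup m' j" by simp
    with m(3) show "m = m'" by (intro poly_mapping_eqI) (metis singletonD)
  qed (use lookup_le_mdegree in auto)
  then show "finite {m :: 'k monom. mdegree m = e}"
    "card {m :: 'k monom. mdegree m = e} \<le> (e + 1) ^ (CARD('k) - 1)"
    by (auto simp: Compl_eq_Diff_UNIV card_Diff_singleton)
qed


section \<open>The Zariski topology\<close>

abbreviation pt :: "'a::field ^ 'm::finite \<Rightarrow> ('a ^ 'm) set" where
  "pt v \<equiv> vec.span {v}"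

lemma pt_def': "pt v = range (\<lambda>c. c *s v)"
  by (rule vec.span_singleton)

lemma pt_in_proj_space [simp]: "pt v \<in> proj_space \<longleftrightarrow> v \<noteq> 0"
proof
  assume "pt v \<in> proj_space"
  then obtain w where w: "w \<noteq> 0" "pt v = pt w" unfolding proj_space_def by auto
  then have "w \<in> pt v" by (simp add: vec.span_base)
  with w show "v \<noteq> 0" by (auto simp: pt_def')
qed (auto simp: proj_space_def)

lemma proj_spaceE:
  assumes "p \<in> proj_space"
  obtains v where "v \<noteq> 0" "p = pt v"
  using assms unfolding proj_space_def by auto

lemma pt_scale: "c \<noteq> 0 \<Longrightarrow> pt (c *s v) = pt v"
proof -
  assume c: "c \<noteq> 0"
  have "k *s v = (k / c) *s (c *s v)" for k using c by (simp add: vector_smult_assoc)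
  then have "v \<in> pt (c *s v)" by (metis pt_def' rangeI vec.scale_one)
  moreover have "c *s v \<in> pt v" by (auto simp: pt_def')
  ultimately show ?thesis by (metis vec.span_eq singletonD subsetI)
qed

lemma pt_eqD:
  assumes "pt v = pt w" "v \<noteq> 0"
  obtains c where "c \<noteq> 0" "v = c *s w"
proof -
  have "v \<in> pt w" using assms(1) by (metis vec.span_base singletonI)
  then obtain c where "v = c *s w" by (auto simp: pt_def')
  with assms(2) show ?thesis by (intro that[of c]) auto
qed

lemma vanishes_at_pt:
  assumes "homogeneous t F"
  shows "vanishes_at F (pt v) \<longleftrightarrow> mpoly_eval F v = 0"
proof
  assume "vanishes_at F (pt v)"
  then show "mpoly_eval F v = 0" by (simp add: vanishes_at_def vec.span_base)
qed (auto simp: vanishes_at_def pt_def' mpoly_eval_homogeneous[OF assms])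

lemma vanishes_at_mult_iff:
  assumes "homogeneous s F" "homogeneous t G" "p \<in> proj_space"
  shows "vanishes_at (F * G) p \<longleftrightarrow> vanishes_at F p \<or> vanishes_at G p"
  using assms(3) vanishes_at_pt[OF homogeneous_mult[OF assms(1,2)]] vanishes_at_pt[OF assms(1)]
    vanishes_at_pt[OF assms(2)] by (auto elim!: proj_spaceE)

lemma not_vanishes_at_one: "p \<in> proj_space \<Longrightarrow> \<not> vanishes_at 1 p"
  by (auto elim!: proj_spaceE simp: vanishes_at_pt[OF homogeneous_one])

lemma topspace_zariski [simp]: "topspace (zariski :: ('a::field ^ 'm::finite) set topology) = proj_space"
proof -
  have "proj_space = {p \<in> proj_space. \<not> vanishes_at (1 :: ('a, 'm) mpoly) p}"
    using not_vanishes_at_one by blast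
  then have "proj_space \<in> {{p \<in> proj_space. \<not> vanishes_at F p} | F :: ('a, 'm) mpoly. \<exists>t. homogeneous t F}"
    using homogeneous_one by blast
  then show ?thesis unfolding zariski_def topology_generated_by_topspace by blast
qed

text \<open>
  The generating open sets are closed under finite intersections, because a product of forms
  vanishes at a point only if one of the factors does. So they form a base.
\<close>

lemma openin_zariski_basis:
  fixes U :: "('a::field ^ 'm::finite) set set"
  assumes "openin zariski U" "p \<in> U"
  shows "\<exists>F t. homogeneous t F \<and> \<not> vanishes_at F p \<and> {p \<in> proj_space. \<not> vanishes_at F p} \<subseteq> U"
proof -
  have "generate_topology_on {{p \<in> proj_space. \<not> vanishes_at F p} | F :: ('a, 'm) mpoly. \<exists>t. homogeneous t F} U"
    using assms(1) unfolding zariski_def openin_topology_generated_by_iff .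
  then show ?thesis using assms(2)
  proof (induction arbitrary: p)
    case (Int U V)
    then obtain F s G t where F: "homogeneous s F" "\<not> vanishes_at F p" "{p \<in> proj_space. \<not> vanishes_at F p} \<subseteq> U"
      and G: "homogeneous t G" "\<not> vanishes_at G p" "{p \<in> proj_space. \<not> vanishes_at G p} \<subseteq> V" by blast
    have "openin zariski U"
      using Int.hyps(1) unfolding zariski_def openin_topology_generated_by_iff .
    then have "p \<in> proj_space" using Int.prems openin_subset[of zariski U] by auto
    with F G vanishes_at_mult_iff[OF F(1) G(1)] homogeneous_mult[OF F(1) G(1)] show ?case
      by (intro exI[of _ "F * G"] exI[of _ "s + t"]) auto
  next
    case (UN K)
    then obtain k where k: "k \<in> K" "p \<in> k" by auto
    from UN.IH[OF k] k(1) show ?case by (meson Sup_upper order_trans)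
  next
    case (Basis s)
    then show ?case by auto
  qed simp
qed

lemma closedin_zariski_vanishing:
  assumes "homogeneous t F"
  shows "closedin zariski {p \<in> proj_space. vanishes_at F p}"
proof -
  have "openin zariski {p \<in> proj_space. \<not> vanishes_at F p}"
    using assms unfolding zariski_def by (intro topology_generated_by_Basis) blast
  moreover have "proj_space - {p \<in> proj_space. vanishes_at F p} = {p \<in> proj_space. \<not> vanishes_at F p}"
    by blast
  ultimately show ?thesis by (auto simp: closedin_def)
qed

lemma closedin_zariski_separate:
  assumes "closedin zariski C" "p \<in> proj_space" "p \<notin> C"
  obtains F t where "homogeneous t F" "\<not> vanishes_at F p" "\<And>q. q \<in> C \<Longrightarrow> vanishes_at F q"
proof -
  have "openin zariski (proj_space - C)" "p \<in> proj_space - C"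
    using assms by (auto simp: closedin_def)
  from openin_zariski_basis[OF this] obtain F t where
    "homogeneous t F" "\<not> vanishes_at F p" "{p \<in> proj_space. \<not> vanishes_at F p} \<subseteq> proj_space - C" by blast
  moreover have "C \<subseteq> proj_space" using closedin_subset[OF assms(1)] by simp
  ultimately show ?thesis by (intro that[of t F]) auto
qed

lemma in_zariski_closureI:
  assumes "p \<in> proj_space" "A \<subseteq> proj_space"
    and "\<And>F t. homogeneous t F \<Longrightarrow> (\<And>q. q \<in> A \<Longrightarrow> vanishes_at F q) \<Longrightarrow> vanishes_at F p"
  shows "p \<in> zariski closure_of A"
proof (rule ccontr)
  assume "p \<notin> zariski closure_of A"
  then obtain F t where "homogeneous t F" "\<not> vanishes_at F p"
    "\<And>q. q \<in> zariski closure_of A \<Longrightarrow> vanishes_at F q"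
    using closedin_zariski_separate[OF closedin_closure_of assms(1)] by blast
  moreover have "A \<subseteq> zariski closure_of A"
    using assms(2) by (simp add: closure_of_subset)
  ultimately show False using assms(3) by blast
qed


section \<open>Irreducibility and dimension\<close>

text \<open>
  Irreducibility of the closure of \<open>A\<close>, expressed by the forms that vanish on \<open>A\<close>.
\<close>

definition prime_on_forms :: "('a::field ^ 'm::finite) set set \<Rightarrow> bool" where
  "prime_on_forms A \<longleftrightarrow> A \<noteq> {} \<and> A \<subseteq> proj_space \<and>
     (\<forall>F G s t. homogeneous s F \<longrightarrow> homogeneous t G \<longrightarrow> F \<notin> vanishing_ideal A \<longrightarrow>
        G \<notin> vanishing_ideal A \<longrightarrow> F * G \<notin> vanishing_ideal A)"

text \<open>
  Irreducibility can be tested on curves: two forms that do not vanish identically on \<open>A\<close> restrict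
  to nonzero polynomials in one variable on a curve that joins points at which they do not vanish,
  and so does their product. The parameters at which the curve passes through the origin are avoided by
  a further factor.
\<close>

lemma prime_on_formsI_curves:
  fixes A :: "('a::{field,ring_char_0} ^ 'm::finite) set set"
  assumes "A \<noteq> {}" "A \<subseteq> proj_space"
    and curve: "\<And>p q. p \<in> A \<Longrightarrow> q \<in> A \<Longrightarrow> \<exists>c s t. (\<chi> i. poly (c i) s) \<noteq> 0 \<and> p = pt (\<chi> i. poly (c i) s) \<and>
       q = pt (\<chi> i. poly (c i) t) \<and> (\<forall>r. (\<chi> i. poly (c i) r) \<noteq> 0 \<longrightarrow> pt (\<chi> i. poly (c i) r) \<in> A)"
  shows "prime_on_forms A"
  unfolding prime_on_forms_def
proof (intro conjI allI impI assms notI)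
  fix F G :: "('a, 'm) mpoly" and u u'
  assume hom: "homogeneous u F" "homogeneous u' G"
    and F: "F \<notin> vanishing_ideal A" and G: "G \<notin> vanishing_ideal A" and FG: "F * G \<in> vanishing_ideal A"
  from F G obtain p q where p: "p \<in> A" "\<not> vanishes_at F p" and q: "q \<in> A" "\<not> vanishes_at G q"
    by (auto simp: vanishing_ideal_def)
  from curve[OF p(1) q(1)] obtain c s t where c: "(\<chi> i. poly (c i) s) \<noteq> 0" "p = pt (\<chi> i. poly (c i) s)"
    "q = pt (\<chi> i. poly (c i) t)" "\<And>r. (\<chi> i. poly (c i) r) \<noteq> 0 \<Longrightarrow> pt (\<chi> i. poly (c i) r) \<in> A" by blast
  have "along c F \<noteq> 0"
    using p(2) poly_along[of c F s] unfolding c vanishes_at_pt[OF hom(1)] by auto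
  moreover have "along c G \<noteq> 0"
    using q(2) poly_along[of c G t] unfolding c vanishes_at_pt[OF hom(2)] by auto
  moreover obtain i where "poly (c i) s \<noteq> 0"
    using c(1) by (auto simp: vec_eq_iff)
  then have "c i \<noteq> 0" by auto
  ultimately have "along c F * along c G * c i \<noteq> 0" by simp
  then obtain r where r: "poly (along c F * along c G * c i) r \<noteq> 0"
    using poly_all_0_iff_0 by blast
  then have "(\<chi> i. poly (c i) r) \<noteq> 0" by (auto simp: vec_eq_iff)
  then have "vanishes_at (F * G) (pt (\<chi> i. poly (c i) r))"
    using c(4) FG by (simp add: vanishing_ideal_def)
  then show False
    using r by (simp add: vanishes_at_pt[OF homogeneous_mult[OF hom]] poly_along)
qed

lemma vanishing_ideal_add: "F \<in> vanishing_ideal A \<Longrightarrow> G \<in> vanishing_ideal A \<Longrightarrow> F + G \<in> vanishing_ideal A"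
  by (simp add: vanishing_ideal_def vanishes_at_def)

lemma vanishing_ideal_zero [simp]: "0 \<in> vanishing_ideal A"
  by (simp add: vanishing_ideal_def vanishes_at_def)

lemma vanishing_ideal_mult: "F \<in> vanishing_ideal A \<Longrightarrow> F * G \<in> vanishing_ideal A"
  by (simp add: vanishing_ideal_def vanishes_at_def)

lemma vanishing_ideal_mult': "F \<in> vanishing_ideal A \<Longrightarrow> G * F \<in> vanishing_ideal A"
  by (simp add: vanishing_ideal_def vanishes_at_def)

lemma vanishing_ideal_diff: "F \<in> vanishing_ideal A \<Longrightarrow> G \<in> vanishing_ideal A \<Longrightarrow> F - G \<in> vanishing_ideal A"
  by (simp add: vanishing_ideal_def vanishes_at_def)

lemma vanishing_ideal_scale: "F \<in> vanishing_ideal A \<Longrightarrow> mpoly_scale c F \<in> vanishing_ideal A"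
  unfolding mpoly_scale_def by (rule vanishing_ideal_mult')

lemma vanishing_ideal_antimono: "A \<subseteq> B \<Longrightarrow> vanishing_ideal B \<subseteq> vanishing_ideal A"
  by (auto simp: vanishing_ideal_def)

lemma irreducible_imp_prime_on_forms:
  fixes A :: "('a::field ^ 'm::finite) set set"
  assumes "irreducible_closedin (subtopology zariski A) Z"
  shows "prime_on_forms Z"
  unfolding prime_on_forms_def
proof (intro conjI allI impI notI)
  show "Z = {} \<Longrightarrow> False" using assms by (simp add: irreducible_closedin_def)
  have closed: "closedin (subtopology zariski A) Z" using assms by (simp add: irreducible_closedin_def)
  show sub: "Z \<subseteq> proj_space" using closedin_subset[OF closed] by auto
  fix F G :: "('a, 'm) mpoly" and s t
  assume hom: "homogeneous s F" "homogeneous t G"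
    and F: "F \<notin> vanishing_ideal Z" and G: "G \<notin> vanishing_ideal Z" and FG: "F * G \<in> vanishing_ideal Z"
  let ?V = "\<lambda>F. {p \<in> proj_space. vanishes_at F p} \<inter> A"
  have "closedin (subtopology zariski A) (?V F)" "closedin (subtopology zariski A) (?V G)"
    using closedin_zariski_vanishing hom by (auto simp: closedin_subtopology)
  moreover have "Z \<subseteq> ?V F \<union> ?V G"
    using sub closedin_subset[OF closed] FG vanishes_at_mult_iff[OF hom]
    by (auto simp: vanishing_ideal_def)
  ultimately have "Z \<subseteq> ?V F \<or> Z \<subseteq> ?V G"
    using assms unfolding irreducible_closedin_def by blast
  with F G show False by (auto simp: vanishing_ideal_def)
qed

text \<open>
  The predicate \<open>independent_forms A t k\<close> stands for the inequality \<open>H(t) \<ge> k\<close> for the Hilbert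
  function \<open>H\<close> of the closure of \<open>A\<close>, and \<open>growth_le A r\<close> for \<open>H(t) = O(t ^ r)\<close>. Families of forms are
  easier to multiply and to concatenate than dimensions of quotient spaces.
\<close>

definition independent_forms :: "('a::field ^ 'm::finite) set set \<Rightarrow> nat \<Rightarrow> nat \<Rightarrow> bool" where
  "independent_forms A t k \<longleftrightarrow> (\<exists>F :: nat \<Rightarrow> ('a, 'm) mpoly. (\<forall>i<k. homogeneous t (F i)) \<and>
     (\<forall>c. (\<Sum>i<k. mpoly_scale (c i) (F i)) \<in> vanishing_ideal A \<longrightarrow> (\<forall>i<k. c i = 0)))"

definition growth_le :: "('a::field ^ 'm::finite) set set \<Rightarrow> nat \<Rightarrow> bool" where
  "growth_le A r \<longleftrightarrow> (\<exists>C. \<forall>t k. independent_forms A t k \<longrightarrow> k \<le> C * (t + 1) ^ r)"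

lemma independent_forms_mono: "A \<subseteq> B \<Longrightarrow> independent_forms A t k \<Longrightarrow> independent_forms B t k"
  unfolding independent_forms_def using vanishing_ideal_antimono[of A B] by blast

lemma growth_le_mono: "A \<subseteq> B \<Longrightarrow> growth_le B r \<Longrightarrow> growth_le A r"
  unfolding growth_le_def using independent_forms_mono by blast

lemma sum_lessThan_add: "(\<Sum>i<k + l. f i) = (\<Sum>i<k. f i) + (\<Sum>i<l. f (k + i))"
  for f :: "nat \<Rightarrow> 'b::comm_monoid_add"
  by (induction l) (simp_all add: add.assoc)

lemma mpoly_scale_mult_right: "mpoly_scale c (F * G) = F * mpoly_scale c G"
  by (simp add: mpoly_scale_def mult.left_commute)

text \<open>
  A form \<open>F\<close> of degree \<open>e\<close> that vanishes on \<open>Z\<close> but is a nonzerodivisor on \<open>Z'\<close> yields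
  the exact sequence behind this inequality of Hilbert functions.
\<close>

lemma independent_forms_step:
  assumes "Z \<subseteq> Z'" "prime_on_forms Z'"
    and F: "homogeneous e F" "F \<in> vanishing_ideal Z" "F \<notin> vanishing_ideal Z'"
    and "independent_forms Z' t k" "independent_forms Z (e + t) l"
  shows "independent_forms Z' (e + t) (k + l)"
proof -
  from assms(6) obtain G where G: "\<And>i. i < k \<Longrightarrow> homogeneous t (G i)"
    "\<And>c. (\<Sum>i<k. mpoly_scale (c i) (G i)) \<in> vanishing_ideal Z' \<Longrightarrow> \<forall>i<k. c i = 0"
    unfolding independent_forms_def by blast
  from assms(7) obtain H where H: "\<And>i. i < l \<Longrightarrow> homogeneous (e + t) (H i)"
    "\<And>c. (\<Sum>i<l. mpoly_scale (c i) (H i)) \<in> vanishing_ideal Z \<Longrightarrow> \<forall>i<l. c i = 0"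
    unfolding independent_forms_def by blast
  define E where "E i = (if i < k then F * G i else H (i - k))" for i
  show ?thesis unfolding independent_forms_def
  proof (intro exI[of _ E] conjI allI impI)
    fix i assume "i < k + l"
    then show "homogeneous (e + t) (E i)"
      using G(1) H(1) homogeneous_mult[OF F(1)] by (auto simp: E_def)
  next
    fix c i assume *: "(\<Sum>i<k + l. mpoly_scale (c i) (E i)) \<in> vanishing_ideal Z'" and i: "i < k + l"
    let ?A = "\<Sum>i<k. mpoly_scale (c i) (G i)" and ?B = "\<Sum>i<l. mpoly_scale (c (k + i)) (H i)"
    have "(\<Sum>i<k + l. mpoly_scale (c i) (E i)) = F * ?A + ?B"
      by (simp add: sum_lessThan_add E_def mpoly_scale_mult_right sum_distrib_left)
    with * have sum: "F * ?A + ?B \<in> vanishing_ideal Z'" by simp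
    then have "F * ?A + ?B \<in> vanishing_ideal Z" using vanishing_ideal_antimono[OF assms(1)] by blast
    from vanishing_ideal_diff[OF this vanishing_ideal_mult[OF F(2), of ?A]]
    have "?B \<in> vanishing_ideal Z" by simp
    from H(2)[OF this] have B: "\<forall>i<l. c (k + i) = 0" .
    then have "?B = 0" by (simp add: mpoly_scale_def mpoly_const_def)
    with sum have "F * ?A \<in> vanishing_ideal Z'" by simp
    moreover have "homogeneous t ?A" by (intro homogeneous_sum homogeneous_scale) (use G(1) in auto)
    ultimately have "?A \<in> vanishing_ideal Z'"
      using assms(2) F unfolding prime_on_forms_def by blast
    from G(2)[OF this] show "c i = 0"
      using i B[rule_format, of "i - k"] by (cases "i < k") auto
  qed
qed

lemma independent_forms_Suc:
  assumes "prime_on_forms Z" "independent_forms Z t k"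
  shows "independent_forms Z (Suc t) k"
proof -
  from assms(1) obtain p where p: "p \<in> Z" "p \<in> proj_space" unfolding prime_on_forms_def by blast
  then obtain v where v: "v \<noteq> 0" "p = pt v" by (auto elim: proj_spaceE)
  then obtain i where "v $ i \<noteq> 0" by (auto simp: vec_eq_iff)
  with p v have "var i \<notin> vanishing_ideal Z"
    using vanishes_at_pt[of 1 "var i" v] by (auto simp: vanishing_ideal_def)
  moreover have "independent_forms {} (1 + t) 0" by (simp add: independent_forms_def)
  moreover have "var i \<in> vanishing_ideal {}" by (simp add: vanishing_ideal_def)
  ultimately have "independent_forms Z (1 + t) (k + 0)"
    using assms by (intro independent_forms_step[of "{}" Z 1 "var i"]) auto
  then show ?thesis by simp
qed

lemma independent_forms_add:
  "prime_on_forms Z \<Longrightarrow> independent_forms Z t k \<Longrightarrow> independent_forms Z (t + s) k"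
  by (induction s) (auto intro: independent_forms_Suc)

lemma independent_forms_zero_one:
  assumes "prime_on_forms Z"
  shows "independent_forms Z 0 1"
  unfolding independent_forms_def
proof (intro exI[of _ "\<lambda>_. 1"] conjI allI impI)
  fix c :: "nat \<Rightarrow> 'a" and i :: nat
  assume *: "(\<Sum>i<1. mpoly_scale (c i) 1) \<in> vanishing_ideal Z" and i: "i < 1"
  from assms obtain p where "p \<in> Z" "p \<in> proj_space" unfolding prime_on_forms_def by blast
  then have "vanishes_at (mpoly_scale (c 0) 1) p" using * by (simp add: vanishing_ideal_def)
  with \<open>p \<in> proj_space\<close> i show "c i = 0"
    by (auto elim!: proj_spaceE simp: vanishes_at_pt[OF homogeneous_scale[OF homogeneous_one]])
qed simp

text \<open>
  Passing to a proper irreducible closed subset lowers the order of growth: adding up the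
  inequality along the degrees \<open>t, t + e, t + 2 e, \<dots>\<close> gives a factor of order \<open>t\<close>.
\<close>

lemma growth_le_drop:
  assumes "Z \<subseteq> Z'" "prime_on_forms Z'" "prime_on_forms Z"
    and F: "homogeneous e F" "F \<in> vanishing_ideal Z" "F \<notin> vanishing_ideal Z'"
    and "growth_le Z' r"
  shows "r > 0 \<and> growth_le Z (r - 1)"
proof -
  from assms(7) obtain C where C: "\<And>t k. independent_forms Z' t k \<Longrightarrow> k \<le> C * (t + 1) ^ r"
    unfolding growth_le_def by blast
  have multi: "independent_forms Z' (j * e + t) (j * l)" if "independent_forms Z t l" for t l j
  proof (induction j)
    case 0
    show ?case by (simp add: independent_forms_def)
  next
    case (Suc j)
    have "independent_forms Z (e + (j * e + t)) l"
      using independent_forms_add[OF assms(3) that, of "e + j * e"] by (simp add: algebra_simps)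
    from independent_forms_step[OF assms(1,2) F Suc this] show ?case by (simp add: algebra_simps)
  qed
  \<comment> \<open>taking \<open>j = t + 1\<close> balances the factor \<open>j\<close> that is gained against the growth of the degree\<close>
  have bound: "(t + 1) * l \<le> C * (e + 1) ^ r * (t + 1) ^ r" if "independent_forms Z t l" for t l
  proof -
    have "(t + 1) * l \<le> C * ((t + 1) * e + t + 1) ^ r"
      using C[OF multi[OF that, of "t + 1"]] by simp
    also have "(t + 1) * e + t + 1 = (e + 1) * (t + 1)" by (simp add: algebra_simps)
    also have "C * ((e + 1) * (t + 1)) ^ r = C * (e + 1) ^ r * (t + 1) ^ r"
      by (simp only: power_mult_distrib mult.assoc)
    finally show ?thesis .
  qed
  have "r > 0"
  proof (rule ccontr)
    assume "\<not> r > 0"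
    then have "(C + 1) * 1 \<le> C"
      using bound[OF independent_forms_add[OF assms(3) independent_forms_zero_one[OF assms(3)], of C]] by simp
    then show False by simp
  qed
  moreover have "l \<le> C * (e + 1) ^ r * (t + 1) ^ (r - 1)" if "independent_forms Z t l" for t l
  proof -
    have "(t + 1) ^ r = (t + 1) * (t + 1) ^ (r - 1)" using \<open>r > 0\<close> by (cases r) auto
    have "(t + 1) * l \<le> C * (e + 1) ^ r * (t + 1) ^ r" by (rule bound[OF that])
    also have "\<dots> = (t + 1) * (C * (e + 1) ^ r * (t + 1) ^ (r - 1))"
      by (simp only: \<open>(t + 1) ^ r = (t + 1) * (t + 1) ^ (r - 1)\<close> mult_ac)
    finally have "(t + 1) * l \<le> (t + 1) * (C * (e + 1) ^ r * (t + 1) ^ (r - 1))" .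
    then show ?thesis by (metis Suc_eq_plus1 Suc_mult_le_cancel1)
  qed
  ultimately show ?thesis unfolding growth_le_def by blast
qed

text \<open>
  Each step down the chain lowers the order of growth by one, and the order of growth of a
  nonempty set is not negative.
\<close>

lemma chain_length_le:
  fixes A :: "('a::field ^ 'm::finite) set set"
  assumes "growth_le A r" "A \<subseteq> proj_space"
    and irr: "\<And>i. i \<le> k \<Longrightarrow> irreducible_closedin (subtopology zariski A) (Z i)"
    and strict: "\<And>i. i < k \<Longrightarrow> Z i \<subset> Z (Suc i)"
  shows "k \<le> r"
proof -
  have sub: "Z i \<subseteq> A" if "i \<le> k" for i
    using irr[OF that] closedin_subset[of "subtopology zariski A" "Z i"]
    by (auto simp: irreducible_closedin_def)
  have "j \<le> r \<and> growth_le (Z (k - j)) (r - j)" if "j \<le> k" for j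
    using that
  proof (induction j)
    case 0
    then show ?case using growth_le_mono[OF sub assms(1)] by simp
  next
    case (Suc j)
    define i where "i = k - Suc j"
    have i: "i < k" "Suc i = k - j" using Suc.prems by (auto simp: i_def)
    from strict[OF i(1)] obtain p where p: "p \<in> Z (Suc i)" "p \<notin> Z i" by blast
    have "closedin (subtopology zariski A) (Z i)" using irr[of i] i by (simp add: irreducible_closedin_def)
    then obtain C where C: "closedin zariski C" "Z i = C \<inter> A" by (auto simp: closedin_subtopology)
    have "p \<in> A" using p sub[of "Suc i"] i by auto
    then have "p \<in> proj_space" "p \<notin> C" using p C assms(2) by auto
    from closedin_zariski_separate[OF C(1) this] obtain F t where
      F: "homogeneous t F" "\<not> vanishes_at F p" "\<And>q. q \<in> C \<Longrightarrow> vanishes_at F q" by blast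
    have IH: "j \<le> r" "growth_le (Z (Suc i)) (r - j)" using Suc i by auto
    have "r - j > 0 \<and> growth_le (Z i) (r - j - 1)"
      using strict[OF i(1)] F p(1) C(2) irr[of i] irr[of "Suc i"] i IH(2)
      by (intro growth_le_drop[of "Z i" "Z (Suc i)" t F] irreducible_imp_prime_on_forms[of A])
        (auto simp: vanishing_ideal_def)
    with IH show ?case by (simp add: i_def)
  qed
  from this[of k] show ?thesis by simp
qed

lemma krull_dim_empty: "krull_dim ({} :: ('a::field ^ 'm::finite) set set) = -1"
proof -
  have "\<not> irreducible_closedin (subtopology zariski {}) (Z :: ('a::field ^ 'm::finite) set set)" for Z
    using closedin_subset[of "subtopology zariski {}" Z] by (auto simp: irreducible_closedin_def)
  then have "{int k | k. \<exists>Z. (\<forall>i\<le>k. irreducible_closedin (subtopology zariski {})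
      (Z i :: ('a::field ^ 'm::finite) set set)) \<and> (\<forall>i<k. Z i \<subset> Z (Suc i))} = {}"
    by blast
  then show ?thesis unfolding krull_dim_def by (simp only: cSup_singleton)
qed

text \<open>
  Two closed sets that cover \<open>B\<close> without containing it are separated from points of \<open>B\<close> by forms whose
  product would vanish on \<open>B\<close>. Passing to the closure spares the proof that a parametrised set is closed.
\<close>

lemma irreducible_closedin_closure:
  fixes A :: "('a::field ^ 'm::finite) set set"
  assumes "A \<subseteq> proj_space" "prime_on_forms B" "B \<subseteq> A"
  shows "irreducible_closedin (subtopology zariski A) (A \<inter> zariski closure_of B)"
  unfolding irreducible_closedin_def
proof (intro conjI allI impI)
  let ?Z = "A \<inter> zariski closure_of B"
  have inZ: "B \<subseteq> ?Z" using assms closure_of_subset[of B zariski] by auto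
  show "closedin (subtopology zariski A) ?Z"
    unfolding closedin_subtopology by (metis closedin_closure_of inf_commute)
  show "?Z \<noteq> {}" using inZ assms(2) by (auto simp: prime_on_forms_def)
  fix A1 A2 assume A: "closedin (subtopology zariski A) A1 \<and> closedin (subtopology zariski A) A2 \<and> ?Z \<subseteq> A1 \<union> A2"
  then obtain C1 C2 where C: "closedin zariski C1" "A1 = C1 \<inter> A" "closedin zariski C2" "A2 = C2 \<inter> A"
    by (auto simp: closedin_subtopology)
  have "B \<subseteq> C1 \<or> B \<subseteq> C2"
  proof (rule ccontr)
    assume "\<not> ?thesis"
    then obtain b1 b2 where b: "b1 \<in> B" "b1 \<notin> C1" "b2 \<in> B" "b2 \<notin> C2" by blast
    then have "b1 \<in> proj_space" "b2 \<in> proj_space" using assms by auto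
    with b C obtain F1 t1 F2 t2 where
      F1: "homogeneous t1 F1" "\<not> vanishes_at F1 b1" "\<And>q. q \<in> C1 \<Longrightarrow> vanishes_at F1 q" and
      F2: "homogeneous t2 F2" "\<not> vanishes_at F2 b2" "\<And>q. q \<in> C2 \<Longrightarrow> vanishes_at F2 q"
      using closedin_zariski_separate by metis
    then have "F1 * F2 \<notin> vanishing_ideal B"
      using assms(2) b unfolding prime_on_forms_def vanishing_ideal_def by blast
    then obtain b where "b \<in> B" "\<not> vanishes_at (F1 * F2) b" by (auto simp: vanishing_ideal_def)
    then have "\<not> vanishes_at F1 b" "\<not> vanishes_at F2 b" by (auto simp: vanishes_at_def)
    with F1(3) F2(3) have "b \<notin> C1" "b \<notin> C2" by auto
    moreover have "b \<in> C1 \<union> C2" using A C inZ \<open>b \<in> B\<close> by auto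
    ultimately show False by blast
  qed
  then show "?Z \<subseteq> A1 \<or> ?Z \<subseteq> A2"
    using C closure_of_minimal[of B C1 zariski] closure_of_minimal[of B C2 zariski] by auto
qed

text \<open>
  The upper bound is the order of growth. For the lower bound, the separating forms keep the closures
  of the sets \<open>B j\<close> distinct.
\<close>

lemma krull_dim_eqI:
  fixes A :: "('a::field ^ 'm::finite) set set"
  assumes "growth_le A r" "A \<subseteq> proj_space"
    and B: "\<And>j. j \<le> r \<Longrightarrow> prime_on_forms (B j)" "\<And>j. j \<le> r \<Longrightarrow> B j \<subseteq> A"
    and mono: "\<And>j. j < r \<Longrightarrow> B j \<subseteq> B (Suc j)"
    and sep: "\<And>j. j < r \<Longrightarrow> \<exists>F t. homogeneous t F \<and> F \<in> vanishing_ideal (B j) \<and> F \<notin> vanishing_ideal (B (Suc j))"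
  shows "krull_dim A = int r"
proof -
  define Z where "Z j = A \<inter> zariski closure_of (B j)" for j
  have inZ: "B j \<subseteq> Z j" if "j \<le> r" for j
    using B(2)[OF that] assms(2) closure_of_subset[of "B j" zariski] by (auto simp: Z_def)
  have irr: "irreducible_closedin (subtopology zariski A) (Z j)" if j: "j \<le> r" for j
    unfolding Z_def by (rule irreducible_closedin_closure[OF assms(2) B[OF j]])
  have strict: "Z j \<subset> Z (Suc j)" if j: "j < r" for j
  proof
    show "Z j \<subseteq> Z (Suc j)" using closure_of_mono[OF mono[OF j], of zariski] by (auto simp: Z_def)
    from sep[OF j] obtain F t where F: "homogeneous t F" "F \<in> vanishing_ideal (B j)" "F \<notin> vanishing_ideal (B (Suc j))"
      by blast
    then obtain b where b: "b \<in> B (Suc j)" "\<not> vanishes_at F b" by (auto simp: vanishing_ideal_def)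
    have "zariski closure_of (B j) \<subseteq> {p \<in> proj_space. vanishes_at F p}"
      using F(2) B(2)[of j] assms(2) j
      by (intro closure_of_minimal closedin_zariski_vanishing[OF F(1)]) (auto simp: vanishing_ideal_def)
    with b have "b \<notin> Z j" by (auto simp: Z_def)
    moreover have "b \<in> Z (Suc j)" using inZ[of "Suc j"] j b by auto
    ultimately show "Z j \<noteq> Z (Suc j)" by blast
  qed
  show ?thesis unfolding krull_dim_def
  proof (rule cSup_eq_maximum)
    show "int r \<in> insert (-1) {int k | k. \<exists>Z. (\<forall>i\<le>k. irreducible_closedin (subtopology zariski A) (Z i)) \<and>
        (\<forall>i<k. Z i \<subset> Z (Suc i))}"
      using irr strict by blast
  next
    fix x assume "x \<in> insert (-1) {int k | k. \<exists>Z. (\<forall>i\<le>k. irreducible_closedin (subtopology zariski A) (Z i)) \<and>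
        (\<forall>i<k. Z i \<subset> Z (Suc i))}"
    moreover have "k \<le> r" if "\<forall>i\<le>k. irreducible_closedin (subtopology zariski A) (Z i)"
        "\<forall>i<k. Z i \<subset> Z (Suc i)" for k Z
      using chain_length_le[OF assms(1,2), of k Z] that by blast
    ultimately show "x \<le> int r" by auto
  qed
qed

text \<open>
  A form of degree \<open>t\<close> vanishes on the parametrised set if its pullback is zero, so more forms than there
  are monomials in the pullbacks cannot be independent on this set.
\<close>

lemma growth_le_parametrized:
  fixes \<psi> :: "'m::finite \<Rightarrow> ('a::field, 'p::finite) mpoly"
  assumes par: "\<And>p. p \<in> A \<Longrightarrow> \<exists>v. p = pt (\<chi> i. mpoly_eval (\<psi> i) v)"
    and M: "\<And>t. finite (M t)" "\<And>t. card (M t) \<le> C * (t + 1) ^ r"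
    and pullback: "\<And>F t. homogeneous t F \<Longrightarrow> keys (compose \<psi> F) \<subseteq> M t"
  shows "growth_le A r"
proof -
  have "k \<le> card (M t)" if "independent_forms A t k" for t k
  proof (rule ccontr)
    assume k: "\<not> k \<le> card (M t)"
    from that obtain F where F: "\<And>i. i < k \<Longrightarrow> homogeneous t (F i)"
      and indep: "\<And>c. (\<Sum>i<k. mpoly_scale (c i) (F i)) \<in> vanishing_ideal A \<Longrightarrow> \<forall>i<k. c i = 0"
      unfolding independent_forms_def by blast
    define G where "G i = compose \<psi> (F i)" for i
    have vanish: "(\<Sum>i<k. mpoly_scale (c i) (F i)) \<in> vanishing_ideal A"
      if "(\<Sum>i<k. mpoly_scale (c i) (G i)) = 0" for c
    proof -
      let ?H = "\<Sum>i<k. mpoly_scale (c i) (F i)"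
      have "compose \<psi> ?H = 0"
        using that by (simp add: G_def mpoly_scale_def coeff_const.subst_sum coeff_const.subst_mult)
      then have zero: "mpoly_eval ?H (\<chi> i. mpoly_eval (\<psi> i) v) = 0" for v
        using mpoly_eval_compose[of \<psi> ?H v] by simp
      have "homogeneous t ?H" using F by (intro homogeneous_sum homogeneous_scale) auto
      then show ?thesis
        unfolding vanishing_ideal_def using par zero by (fastforce simp: vanishes_at_pt)
    qed
    have inj: "inj_on G {..<k}"
    proof (rule inj_onI, rule ccontr)
      fix a b assume ab: "a \<in> {..<k}" "b \<in> {..<k}" "G a = G b" "a \<noteq> b"
      define c where "c i = (if i = a then 1 else if i = b then - 1 else 0 :: 'a)" for i
      have "(\<Sum>i<k. mpoly_scale (c i) (G i)) = (\<Sum>i\<in>{a, b}. mpoly_scale (c i) (G i))"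
        using ab by (intro sum.mono_neutral_right) (auto simp: c_def mpoly_scale_def mpoly_const_def)
      also have "\<dots> = 0"
        using ab by (simp add: c_def mpoly_scale_def mpoly_const_def single_uminus)
      finally have "\<forall>i<k. c i = 0" by (intro indep vanish)
      with ab show False by (auto simp: c_def)
    qed
    have "mpoly.independent (G ` {..<k})"
      unfolding mpoly.dependent_finite[OF finite_imageI[OF finite_lessThan]]
    proof safe
      fix u x assume *: "x < k" "(\<Sum>v\<in>G ` {..<k}. mpoly_scale (u v) v) = 0" "u (G x) \<noteq> 0"
      then have "(\<Sum>i<k. mpoly_scale (u (G i)) (G i)) = 0" by (simp add: sum.reindex[OF inj] o_def)
      from indep[OF vanish[OF this]] * show False by blast
    qed
    moreover have "G ` {..<k} \<subseteq> mpoly.span ((\<lambda>m. single m 1) ` M t)"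
    proof safe
      fix i assume "i < k"
      have "G i = (\<Sum>m\<in>keys (G i). mpoly_scale (lookup (G i) m) (single m 1))"
        by (subst mpoly_sum_singles) (simp add: mpoly_scale_def mpoly_const_def mult_single)
      also have "\<dots> \<in> mpoly.span ((\<lambda>m. single m 1) ` M t)"
        using pullback[OF F[OF \<open>i < k\<close>]]
        by (intro mpoly.span_sum mpoly.span_scale mpoly.span_base) (auto simp: G_def)
      finally show "G i \<in> mpoly.span ((\<lambda>m. single m 1) ` M t)" .
    qed
    ultimately have "card (G ` {..<k}) \<le> card ((\<lambda>m. single m (1::'a)) ` M t)"
      using mpoly.independent_span_bound[OF finite_imageI[OF M(1)]] by blast
    also have "\<dots> \<le> card (M t)" by (rule card_image_le[OF M(1)])
    finally show False using k card_image[OF inj] by simp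
  qed
  then show ?thesis unfolding growth_le_def using M(2) order_trans by blast
qed

lemma prime_on_forms_singleton:
  assumes "p \<in> proj_space"
  shows "prime_on_forms {p}"
  using assms by (simp add: prime_on_forms_def vanishing_ideal_def vanishes_at_mult_iff)

lemma separating_linear_form:
  fixes p q :: "('a::field ^ 'm::finite) set"
  assumes "p \<in> proj_space" "q \<in> proj_space" "p \<noteq> q"
  obtains F where "homogeneous 1 F" "vanishes_at F p" "\<not> vanishes_at F q"
proof -
  obtain v w where v: "v \<noteq> 0" "p = pt v" and w: "w \<noteq> 0" "q = pt w"
    using assms by (auto elim!: proj_spaceE)
  obtain i where i: "v $ i \<noteq> 0" using v by (auto simp: vec_eq_iff)
  have "\<exists>j. v $ i * w $ j \<noteq> v $ j * w $ i"
  proof (rule ccontr)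
    assume "\<nexists>j. v $ i * w $ j \<noteq> v $ j * w $ i"
    then have eq: "w = (w $ i / v $ i) *s v" using i by (auto simp: vec_eq_iff field_simps)
    with w(1) have "w $ i / v $ i \<noteq> 0" by auto
    then have "pt w = pt v" using eq by (metis pt_scale)
    with assms(3) v w show False by simp
  qed
  then obtain j where j: "v $ i * w $ j \<noteq> v $ j * w $ i" by blast
  define F :: "('a, 'm) mpoly" where "F = mpoly_scale (v $ i) (var j) - mpoly_scale (v $ j) (var i)"
  have "homogeneous 1 F" by (simp add: F_def homogeneous_diff homogeneous_scale)
  with v w j show ?thesis
    by (intro that[of F]) (simp_all add: vanishes_at_pt F_def)
qed

text \<open>
  Distinct points of a finite set are separated by products of linear forms, so the set is not
  irreducible unless it has a single point.
\<close>

lemma prime_on_forms_finite: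
  fixes Z :: "('a::field ^ 'm::finite) set set"
  assumes "finite Z" "prime_on_forms Z" "p \<in> Z" "q \<in> Z"
  shows "p = q"
proof (rule ccontr)
  assume ne: "p \<noteq> q"
  have sub: "Z \<subseteq> proj_space" using assms(2) by (simp add: prime_on_forms_def)
  have "\<exists>F. homogeneous 1 F \<and> vanishes_at F z \<and> \<not> vanishes_at F p" if "z \<in> Z - {p}" for z
    using separating_linear_form[of z p] that sub assms(3) by blast
  then obtain f where f: "\<And>z. z \<in> Z - {p} \<Longrightarrow> homogeneous 1 (f z) \<and> vanishes_at (f z) z \<and> \<not> vanishes_at (f z) p"
    by metis
  have "homogeneous (card S) (prod f S) \<and> \<not> vanishes_at (prod f S) p \<and> (\<forall>z\<in>S. vanishes_at (prod f S) z)"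
    if "finite S" "S \<subseteq> Z - {p}" for S
    using that
  proof (induction S)
    case empty
    then show ?case using not_vanishes_at_one assms(3) sub by auto
  next
    case (insert x S)
    then have IH: "homogeneous (card S) (prod f S)" "\<not> vanishes_at (prod f S) p" "\<forall>z\<in>S. vanishes_at (prod f S) z"
      and x: "homogeneous 1 (f x)" "vanishes_at (f x) x" "\<not> vanishes_at (f x) p" using f[of x] by auto
    have "\<not> vanishes_at (f x * prod f S) p"
      using vanishes_at_mult_iff[OF x(1) IH(1)] assms(3) sub x IH by auto
    moreover have "homogeneous (Suc (card S)) (f x * prod f S)" using homogeneous_mult[OF x(1) IH(1)] by simp
    moreover have "\<forall>z\<in>insert x S. vanishes_at (f x * prod f S) z"
      using x(2) IH(3) by (auto simp: vanishes_at_def)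
    ultimately show ?case using insert by simp
  qed
  from this[of "Z - {p}"] assms(1) have P: "homogeneous (card (Z - {p})) (prod f (Z - {p}))"
    "\<not> vanishes_at (prod f (Z - {p})) p" "\<forall>z\<in>Z - {p}. vanishes_at (prod f (Z - {p})) z" by auto
  obtain G where G: "homogeneous 1 G" "vanishes_at G p" "\<not> vanishes_at G q"
    using separating_linear_form[of p q] ne assms sub by blast
  have "prod f (Z - {p}) * G \<notin> vanishing_ideal Z"
    using assms(2-4) P(1,2) G(1,3) unfolding prime_on_forms_def vanishing_ideal_def by blast
  moreover have "prod f (Z - {p}) * G \<in> vanishing_ideal Z"
    using P(3) G(2) by (auto simp: vanishing_ideal_def vanishes_at_def)
  ultimately show False by blast
qed

lemma krull_dim_finite:
  fixes A :: "('a::field ^ 'm::finite) set set"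
  assumes "finite A" "A \<noteq> {}" "A \<subseteq> proj_space"
  shows "krull_dim A = 0"
  unfolding krull_dim_def
proof (rule cSup_eq_maximum)
  obtain p where p: "p \<in> A" using assms(2) by blast
  then have "irreducible_closedin (subtopology zariski A) (A \<inter> zariski closure_of {p})"
    using assms(3) by (intro irreducible_closedin_closure prime_on_forms_singleton) auto
  then have "\<exists>Z. (\<forall>i\<le>0. irreducible_closedin (subtopology zariski A) (Z i)) \<and> (\<forall>i<0. Z i \<subset> Z (Suc i))"
    by (intro exI[of _ "\<lambda>_. A \<inter> zariski closure_of {p}"]) simp
  then show "0 \<in> insert (-1) {int k | k. \<exists>Z. (\<forall>i\<le>k. irreducible_closedin (subtopology zariski A) (Z i)) \<and>
      (\<forall>i<k. Z i \<subset> Z (Suc i))}" by force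
next
  fix x assume "x \<in> insert (-1) {int k | k. \<exists>Z. (\<forall>i\<le>k. irreducible_closedin (subtopology zariski A) (Z i)) \<and>
      (\<forall>i<k. Z i \<subset> Z (Suc i))}"
  moreover have "k = 0" if irr: "\<And>i. i \<le> k \<Longrightarrow> irreducible_closedin (subtopology zariski A) (Z i)"
    and strict: "\<And>i. i < k \<Longrightarrow> Z i \<subset> Z (Suc i)" for k Z
  proof (rule ccontr)
    assume "k \<noteq> 0"
    then have k: "0 < k" "Suc 0 \<le> k" "0 \<le> k" by auto
    have "Z (Suc 0) \<subseteq> A"
      using irr[OF k(2)] closedin_subset[of "subtopology zariski A" "Z (Suc 0)"]
      by (auto simp: irreducible_closedin_def)
    then have fin: "finite (Z (Suc 0))" using assms(1) finite_subset by blast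
    from irr[OF k(3)] obtain a where "a \<in> Z 0" by (auto simp: irreducible_closedin_def)
    moreover from strict[OF k(1)] obtain b where "b \<in> Z (Suc 0)" "b \<notin> Z 0" by blast
    ultimately show False
      using prime_on_forms_finite[OF fin irreducible_imp_prime_on_forms[OF irr[OF k(2)]], of a b] strict[OF k(1)]
      by auto
  qed
  ultimately show "x \<le> 0" by fastforce
qed

section \<open>The Veronese variety and its tangent spaces\<close>

definition veronese_vector :: "('m::finite \<Rightarrow> 'k::finite monom) \<Rightarrow> 'a::comm_ring_1 ^ 'k \<Rightarrow> 'a ^ 'm" where
  "veronese_vector mon u = (\<chi> i. monom_eval (($) u) (mon i))"

text \<open>
  The curve \<open>\<phi> (u + T w)\<close>, whose coordinates are polynomials in \<open>T\<close>. Identities between its coordinates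
  give the equations of \<open>X\<close> in degree zero and the equations of the tangent spaces in degree one.
\<close>

definition veronese_curve ::
    "('m::finite \<Rightarrow> 'k::finite monom) \<Rightarrow> 'a::comm_ring_1 ^ 'k \<Rightarrow> 'a ^ 'k \<Rightarrow> 'm \<Rightarrow> 'a poly" where
  "veronese_curve mon u w i = monom_eval (\<lambda>j. [:u $ j, w $ j:]) (mon i)"

definition tangent_vector ::
    "('m::finite \<Rightarrow> 'k::finite monom) \<Rightarrow> 'a::comm_ring_1 ^ 'k \<Rightarrow> 'a ^ 'k \<Rightarrow> 'a ^ 'm" where
  "tangent_vector mon u w = (\<chi> i. coeff (veronese_curve mon u w i) 1)"

definition quadric :: "'m \<Rightarrow> 'm \<Rightarrow> 'm \<Rightarrow> 'm \<Rightarrow> ('a::comm_ring_1, 'm::finite) mpoly" where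
  "quadric i j k l = var i * var j - var k * var l"

lemma homogeneous_quadric: "homogeneous 2 (quadric i j k l)"
  unfolding quadric_def using homogeneous_mult[OF homogeneous_var(1) homogeneous_var(1)]
  by (intro homogeneous_diff) (simp_all add: numeral_2_eq_2)

lemma mpoly_eval_quadric [simp]: "mpoly_eval (quadric i j k l) y = y $ i * y $ j - y $ k * y $ l"
  by (simp add: quadric_def)

lemma coeff_1_linear_power: "coeff ([:a, b:] ^ k) (Suc 0) = of_nat k * a ^ (k - 1) * (b :: 'a::comm_ring_1)"
proof (induction k)
  case (Suc k)
  have "coeff ([:a, b:] ^ k) 0 = a ^ k" by (simp add: coeff_0_power)
  then show ?case using Suc by (cases k) (simp_all add: coeff_1_mult algebra_simps del: mult_pCons_left)
qed simp

lemma tangent_vector_zero_left: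
  fixes w :: "'a::comm_ring_1 ^ 'k::finite"
  shows "(\<And>i. mdegree (mon i) \<ge> 2) \<Longrightarrow> tangent_vector mon 0 w = 0"
proof -
  assume deg: "\<And>i. mdegree (mon i) \<ge> 2"
  have "coeff (monom_eval (\<lambda>j. [:(0::'a), w $ j:]) (mon i)) 1 = 0" for i
  proof -
    from deg[of i] obtain e where "mdegree (mon i) = Suc (Suc e)" by (metis Suc_le_D numeral_2_eq_2 Suc_le_mono)
    then obtain j m where m: "mon i = single j 1 + m" "mdegree m = Suc e"
      by (rule monom_split_mdegree)
    then obtain j' m' where m': "m = single j' 1 + m'" by (metis monom_split_mdegree)
    show ?thesis by (simp add: m m' monom_eval_add coeff_1_mult)
  qed
  then show ?thesis by (simp add: tangent_vector_def veronese_curve_def vec_eq_iff)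
qed

lemma coeff_veronese_curve_0: "coeff (veronese_curve mon u w i) 0 = veronese_vector mon u $ i"
  by (simp add: veronese_curve_def veronese_vector_def coeff_monom_eval_0)

lemma coeff_veronese_curve_1 [simp]: "coeff (veronese_curve mon u w i) (Suc 0) = tangent_vector mon u w $ i"
  by (simp add: tangent_vector_def)

lemma poly_veronese_curve: "(\<chi> i. poly (veronese_curve mon u w i) t) = veronese_vector mon (u + t *s w)"
proof -
  have "(\<lambda>j. u $ j + t * w $ j) = ($) (u + t *s w)" by (auto simp: mult.commute)
  then show ?thesis by (simp add: veronese_curve_def veronese_vector_def poly_monom_eval)
qed

lemma veronese_curve_quadric:
  assumes "mon i + mon j = mon k + mon l"
  shows "veronese_curve mon u w i * veronese_curve mon u w j = veronese_curve mon u w k * veronese_curve mon u w l"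
  using assms by (simp add: veronese_curve_def flip: monom_eval_add)

lemma veronese_vector_quadric:
  assumes "mon i + mon j = mon k + mon l"
  shows "veronese_vector mon u $ i * veronese_vector mon u $ j = veronese_vector mon u $ k * veronese_vector mon u $ l"
  using assms by (simp add: veronese_vector_def flip: monom_eval_add)

lemma tangent_vector_quadric:
  assumes "mon i + mon j = mon k + mon l"
  shows "veronese_vector mon u $ i * tangent_vector mon u w $ j + tangent_vector mon u w $ i * veronese_vector mon u $ j
       = veronese_vector mon u $ k * tangent_vector mon u w $ l + tangent_vector mon u w $ k * veronese_vector mon u $ l"
  using arg_cong[OF veronese_curve_quadric[OF assms], of "\<lambda>p. coeff p (Suc 0)" u w]
  by (simp only: coeff_1_mult coeff_veronese_curve_0 coeff_veronese_curve_1)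

lemma tangent_vector_sum:
  "tangent_vector mon u w $ i = (\<Sum>j\<in>UNIV. of_nat (lookup (mon i) j) *
     monom_eval (($) u) (mon i - single j 1) * w $ j)"
  by (simp add: tangent_vector_def veronese_curve_def monom_eval_linear_coeff del: One_nat_def)

lemma tangent_vector_add: "tangent_vector mon u (w + w') = tangent_vector mon u w + tangent_vector mon u w'"
  by (simp add: vec_eq_iff tangent_vector_sum algebra_simps sum.distrib)

lemma tangent_vector_scale: "tangent_vector mon u (c *s w) = c *s tangent_vector mon u w"
  by (simp add: vec_eq_iff tangent_vector_sum algebra_simps sum_distrib_left)

text \<open>
  The assumption on the number of variables excludes the case that \<open>X\<close> is a single point, which has no
  secant lines.
\<close>

locale veronese_monomials =
  fixes mon :: "'m::finite \<Rightarrow> 'k::finite monom" and d :: nat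
  assumes bij: "bij_betw mon UNIV {m. mdegree m = d}" and d_ge_2: "2 \<le> d"
    and two_variables: "CARD('k) \<ge> 2"
begin

abbreviation \<phi> :: "'a::comm_ring_1 ^ 'k \<Rightarrow> 'a ^ 'm" where "\<phi> \<equiv> veronese_vector mon"
abbreviation \<tau> :: "'a::comm_ring_1 ^ 'k \<Rightarrow> 'a ^ 'k \<Rightarrow> 'a ^ 'm" where "\<tau> \<equiv> tangent_vector mon"
abbreviation X :: "('a::field ^ 'm) set set" where "X \<equiv> veronese_variety mon"

definition idx :: "'k monom \<Rightarrow> 'm" where "idx = inv mon"

lemma mdegree_mon [simp]: "mdegree (mon i) = d"
  using bij by (auto simp: bij_betw_def)

lemma idx_mon [simp]: "idx (mon i) = i"
  using bij by (simp add: idx_def bij_betw_def)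

lemma mon_idx [simp]: "mdegree m = d \<Longrightarrow> mon (idx m) = m"
  using bij unfolding idx_def bij_betw_def by (metis (mono_tags, lifting) f_inv_into_f mem_Collect_eq)

lemma veronese_nth: "mdegree m = d \<Longrightarrow> \<phi> u $ idx m = monom_eval (($) u) m"
  by (simp add: veronese_vector_def)

lemma tangent_nth: "mdegree m = d \<Longrightarrow> \<tau> u w $ idx m = coeff (monom_eval (\<lambda>j. [:u $ j, w $ j:]) m) 1"
  by (simp add: tangent_vector_def veronese_curve_def)

lemma veronese_scale: "\<phi> (c *s u) = c ^ d *s \<phi> u"
  by (simp add: vec_eq_iff veronese_vector_def vector_scalar_mult_def monom_eval_mult monom_eval_const
      del: vec_lambda_eta)

lemma veronese_zero [simp]: "\<phi> 0 = 0"
proof -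
  have "\<phi> (0 *s 0) = (0::'a) ^ d *s \<phi> 0" by (rule veronese_scale)
  moreover have "(0::'a) ^ d = 0" using d_ge_2 by (cases d) simp_all
  ultimately show ?thesis by simp
qed

lemma tangent_zero_left [simp]: "\<tau> 0 w = 0"
  using d_ge_2 by (intro tangent_vector_zero_left) simp

lemma veronese_eq_0_iff [simp]: "\<phi> u = 0 \<longleftrightarrow> u = (0 :: 'a::field ^ 'k)"
proof
  assume zero: "\<phi> u = 0"
  show "u = 0" unfolding vec_eq_iff
  proof
    fix j
    have "\<phi> u $ idx (single j d) = u $ j ^ d" by (simp add: veronese_nth)
    with zero d_ge_2 show "u $ j = 0 $ j" by simp
  qed
qed simp

lemma tangent_self: "\<tau> u u = of_nat d *s \<phi> u"
proof -
  have "coeff (monom_eval (\<lambda>j. [:u $ j, u $ j:]) m) 1 = of_nat (mdegree m) * monom_eval (($) u) m" for m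
    by (induction m rule: monom_induct) (simp_all add: monom_eval_add coeff_1_mult coeff_monom_eval_0 algebra_simps)
  then show ?thesis by (simp add: vec_eq_iff tangent_vector_def veronese_curve_def veronese_vector_def)
qed

lemma veronese_variety_eq: "X = {pt (\<phi> u) | u. u \<noteq> (0 :: 'a::field ^ 'k)}"
proof -
  have "monomial_map mon (pt u) = pt (\<phi> u)" for u :: "'a ^ 'k"
  proof -
    have "(\<lambda>v. \<chi> i. monom_eval (($) v) (mon i)) ` pt u = \<phi> ` pt u"
      by (simp add: veronese_vector_def)
    also have "\<dots> = range (\<lambda>c. c ^ d *s \<phi> u)" by (simp add: pt_def' veronese_scale image_image)
    finally have eq: "monomial_map mon (pt u) = vec.span (range (\<lambda>c. c ^ d *s \<phi> u))"
      by (simp add: monomial_map_def)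
    have "1 ^ d *s \<phi> u \<in> range (\<lambda>c. c ^ d *s \<phi> u)" by blast
    then have "\<phi> u \<in> vec.span (range (\<lambda>c. c ^ d *s \<phi> u))" by (intro vec.span_base) simp
    moreover have "range (\<lambda>c. c ^ d *s \<phi> u) \<subseteq> pt (\<phi> u)" by (auto simp: pt_def')
    ultimately show ?thesis unfolding eq by (subst vec.span_eq) auto
  qed
  then show ?thesis unfolding veronese_variety_def proj_space_def by auto
qed

lemma veronese_in_X [simp]: "pt (\<phi> u) \<in> X \<longleftrightarrow> u \<noteq> 0"
proof
  assume "pt (\<phi> u) \<in> X"
  then have "pt (\<phi> u) \<in> proj_space" unfolding veronese_variety_eq by (auto simp del: pt_in_proj_space) simp
  then show "u \<noteq> 0" by simp
qed (auto simp: veronese_variety_eq)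

lemma veronese_varietyE:
  assumes "x \<in> X"
  obtains u where "u \<noteq> 0" "x = pt (\<phi> u)"
  using assms unfolding veronese_variety_eq by blast

lemma X_subset_proj_space: "X \<subseteq> proj_space"
  by (auto elim!: veronese_varietyE)

lemma vanishes_on_veronese:
  assumes "F \<in> vanishing_ideal X"
  shows "mpoly_eval F (c *s \<phi> u) = (0 :: 'a::field)"
proof -
  obtain u' :: "'a ^ 'k" where u': "u' \<noteq> 0" "u \<noteq> 0 \<Longrightarrow> u' = u"
    by (metis one_neq_zero vec_eq_iff vec_lambda_beta zero_index)
  have "vanishes_at F (pt (\<phi> u'))" using assms u' by (simp add: vanishing_ideal_def)
  moreover have "c *s \<phi> u \<in> pt (\<phi> u')"
    using u' by (cases "u = 0") (auto simp: pt_def' vec.span_zero)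
  ultimately show ?thesis by (simp add: vanishes_at_def)
qed

lemma quadric_in_ideal:
  assumes "mon i + mon j = mon k + mon l"
  shows "quadric i j k l \<in> vanishing_ideal (X :: ('a::field ^ 'm) set set)"
  unfolding vanishing_ideal_def
proof clarify
  fix x :: "('a ^ 'm) set" assume "x \<in> X"
  then obtain u where "x = pt (\<phi> u)" by (rule veronese_varietyE)
  then show "vanishes_at (quadric i j k l) x"
    by (simp add: vanishes_at_pt[OF homogeneous_quadric] veronese_vector_quadric[OF assms])
qed

text \<open>
  The relations \<open>(x\<^sub>j x\<^sub>b r)\<^sup>2 = (x\<^sub>j\<^sup>2 r) (x\<^sub>b\<^sup>2 r)\<close> show that a coordinate belonging to a pure power \<open>x\<^sub>j\<^sup>d\<close> is nonzero; then \<open>u\<close> is read off from the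
  coordinates belonging to \<open>x\<^sub>j\<^sup>d\<^sup>-\<^sup>1 x\<^sub>b\<close>, and the quadrics determine the other coordinates by recursion.
\<close>

lemma veronese_variety_cut_out_by_quadrics:
  fixes y :: "'a::field ^ 'm"
  assumes "y \<noteq> 0" and quad: "\<And>i j k l. mon i + mon j = mon k + mon l \<Longrightarrow> y $ i * y $ j = y $ k * y $ l"
  shows "pt y \<in> X"
proof -
  define Y where "Y m = y $ idx m" for m
  have rel: "Y a * Y b = Y a' * Y b'"
    if "a + b = a' + b'" "mdegree a = d" "mdegree b = d" "mdegree a' = d" "mdegree b' = d" for a b a' b'
    unfolding Y_def by (rule quad) (use that in simp)
  define S where "S = {(i, j). y $ i \<noteq> 0 \<and> lookup (mon i) j > 0}"
  obtain i0 where i0: "y $ i0 \<noteq> 0" using assms(1) by (auto simp: vec_eq_iff)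
  obtain j0 m0 where "mon i0 = single j0 1 + m0"
    using monom_split_mdegree[of "mon i0" "d - 1"] d_ge_2 by fastforce
  then have "(i0, j0) \<in> S" using i0 by (simp add: S_def lookup_add)
  then have S: "finite S" "S \<noteq> {}" by auto
  define f where "f = (\<lambda>(i, j). lookup (mon i) j)"
  \<comment> \<open>among the nonzero coordinates, choose one with the largest possible exponent of a variable\<close>
  have "Max (f ` S) \<in> f ` S" using S by simp
  then obtain i j where ij: "(i, j) \<in> S" "f (i, j) = Max (f ` S)" by fastforce
  then have max: "f s \<le> f (i, j)" if "s \<in> S" for s using that S by simp
  have "mon i = single j d"
  proof (rule ccontr)
    assume ne: "mon i \<noteq> single j d"
    from ij obtain m where m: "mon i = single j 1 + m"
      by (metis (mono_tags, lifting) S_def case_prodD mem_Collect_eq monom_split_variable)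
    have "\<exists>b. b \<noteq> j \<and> lookup m b > 0"
    proof (rule ccontr)
      assume *: "\<not> ?thesis"
      have "m = single j (lookup m j)"
        by (rule poly_mapping_eqI) (use * in \<open>auto simp: lookup_single when_def\<close>)
      then obtain k where "mon i = single j (1 + k)" using m by (metis single_add)
      then show False using ne mdegree_mon[of i] by simp
    qed
    then obtain b where b: "b \<noteq> j" "lookup m b > 0" by blast
    then obtain r where r: "m = single b 1 + r" by (metis monom_split_variable)
    let ?m1 = "single j 1 + (single j 1 + r)"
      and ?m2 = "single b 1 + (single b 1 + r)"
    have deg: "mdegree r + 2 = d" using mdegree_mon[of i] m r by simp
    have "Y (mon i) * Y (mon i) = Y ?m1 * Y ?m2"
      by (rule rel) (use deg in \<open>simp_all add: m r add_ac\<close>)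
    then have "Y ?m1 \<noteq> 0" using ij(1) by (auto simp: Y_def S_def)
    then have "(idx ?m1, j) \<in> S" using deg by (simp add: S_def Y_def lookup_add)
    from max[OF this] have "lookup ?m1 j \<le> lookup (mon i) j"
      using deg by (simp add: f_def)
    then show False using b by (simp add: m r lookup_add lookup_single when_def)
  qed
  then have Y0: "Y (single j d) \<noteq> 0" using ij(1) by (simp add: S_def Y_def) (metis idx_mon)
  define c where "c = Y (single j d)"
  define u where "u = (\<chi> b. Y (single j (d - 1) + single b 1) / c)"
  have claim: "Y (single j (d - mdegree m) + m) = c * monom_eval (($) u) m" if "mdegree m \<le> d" for m
    using that
  proof (induction m rule: monom_induct)
    case 0
    then show ?case by (simp add: c_def)
  next
    case (add b m)
    let ?e = "mdegree m"
    have s: "single j (d - ?e) = single j (d - Suc ?e) + single j (1 :: nat)"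
      "single j d = single j (d - 1) + single j (1 :: nat)"
      using add.prems d_ge_2 by (simp_all add: Suc_diff_Suc flip: single_add)
    have "Y (single j d) * Y (single j (d - Suc ?e) + (single b 1 + m))
        = Y (single j (d - 1) + single b 1) * Y (single j (d - ?e) + m)"
      by (rule rel) (use add.prems d_ge_2 in \<open>simp_all add: s add_ac\<close>)
    moreover have "Y (single j (d - 1) + single b 1) = c * u $ b"
      using Y0 by (simp add: u_def c_def)
    moreover have "Y (single j (d - ?e) + m) = c * monom_eval (($) u) m"
      using add by simp
    ultimately show ?case using Y0 by (simp add: c_def monom_eval_add)
  qed
  have y: "y = c *s \<phi> u"
  proof (simp add: vec_eq_iff, rule allI)
    fix i
    show "y $ i = c * \<phi> u $ i" using claim[of "mon i"] by (simp add: Y_def veronese_vector_def)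
  qed
  then have "u \<noteq> 0" using assms(1) by auto
  moreover have "pt y = pt (\<phi> u)" unfolding y by (rule pt_scale) (use Y0 c_def in simp)
  ultimately show ?thesis by simp
qed

text \<open>
  The recursion of the preceding proof, linearised: a solution \<open>y\<close> of the linearised quadrics is
  determined by its coordinates belonging to \<open>x\<^sub>j\<^sup>d\<^sup>-\<^sup>1 x\<^sub>b\<close>, and \<open>w\<close> can be chosen such that \<open>\<tau> u w\<close> has
  these coordinates. The coordinate of \<open>x\<^sub>j\<^sup>d\<close> requires a division by \<open>d\<close>.
\<close>

lemma tangent_cut_out_by_quadrics:
  fixes y :: "'a::field_char_0 ^ 'm"
  assumes "u \<noteq> 0" and quad: "\<And>i j k l. mon i + mon j = mon k + mon l \<Longrightarrow>
    \<phi> u $ i * y $ j + y $ i * \<phi> u $ j = \<phi> u $ k * y $ l + y $ k * \<phi> u $ l"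
  shows "\<exists>w. y = \<tau> u w"
proof -
  obtain j where j: "u $ j \<noteq> 0" using assms(1) by (auto simp: vec_eq_iff)
  define wj where "wj = y $ idx (single j d) / (of_nat d * u $ j ^ (d - 1))"
  define w where "w = (\<chi> b. if b = j then wj else
      (y $ idx (single j (d - 1) + single b 1) -
       of_nat (d - 1) * u $ j ^ (d - 2) * wj * u $ b) / u $ j ^ (d - 1))"
  define Z where "Z m = (y - \<tau> u w) $ idx m" for m
  have Z0: "Z (single j d) = 0"
    using j d_ge_2 by (simp add: Z_def tangent_nth coeff_1_linear_power w_def wj_def)
  have Z1: "Z (single j (d - 1) + single b 1) = 0" for b
  proof (cases "b = j")
    case True
    then show ?thesis using Z0 d_ge_2 by (simp flip: single_add)
  next
    case False
    then show ?thesis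
      using j d_ge_2 by (simp add: Z_def tangent_nth monom_eval_add coeff_1_mult coeff_1_linear_power
          coeff_0_power w_def numeral_2_eq_2)
  qed
  have rel: "monom_eval (($) u) a * Z b + Z a * monom_eval (($) u) b =
      monom_eval (($) u) a' * Z b' + Z a' * monom_eval (($) u) b'"
    if "a + b = a' + b'" "mdegree a = d" "mdegree b = d" "mdegree a' = d" "mdegree b' = d" for a b a' b'
  proof -
    have eq: "mon (idx a) + mon (idx b) = mon (idx a') + mon (idx b')" using that by simp
    from quad[OF eq] tangent_vector_quadric[OF eq, of u w] show ?thesis
      using that by (simp add: Z_def veronese_nth algebra_simps)
  qed
  have claim: "Z (single j (d - mdegree m) + m) = 0" if "mdegree m \<le> d" for m
    using that
  proof (induction m rule: monom_induct)
    case 0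
    then show ?case by (simp add: Z0)
  next
    case (add b m)
    let ?e = "mdegree m"
    have s: "single j (d - ?e) = single j (d - Suc ?e) + single j (1 :: nat)"
      "single j d = single j (d - 1) + single j (1 :: nat)"
      using add.prems d_ge_2 by (simp_all add: Suc_diff_Suc flip: single_add)
    let ?a = "single j d" and ?b = "single j (d - Suc ?e) + (single b 1 + m)"
      and ?a' = "single j (d - 1) + single b 1" and ?b' = "single j (d - ?e) + m"
    have "monom_eval (($) u) ?a * Z ?b + Z ?a * monom_eval (($) u) ?b =
      monom_eval (($) u) ?a' * Z ?b' + Z ?a' * monom_eval (($) u) ?b'"
      by (rule rel) (use add.prems d_ge_2 in \<open>simp_all add: s add_ac\<close>)
    moreover have "Z ?b' = 0" using add by simp
    ultimately show ?case using j Z0 Z1[of b] by simp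
  qed
  have "y = \<tau> u w"
  proof (simp add: vec_eq_iff, rule allI)
    fix i
    show "y $ i = \<tau> u w $ i" using claim[of "mon i"] by (simp add: Z_def)
  qed
  then show ?thesis by blast
qed

text \<open>
  For \<open>c \<noteq> 0\<close> this is, up to the factor \<open>c\<close>, the linear coefficient of \<open>F\<close> along the curve
  \<open>c \<phi> (u + T w)\<close> on the cone over \<open>X\<close>. The vertex \<open>c = 0\<close> of the cone follows because the sum is a
  polynomial in \<open>c\<close>.
\<close>

lemma derivative_along_tangent_vanishes:
  fixes u w :: "'a::field_char_0 ^ 'k"
  assumes F: "F \<in> vanishing_ideal X"
  shows "(\<Sum>i\<in>UNIV. mpoly_eval (mpoly_pderiv i F) (c *s \<phi> u) * \<tau> u w $ i) = 0"
proof -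
  define g where "g c = (\<Sum>i\<in>UNIV. mpoly_eval (mpoly_pderiv i F) (c *s \<phi> u) * \<tau> u w $ i)" for c
  have g0: "g c = 0" if "c \<noteq> 0" for c
  proof -
    have "along (\<lambda>i. smult c (veronese_curve mon u w i)) F = 0"
    proof -
      have "poly (along (\<lambda>i. smult c (veronese_curve mon u w i)) F) t = 0" for t
      proof -
        have "(\<chi> i. poly (smult c (veronese_curve mon u w i)) t) = c *s \<phi> (u + t *s w)"
          unfolding poly_veronese_curve[symmetric] by (simp add: vec_eq_iff)
        then show ?thesis by (simp add: poly_along vanishes_on_veronese[OF F])
      qed
      then show ?thesis using poly_all_0_iff_0 by blast
    qed
    then have "0 = coeff (along (\<lambda>i. smult c (veronese_curve mon u w i)) F) 1" by simp
    also have "\<dots> = coeff (along (\<lambda>i. [:(c *s \<phi> u) $ i, (c *s \<tau> u w) $ i:]) F) 1"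
      by (rule coeff_along_1_cong) (simp_all add: coeff_veronese_curve_0)
    also have "\<dots> = c * g c"
      unfolding sum_pderiv_eq_coeff_along[symmetric] by (simp add: g_def sum_distrib_left algebra_simps)
    finally show ?thesis using that by simp
  qed
  define P where "P = (\<Sum>i\<in>UNIV. along (\<lambda>k. [:0, \<phi> u $ k:]) (mpoly_pderiv i F) * [:\<tau> u w $ i:])"
  have Pg: "poly P c = g c" for c
  proof -
    have "(\<chi> i. c * \<phi> u $ i) = c *s \<phi> u" by (simp add: vec_eq_iff)
    then show ?thesis by (simp add: P_def g_def poly_sum poly_along mult_ac del: vec_lambda_eta)
  qed
  have "P = 0" by (rule poly_eq_0_if_zero_cofinitely) (simp add: Pg g0)
  then have g: "g c = 0" for c using Pg[of c] by simp
  then show ?thesis by (simp add: g_def)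
qed

lemma tangent_space_eq:
  fixes u :: "'a::field_char_0 ^ 'k"
  assumes "u \<noteq> 0"
  shows "tangent_space X (pt (\<phi> u)) = {pt (\<tau> u w) | w. \<tau> u w \<noteq> 0}"
proof (intro equalityI subsetI)
  fix p assume "p \<in> tangent_space X (pt (\<phi> u))"
  then have p: "p \<in> proj_space" and eq: "\<And>F v w. F \<in> vanishing_ideal X \<Longrightarrow> v \<in> pt (\<phi> u) \<Longrightarrow> w \<in> p \<Longrightarrow>
      (\<Sum>i\<in>UNIV. mpoly_eval (mpoly_pderiv i F) v * w $ i) = 0"
    by (auto simp: tangent_space_def)
  from p obtain y where y: "y \<noteq> 0" "p = pt y" by (rule proj_spaceE)
  have "\<exists>w. y = \<tau> u w"
  proof (rule tangent_cut_out_by_quadrics[OF assms])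
    fix i j k l assume "mon i + mon j = mon k + mon l"
    from eq[OF quadric_in_ideal[OF this], of "\<phi> u" y]
    have "coeff (along (\<lambda>i. [:\<phi> u $ i, y $ i:]) (quadric i j k l)) 1 = 0"
      by (simp only: sum_pderiv_eq_coeff_along y singletonI vec.span_base)
    then show "\<phi> u $ i * y $ j + y $ i * \<phi> u $ j = \<phi> u $ k * y $ l + y $ k * \<phi> u $ l"
      by (simp add: quadric_def coeff_poly.subst_diff coeff_poly.subst_mult coeff_1_mult algebra_simps)
  qed
  then show "p \<in> {pt (\<tau> u w) | w. \<tau> u w \<noteq> 0}" using y by blast
next
  fix p assume "p \<in> {pt (\<tau> u w) | w. \<tau> u w \<noteq> 0}"
  then obtain w where w: "\<tau> u w \<noteq> 0" "p = pt (\<tau> u w)" by blast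
  have "(\<Sum>i\<in>UNIV. mpoly_eval (mpoly_pderiv i F) v * w' $ i) = 0"
    if F: "F \<in> vanishing_ideal X" and v: "v \<in> pt (\<phi> u)" and w': "w' \<in> p" for F v w'
  proof -
    from v w' w obtain c e where "v = c *s \<phi> u" "w' = e *s \<tau> u w" by (auto simp: pt_def')
    then have "(\<Sum>i\<in>UNIV. mpoly_eval (mpoly_pderiv i F) v * w' $ i) =
        e * (\<Sum>i\<in>UNIV. mpoly_eval (mpoly_pderiv i F) (c *s \<phi> u) * \<tau> u w $ i)"
      by (simp add: sum_distrib_left algebra_simps)
    then show ?thesis using derivative_along_tangent_vanishes[OF F] by simp
  qed
  then show "p \<in> tangent_space X (pt (\<phi> u))" using w by (simp add: tangent_space_def)
qed

lemma tangent_variety_eq: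
  "tangent_variety (X :: ('a::field_char_0 ^ 'm) set set) = {pt (\<tau> u w) | u w. \<tau> u w \<noteq> 0}"
proof -
  have "tangent_variety (X :: ('a ^ 'm) set set) = {pt (\<tau> u w) | u w. u \<noteq> 0 \<and> \<tau> u w \<noteq> 0}"
  proof (intro equalityI subsetI)
    fix p assume "p \<in> tangent_variety (X :: ('a ^ 'm) set set)"
    then obtain x where x: "x \<in> X" "p \<in> tangent_space X x" by (auto simp: tangent_variety_def)
    from x(1) obtain u where "u \<noteq> 0" "x = pt (\<phi> u)" by (rule veronese_varietyE)
    with x(2) show "p \<in> {pt (\<tau> u w) | u w. u \<noteq> 0 \<and> \<tau> u w \<noteq> 0}" by (auto simp: tangent_space_eq)
  next
    fix p assume "p \<in> {pt (\<tau> u w) | u w. u \<noteq> (0 :: 'a ^ 'k) \<and> \<tau> u w \<noteq> 0}"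
    then obtain u w where u: "u \<noteq> (0 :: 'a ^ 'k)" "\<tau> u w \<noteq> 0" "p = pt (\<tau> u w)" by blast
    then have "p \<in> tangent_space X (pt (\<phi> u))" by (auto simp: tangent_space_eq)
    with u(1) show "p \<in> tangent_variety X" unfolding tangent_variety_def by (meson UN_I veronese_in_X)
  qed
  also have "\<dots> = {pt (\<tau> u w) | u w. \<tau> u w \<noteq> 0}"
  proof -
    have "u \<noteq> 0" if "\<tau> u w \<noteq> 0" for u w :: "'a ^ 'k" using that by auto
    then show ?thesis by blast
  qed
  finally show ?thesis .
qed

end

section \<open>The secant variety\<close>

text \<open>
  The determinant of three by three matrices, written out such that it applies to matrices of forms.
\<close>

definition det3 :: "(nat \<Rightarrow> nat \<Rightarrow> 'a::comm_ring_1) \<Rightarrow> 'a" where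
  "det3 M = M 0 0 * (M 1 1 * M 2 2 - M 1 2 * M 2 1) - M 0 1 * (M 1 0 * M 2 2 - M 1 2 * M 2 0)
          + M 0 2 * (M 1 0 * M 2 1 - M 1 1 * M 2 0)"

lemma det3_rank_two: "det3 (\<lambda>a b. p a * r b + s a * t b) = 0"
  by (simp add: det3_def algebra_simps)

lemma rows_dependent2:
  fixes r0 r1 :: "'b \<Rightarrow> 'a::field"
  assumes "\<And>a b. a \<in> I \<Longrightarrow> b \<in> I \<Longrightarrow> r0 a * r1 b = r0 b * r1 a"
  shows "\<exists>k l. (k \<noteq> 0 \<or> l \<noteq> 0) \<and> (\<forall>b\<in>I. k * r0 b + l * r1 b = 0)"
proof (cases "\<exists>a\<in>I. r0 a \<noteq> 0")
  case True
  then obtain a where "a \<in> I" "r0 a \<noteq> 0" by blast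
  with assms[of a] show ?thesis
    by (intro exI[of _ "- r1 a"] exI[of _ "r0 a"]) (auto simp: mult.commute)
next
  case False
  then show ?thesis by (intro exI[of _ 1] exI[of _ 0]) auto
qed

text \<open>
  If a two by two minor of the first two rows is nonzero, the cofactors of a third column give the
  relation, by expansion of the determinants along this column.
\<close>

lemma rows_dependent3:
  fixes r :: "nat \<Rightarrow> 'b \<Rightarrow> 'a::field"
  assumes minors: "\<And>c. (\<And>b. c b \<in> I) \<Longrightarrow> det3 (\<lambda>a b. r a (c b)) = 0"
  shows "\<exists>k0 k1 k2. (k0 \<noteq> 0 \<or> k1 \<noteq> 0 \<or> k2 \<noteq> 0) \<and> (\<forall>b\<in>I. k0 * r 0 b + k1 * r 1 b + k2 * r 2 b = 0)"
proof (cases "\<exists>c0\<in>I. \<exists>c1\<in>I. r 0 c0 * r 1 c1 \<noteq> r 0 c1 * r 1 c0")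
  case True
  then obtain c0 c1 where c: "c0 \<in> I" "c1 \<in> I" "r 0 c0 * r 1 c1 - r 0 c1 * r 1 c0 \<noteq> 0" by auto
  show ?thesis
  proof (intro exI conjI ballI)
    show "(r 1 c0 * r 2 c1 - r 1 c1 * r 2 c0 \<noteq> 0 \<or> r 2 c0 * r 0 c1 - r 2 c1 * r 0 c0 \<noteq> 0 \<or>
        r 0 c0 * r 1 c1 - r 0 c1 * r 1 c0 \<noteq> 0)" using c(3) by blast
    fix b assume "b \<in> I"
    with minors[of "\<lambda>n. if n = 0 then c0 else if n = 1 then c1 else b"] c
    show "(r 1 c0 * r 2 c1 - r 1 c1 * r 2 c0) * r 0 b + (r 2 c0 * r 0 c1 - r 2 c1 * r 0 c0) * r 1 b +
        (r 0 c0 * r 1 c1 - r 0 c1 * r 1 c0) * r 2 b = 0"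
      by (simp add: det3_def algebra_simps)
  qed
next
  case False
  then have "\<exists>k l. (k \<noteq> 0 \<or> l \<noteq> 0) \<and> (\<forall>b\<in>I. k * r 0 b + l * r 1 b = 0)"
    by (intro rows_dependent2) auto
  then obtain k l where "k \<noteq> 0 \<or> l \<noteq> 0" "\<forall>b\<in>I. k * r 0 b + l * r 1 b = 0" by blast
  then show ?thesis by (intro exI[of _ k] exI[of _ l] exI[of _ 0]) auto
qed

lemma binary_quadratic_form_factors:
  fixes k0 k1 k2 :: "'a::alg_closed_field"
  shows "\<exists>p1 p2 r1 r2. p1 * r1 = k0 \<and> p1 * r2 + p2 * r1 = k1 \<and> p2 * r2 = k2 \<and>
    (k0 \<noteq> 0 \<or> k1 \<noteq> 0 \<or> k2 \<noteq> 0 \<longrightarrow> (p1 \<noteq> 0 \<or> p2 \<noteq> 0) \<and> (r1 \<noteq> 0 \<or> r2 \<noteq> 0))"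
proof (cases "k2 = 0")
  case True
  then show ?thesis by (intro exI[of _ 1] exI[of _ 0] exI[of _ k0] exI[of _ k1]) auto
next
  case False
  then have "degree [:k0, k1, k2:] > 0" by simp
  from alg_closed_imp_poly_has_root[OF this] obtain x where "k0 + x * (k1 + x * k2) = 0" by auto
  then have x: "k0 = - (x * (k1 + x * k2))" by (simp add: eq_neg_iff_add_eq_0)
  show ?thesis
    by (rule exI[of _ "- x"], rule exI[of _ 1], rule exI[of _ "k1 + x * k2"], rule exI[of _ k2])
      (use x False in \<open>auto simp: algebra_simps\<close>)
qed

lemma span_union_pts: "vec.span (pt x \<union> pt y) = {z. \<exists>a b. z = a *s x + b *s y}"
proof -
  have "vec.span (pt x \<union> pt y) = vec.span {x, y}"
  proof (subst vec.span_eq, intro conjI)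
    show "pt x \<union> pt y \<subseteq> vec.span {x, y}"
      using vec.span_mono[of "{x}" "{x, y}"] vec.span_mono[of "{y}" "{x, y}"] by auto
    show "{x, y} \<subseteq> vec.span (pt x \<union> pt y)" by (auto intro!: vec.span_base)
  qed
  also have "\<dots> = {z. \<exists>a b. z = a *s x + b *s y}"
    by (auto simp: vec.span_insert vec.span_singleton diff_eq_eq add.commute)
  finally show ?thesis .
qed

lemma pt_subset_iff: "vec.subspace S \<Longrightarrow> pt z \<subseteq> S \<longleftrightarrow> z \<in> S"
  using vec.span_base[of z "{z}"] vec.span_minimal[of "{z}" S] by auto

lemma proj_span_pair:
  "proj_span {pt x, pt y} = {pt z | z. z \<noteq> 0 \<and> (\<exists>a b. z = a *s x + b *s y)}"
proof -
  have "pt z \<subseteq> vec.span (pt x \<union> pt y) \<longleftrightarrow> (\<exists>a b. z = a *s x + b *s y)" for z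
    using pt_subset_iff[OF vec.subspace_span, of z "pt x \<union> pt y"] unfolding span_union_pts by simp
  note sub = this
  show ?thesis unfolding proj_span_def
  proof (intro equalityI subsetI)
    fix p assume "p \<in> {p \<in> proj_space. p \<subseteq> vec.span (\<Union>{pt x, pt y})}"
    then have p: "p \<in> proj_space" "p \<subseteq> vec.span (pt x \<union> pt y)" by auto
    from p(1) obtain z where z: "z \<noteq> 0" "p = pt z" by (rule proj_spaceE)
    with p(2) sub[of z] have "\<exists>a b. z = a *s x + b *s y" by simp
    with z show "p \<in> {pt z | z. z \<noteq> 0 \<and> (\<exists>a b. z = a *s x + b *s y)}" by blast
  next
    fix p assume "p \<in> {pt z | z. z \<noteq> 0 \<and> (\<exists>a b. z = a *s x + b *s y)}"
    then obtain z where z: "p = pt z" "z \<noteq> 0" "\<exists>a b. z = a *s x + b *s y" by blast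
    then have "p \<in> proj_space" "p \<subseteq> vec.span (pt x \<union> pt y)" using sub[of z] by simp_all
    then show "p \<in> {p \<in> proj_space. p \<subseteq> vec.span (\<Union>{pt x, pt y})}" by simp
  qed
qed

context veronese_monomials
begin

text \<open>
  A vector of coordinates is a functional on forms of degree \<open>d\<close>: the point \<open>\<phi> u\<close> is evaluation at
  \<open>u\<close>, and \<open>\<tau> u w\<close> is the derivative at \<open>u\<close> in direction \<open>w\<close>.
\<close>

definition functional :: "'a::comm_ring_1 ^ 'm \<Rightarrow> ('a, 'k) mpoly \<Rightarrow> 'a" where
  "functional y f = (\<Sum>i\<in>UNIV. y $ i * lookup f (mon i))"

lemma functional_add: "functional y (f + g) = functional y f + functional y g"
  by (simp add: functional_def lookup_add algebra_simps sum.distrib)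

lemma functional_zero [simp]: "functional y 0 = 0"
  by (simp add: functional_def)

lemma functional_scale: "functional y (mpoly_scale c f) = c * functional y f"
  by (simp add: functional_def mpoly_scale_lookup sum_distrib_left mult_ac)

lemma functional_add_left: "functional (y + z) f = functional y f + functional z f"
  by (simp add: functional_def algebra_simps sum.distrib)

lemma functional_scale_left: "functional (c *s y) f = c * functional y f"
  by (simp add: functional_def sum_distrib_left mult_ac)

lemma functional_single:
  "functional y (single m c) = (if mdegree m = d then c * y $ idx m else 0)"
proof -
  have "functional y (single m c) = (\<Sum>i\<in>UNIV. if mon i = m then c * y $ i else 0)"
    unfolding functional_def by (intro sum.cong) (auto simp: lookup_single when_def)
  also have "\<dots> = (\<Sum>i\<in>UNIV. if i = idx m then if mdegree m = d then c * y $ i else 0 else 0)"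
    by (intro sum.cong) auto
  finally show ?thesis by simp
qed

lemma functional_veronese: "homogeneous d f \<Longrightarrow> functional (\<phi> u) f = mpoly_eval f u"
  by (induction rule: mpoly_homogeneous_induct) (simp_all add: functional_single functional_add veronese_nth)

lemma functional_tangent:
  "homogeneous d f \<Longrightarrow> functional (\<tau> u w) f = coeff (along (\<lambda>j. [:u $ j, w $ j:]) f) 1"
  by (induction rule: mpoly_homogeneous_induct)
    (simp_all add: functional_single functional_add tangent_nth coeff_poly.subst_single coeff_poly.subst_add
      del: One_nat_def)


text \<open>
  The assumption \<open>rec\<close> says that each variable acts on the functional \<open>E\<close> like the linear combination
  \<open>u\<^sub>j l1 + v\<^sub>j l2\<close>, so a monomial acts like a product of such combinations. As the product \<open>l1 l2\<close> acts
  as zero, only the two pure powers survive, with the values of the monomial at \<open>u\<close> and \<open>v\<close>.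
\<close>

lemma functional_killed_by_product:
  fixes E :: "('a::comm_ring_1, 'k) mpoly \<Rightarrow> 'a"
  assumes rec: "\<And>j g. E (var j * g) = u $ j * E (l1 * g) + v $ j * E (l2 * g)"
    and kill: "\<And>g. E (l1 * (l2 * g)) = 0"
  shows "mdegree m = Suc e \<Longrightarrow> E (single m 1 * g) =
    monom_eval (($) u) m * E (l1 ^ Suc e * g) + monom_eval (($) v) m * E (l2 ^ Suc e * g)"
proof (induction e arbitrary: m g)
  case 0
  then obtain j m' where "m = single j 1 + m'" "mdegree m' = 0" by (rule monom_split_mdegree)
  then have m: "m = single j 1" by (simp add: mdegree_eq_0_iff)
  show ?case using rec[of j g] by (simp add: m var_def)
next
  case (Suc e)
  from Suc.prems obtain j m' where m: "m = single j 1 + m'" "mdegree m' = Suc e"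
    by (rule monom_split_mdegree)
  have "single m 1 * g = var j * (single m' 1 * g)"
    by (simp add: m var_def mult_single flip: mult.assoc)
  then have "E (single m 1 * g) =
      u $ j * E (single m' 1 * (l1 * g)) + v $ j * E (single m' 1 * (l2 * g))"
    by (simp add: rec mult.left_commute)
  also have "\<dots> = u $ j * (monom_eval (($) u) m' * E (l1 ^ Suc e * (l1 * g)) + monom_eval (($) v) m' * E (l2 ^ Suc e * (l1 * g)))
      + v $ j * (monom_eval (($) u) m' * E (l1 ^ Suc e * (l2 * g)) + monom_eval (($) v) m' * E (l2 ^ Suc e * (l2 * g)))"
    by (simp only: Suc.IH[OF m(2)])
  also have "E (l2 ^ Suc e * (l1 * g)) = 0" using kill[of "l2 ^ e * g"] by (simp add: mult_ac)
  also have "E (l1 ^ Suc e * (l2 * g)) = 0" using kill[of "l1 ^ e * g"] by (simp add: mult_ac)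
  finally show ?case by (simp add: m monom_eval_add mult_ac)
qed

text \<open>
  If instead the square of \<open>l1\<close> acts as zero, the product is expanded to first order in \<open>l1\<close>: the
  coefficients are the value and the derivative of the monomial.
\<close>

lemma functional_killed_by_square:
  fixes E :: "('a::comm_ring_1, 'k) mpoly \<Rightarrow> 'a"
  assumes rec: "\<And>j g. E (var j * g) = v $ j * E (l1 * g) + u $ j * E (l2 * g)"
    and kill: "\<And>g. E (l1 * (l1 * g)) = 0"
  shows "E (single m 1 * g) = monom_eval (($) u) m * E (l2 ^ mdegree m * g) +
    coeff (monom_eval (\<lambda>j. [:u $ j, v $ j:]) m) 1 * E (l1 * (l2 ^ (mdegree m - 1) * g))"
proof (induction m arbitrary: g rule: monom_induct)
  case 0
  then show ?case by simp
next
  case (add j m)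
  define D where "D = coeff (monom_eval (\<lambda>j. [:u $ j, v $ j:]) m) 1"
  have "single (single j 1 + m) 1 * g = var j * (single m 1 * g)"
    by (simp add: var_def mult_single flip: mult.assoc)
  then have "E (single (single j 1 + m) 1 * g) =
      v $ j * E (single m 1 * (l1 * g)) + u $ j * E (single m 1 * (l2 * g))"
    by (simp add: rec mult.left_commute)
  also have "\<dots> = v $ j * (monom_eval (($) u) m * E (l2 ^ mdegree m * (l1 * g)) + D * E (l1 * (l2 ^ (mdegree m - 1) * (l1 * g))))
      + u $ j * (monom_eval (($) u) m * E (l2 ^ mdegree m * (l2 * g)) + D * E (l1 * (l2 ^ (mdegree m - 1) * (l2 * g))))"
    unfolding D_def by (simp only: add.IH)
  also have "E (l1 * (l2 ^ (mdegree m - 1) * (l1 * g))) = 0"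
    using kill[of "l2 ^ (mdegree m - 1) * g"] by (simp add: mult_ac)
  also have "D * E (l1 * (l2 ^ (mdegree m - 1) * (l2 * g))) = D * E (l1 * (l2 ^ mdegree m * g))"
  proof (cases "mdegree m")
    case 0
    then have "D = 0" by (simp add: D_def mdegree_eq_0_iff)
    then show ?thesis by simp
  qed (simp add: mult_ac)
  finally show ?case
    by (simp add: monom_eval_add coeff_1_mult coeff_monom_eval_0 D_def algebra_simps)
qed

definition on_secant :: "'a::field ^ 'm \<Rightarrow> bool" where
  "on_secant y \<longleftrightarrow> (\<exists>a b u v. y = a *s \<phi> u + b *s \<phi> v)"

definition on_tangent :: "'a::field ^ 'm \<Rightarrow> bool" where
  "on_tangent y \<longleftrightarrow> (\<exists>u w. y = \<tau> u w)"

lemma functional_relation: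
  assumes rel: "\<And>b. mdegree b = d - e \<Longrightarrow> k0 * q $ idx (a0 + b) + k1 * q $ idx (a1 + b) + k2 * q $ idx (a2 + b) = 0"
    and "mdegree a0 = e" "mdegree a1 = e" "mdegree a2 = e"
  shows "k0 * functional q (single a0 1 * g) + k1 * functional q (single a1 1 * g)
    + k2 * functional q (single a2 1 * g) = 0"
proof (induction g rule: mpoly_induct)
  case (single m c)
  show ?case
  proof (cases "e + mdegree m = d")
    case True
    have "k0 * (c * q $ idx (a0 + m)) + k1 * (c * q $ idx (a1 + m)) + k2 * (c * q $ idx (a2 + m)) =
      c * (k0 * q $ idx (a0 + m) + k1 * q $ idx (a1 + m) + k2 * q $ idx (a2 + m))"
      by (simp add: algebra_simps)
    also have "\<dots> = 0" using rel[of m] True by simp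
    finally show ?thesis using True assms by (simp add: mult_single functional_single)
  next
    case False
    then show ?thesis using assms by (simp add: mult_single functional_single)
  qed
next
  case (add F G)
  have "k0 * functional q (single a0 1 * (F + G)) + k1 * functional q (single a1 1 * (F + G))
    + k2 * functional q (single a2 1 * (F + G)) =
   (k0 * functional q (single a0 1 * F) + k1 * functional q (single a1 1 * F)
    + k2 * functional q (single a2 1 * F)) +
   (k0 * functional q (single a0 1 * G) + k1 * functional q (single a1 1 * G)
    + k2 * functional q (single a2 1 * G))"
    by (simp add: distrib_left functional_add)
  then show ?case using add by simp
qed

text \<open>
  The assumption says that the catalecticant matrices of \<open>q\<close> of shapes \<open>(1, d - 1)\<close> and \<open>(2, d - 2)\<close> have
  rank at most two. By the first, the functional only depends on two variables \<open>x1\<close> and \<open>x2\<close>; by the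
  second, it is killed by a quadratic form in \<open>x1\<close> and \<open>x2\<close>. This form is a product of two linear forms.
  If they are independent, the functional is a combination of two evaluations; if they are
  proportional, it is a combination of an evaluation and a derivative at the same point.
\<close>

lemma catalecticant_imp_on_secant_or_tangent:
  fixes q :: "'a::{alg_closed_field, field_char_0} ^ 'm"
  assumes minors: "\<And>e \<alpha> \<beta>. e = 1 \<or> e = 2 \<Longrightarrow> (\<And>a. mdegree (\<alpha> a) = e) \<Longrightarrow> (\<And>b. mdegree (\<beta> b) = d - e) \<Longrightarrow>
      det3 (\<lambda>a b. q $ idx (\<alpha> a + \<beta> b)) = 0"
  shows "on_secant q \<or> on_tangent q"
proof (cases "q = 0")
  case True
  then have "q = 0 *s \<phi> 0 + 0 *s \<phi> 0" by simp
  then show ?thesis unfolding on_secant_def by blast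
next
  case False
  define I where "I = {b :: 'k monom. mdegree b = d - 1}"
  define r where "r j b = q $ idx (single j 1 + b)" for j b
  have dep3: "\<exists>k0 k1 k2. (k0 \<noteq> 0 \<or> k1 \<noteq> 0 \<or> k2 \<noteq> 0) \<and> (\<forall>b\<in>I. k0 * r j0 b + k1 * r j1 b + k2 * r j2 b = 0)" for j0 j1 j2
  proof -
    let ?j = "\<lambda>n::nat. if n = 0 then j0 else if n = 1 then j1 else j2"
    have "\<exists>k0 k1 k2. (k0 \<noteq> 0 \<or> k1 \<noteq> 0 \<or> k2 \<noteq> 0) \<and>
        (\<forall>b\<in>I. k0 * r (?j 0) b + k1 * r (?j 1) b + k2 * r (?j 2) b = 0)"
      by (rule rows_dependent3) (use minors[of 1 "\<lambda>n. single (?j n) 1"] in \<open>simp add: r_def I_def\<close>)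
    then show ?thesis by simp
  qed
  \<comment> \<open>two rows span the row space of the first catalecticant matrix\<close>
  have "\<exists>j1 j2 u v. \<forall>j. \<forall>b\<in>I. r j b = u j * r j1 b + v j * r j2 b"
  proof (cases "\<exists>j1 j2. \<forall>k l. (\<forall>b\<in>I. k * r j1 b + l * r j2 b = 0) \<longrightarrow> k = 0 \<and> l = 0")
    case True
    then obtain j1 j2 where indep: "\<And>k l. (\<And>b. b \<in> I \<Longrightarrow> k * r j1 b + l * r j2 b = 0) \<Longrightarrow> k = 0 \<and> l = 0" by blast
    have "\<exists>u v. \<forall>b\<in>I. r j b = u * r j1 b + v * r j2 b" for j
    proof -
      obtain k0 k1 k2 where k: "k0 \<noteq> 0 \<or> k1 \<noteq> 0 \<or> k2 \<noteq> 0"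
        and rel: "\<forall>b\<in>I. k0 * r j b + k1 * r j1 b + k2 * r j2 b = 0" using dep3[of j j1 j2] by blast
      have k0: "k0 \<noteq> 0"
      proof
        assume "k0 = 0"
        with rel indep[of k1 k2] k show False by auto
      qed
      have "r j b = - (k1 / k0) * r j1 b + - (k2 / k0) * r j2 b" if "b \<in> I" for b
      proof -
        have "k0 * r j b + k1 * r j1 b + k2 * r j2 b = 0" using rel that by blast
        then have "k0 * r j b = - k1 * r j1 b - k2 * r j2 b" by algebra
        then show ?thesis using k0 by (simp add: field_simps)
      qed
      then show ?thesis by blast
    qed
    then show ?thesis by metis
  next
    case dep: False
    obtain i where i: "q $ i \<noteq> 0" using False by (auto simp: vec_eq_iff)
    have "mdegree (mon i) = Suc (d - 1)" using d_ge_2 by simp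
    then obtain j1 b1 where b1: "mon i = single j1 1 + b1" "mdegree b1 = d - 1"
      by (rule monom_split_mdegree)
    have "idx (single j1 1 + b1) = i" unfolding b1(1)[symmetric] by simp
    then have r1: "b1 \<in> I" "r j1 b1 \<noteq> 0" using i b1(2) by (simp_all add: I_def r_def)
    have "\<exists>u. \<forall>b\<in>I. r j b = u * r j1 b" for j
    proof -
      from dep obtain k l where k: "\<forall>b\<in>I. k * r j1 b + l * r j b = 0" "k \<noteq> 0 \<or> l \<noteq> 0" by blast
      have l: "l \<noteq> 0" using k r1 by auto
      have "r j b = - (k / l) * r j1 b" if "b \<in> I" for b
      proof -
        have "l * r j b = - (k * r j1 b)" using k(1) that by (simp add: eq_neg_iff_add_eq_0 add.commute)
        then show ?thesis using l by (simp add: field_simps)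
      qed
      then show ?thesis by blast
    qed
    then obtain u where u: "\<And>j b. b \<in> I \<Longrightarrow> r j b = u j * r j1 b" by metis
    show ?thesis
    proof (rule exI[of _ j1], rule exI[of _ j1], rule exI[of _ u], rule exI[of _ "\<lambda>_. 0"], intro allI ballI)
      fix j b assume "b \<in> I"
      from u[OF this, of j] show "r j b = u j * r j1 b + 0 * r j1 b" by simp
    qed
  qed
  then obtain j1 j2 u v where uv: "\<And>j b. b \<in> I \<Longrightarrow> r j b = u j * r j1 b + v j * r j2 b" by blast
  let ?E = "functional q"
  define x1 where "x1 = (var j1 :: ('a, 'k) mpoly)"
  define x2 where "x2 = (var j2 :: ('a, 'k) mpoly)"
  have E_var: "?E (var j * g) = u j * ?E (x1 * g) + v j * ?E (x2 * g)" for j g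
  proof -
    have "1 * functional q (single (single j 1) 1 * g) +
        (- u j) * functional q (single (single j1 1) 1 * g) +
        (- v j) * functional q (single (single j2 1) 1 * g) = 0"
    proof (rule functional_relation[where e = 1])
      fix b :: "'k monom" assume "mdegree b = d - 1"
      then have "r j b = u j * r j1 b + v j * r j2 b" by (intro uv) (simp add: I_def)
      then show "1 * q $ idx (single j 1 + b) + - u j * q $ idx (single j1 1 + b) +
          - v j * q $ idx (single j2 1 + b) = 0"
        unfolding r_def by algebra
    qed simp_all
    then show ?thesis by (simp add: var_def x1_def x2_def algebra_simps)
  qed
  obtain k0 k1 k2 where k: "k0 \<noteq> 0 \<or> k1 \<noteq> 0 \<or> k2 \<noteq> 0"
    and quad: "\<And>g. k0 * ?E (x1 * (x1 * g)) + k1 * ?E (x1 * (x2 * g)) + k2 * ?E (x2 * (x2 * g)) = 0"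
  proof -
    define a where "a n = (if n = 0 then single j1 1 + single j1 1 else
      if n = 1 then single j1 1 + single j2 1
      else single j2 1 + single j2 (1::nat))" for n :: nat
    have "\<exists>k0 k1 k2. (k0 \<noteq> 0 \<or> k1 \<noteq> 0 \<or> k2 \<noteq> 0) \<and> (\<forall>b\<in>{b. mdegree b = d - 2}.
        k0 * q $ idx (a 0 + b) + k1 * q $ idx (a 1 + b) + k2 * q $ idx (a 2 + b) = 0)"
      by (rule rows_dependent3) (use minors[of 2 a] in \<open>simp add: a_def\<close>)
    then obtain k0 k1 k2 where k: "k0 \<noteq> 0 \<or> k1 \<noteq> 0 \<or> k2 \<noteq> 0"
      and rel: "\<And>b. mdegree b = d - 2 \<Longrightarrow> k0 * q $ idx (a 0 + b) + k1 * q $ idx (a 1 + b) + k2 * q $ idx (a 2 + b) = 0"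
      by blast
    have "k0 * ?E (single (a 0) 1 * g) + k1 * ?E (single (a 1) 1 * g) +
        k2 * ?E (single (a 2) 1 * g) = 0" for g
      by (rule functional_relation[where e = 2, OF rel]) (simp_all add: a_def)
    moreover have "single (a 0) 1 = x1 * x1" "single (a 1) 1 = x1 * x2"
      "single (a 2) 1 = x2 * x2"
      by (simp_all add: a_def x1_def x2_def var_def mult_single)
    ultimately show ?thesis using k by (intro that[of k0 k1 k2]) (simp_all add: mult.assoc)
  qed
  obtain p1 p2 r1 r2 where pr: "p1 * r1 = k0" "p1 * r2 + p2 * r1 = k1" "p2 * r2 = k2"
    "p1 \<noteq> 0 \<or> p2 \<noteq> 0" "r1 \<noteq> 0 \<or> r2 \<noteq> 0"
    using binary_quadratic_form_factors[of k0 k1 k2] k by metis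
  define l1 where "l1 = mpoly_scale p1 x1 + mpoly_scale p2 x2"
  define l2 where "l2 = mpoly_scale r1 x1 + mpoly_scale r2 x2"
  have scale_mult: "mpoly_scale c F * G = mpoly_scale c (F * G)" for c and F G :: "('a, 'k) mpoly"
    by (simp add: mpoly_scale_def mult.assoc)
  have El: "?E (l1 * g) = p1 * ?E (x1 * g) + p2 * ?E (x2 * g)"
    "?E (l2 * g) = r1 * ?E (x1 * g) + r2 * ?E (x2 * g)" for g
    by (simp_all add: l1_def l2_def distrib_right scale_mult functional_add functional_scale)
  have kill: "?E (l1 * (l2 * g)) = 0" for g
  proof -
    have "?E (l1 * (l2 * g)) = p1 * (r1 * ?E (x1 * (x1 * g)) + r2 * ?E (x2 * (x1 * g))) +
        p2 * (r1 * ?E (x1 * (x2 * g)) + r2 * ?E (x2 * (x2 * g)))"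
      using El(1)[of "l2 * g"] El(2)[of "x1 * g"] El(2)[of "x2 * g"] by (simp add: mult.left_commute)
    also have "\<dots> = k0 * ?E (x1 * (x1 * g)) + k1 * ?E (x1 * (x2 * g)) + k2 * ?E (x2 * (x2 * g))"
      unfolding pr(1-3)[symmetric] by (simp add: algebra_simps)
    finally show ?thesis using quad by simp
  qed
  show ?thesis
  proof (cases "p1 * r2 - p2 * r1 = 0")
    case False
    define \<delta> where "\<delta> = p1 * r2 - p2 * r1"
    have \<delta>: "\<delta> \<noteq> 0" using False by (simp add: \<delta>_def)
    define u' where "u' = (\<chi> j. (u j * r2 - v j * r1) / \<delta>)"
    define v' where "v' = (\<chi> j. (v j * p1 - u j * p2) / \<delta>)"
    have rec: "?E (var j * g) = u' $ j * ?E (l1 * g) + v' $ j * ?E (l2 * g)" for j g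
    proof -
      have "\<delta> * (u' $ j * ?E (l1 * g) + v' $ j * ?E (l2 * g)) =
          (u j * r2 - v j * r1) * ?E (l1 * g) + (v j * p1 - u j * p2) * ?E (l2 * g)"
        using \<delta> by (simp add: u'_def v'_def distrib_left)
      also have "\<dots> = \<delta> * ?E (var j * g)" unfolding El E_var \<delta>_def by algebra
      finally show ?thesis using \<delta> by simp
    qed
    have "q $ i = monom_eval (($) u') (mon i) * ?E (l1 ^ d * 1) + monom_eval (($) v') (mon i) * ?E (l2 ^ d * 1)" for i
      using functional_killed_by_product[of ?E u' l1 v' l2, OF rec kill, of "mon i" "d - 1" 1] d_ge_2
      by (simp add: functional_single)
    then have "q = ?E (l1 ^ d) *s \<phi> u' + ?E (l2 ^ d) *s \<phi> v'"
      by (simp add: vec_eq_iff veronese_vector_def mult.commute)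
    then show ?thesis unfolding on_secant_def by blast
  next
    case True
    have "\<exists>c. c \<noteq> 0 \<and> r1 = c * p1 \<and> r2 = c * p2"
    proof (cases "p1 = 0")
      case True
      then show ?thesis using pr(4,5) \<open>p1 * r2 - p2 * r1 = 0\<close> by (intro exI[of _ "r2 / p2"]) auto
    next
      case False
      then have "r2 = r1 / p1 * p2" using True by (simp add: field_simps)
      then show ?thesis using pr(5) False by (intro exI[of _ "r1 / p1"]) auto
    qed
    then obtain c where c: "c \<noteq> 0" "r1 = c * p1" "r2 = c * p2" by blast
    have "?E (l2 * g) = c * ?E (l1 * g)" for g unfolding El c by algebra
    then have kill2: "?E (l1 * (l1 * g)) = 0" for g
      using kill[of g] c(1) by (simp add: mult.left_commute[of l1 l2])
    obtain l' :: "('a, 'k) mpoly" and u' v' where rec: "\<And>j g. ?E (var j * g) = v' j * ?E (l1 * g) + u' j * ?E (l' * g)"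
    proof (cases "p1 = 0")
      case True
      then have "p2 \<noteq> 0" using pr(4) by simp
      then have "?E (var j * g) = v j / p2 * ?E (l1 * g) + u j * ?E (x1 * g)" for j g
        using True by (simp add: E_var El)
      then show ?thesis by (rule that)
    next
      case False
      then have "?E (var j * g) = u j / p1 * ?E (l1 * g) + (v j - u j * p2 / p1) * ?E (x2 * g)" for j g
        unfolding E_var El by (simp add: divide_simps) algebra
      then show ?thesis by (rule that)
    qed
    let ?a = "?E (l' ^ d)" and ?b = "?E (l1 * l' ^ (d - 1))"
    have "q $ i = monom_eval (($) (\<chi> j. u' j)) (mon i) * ?a + \<tau> (\<chi> j. u' j) (\<chi> j. v' j) $ i * ?b" for i
      using functional_killed_by_square[of ?E "\<chi> j. v' j" l1 "\<chi> j. u' j" l' "mon i" 1] rec kill2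
      by (simp add: functional_single tangent_vector_def veronese_curve_def)
    then have "q = ?a *s \<phi> (\<chi> j. u' j) + ?b *s \<tau> (\<chi> j. u' j) (\<chi> j. v' j)"
      by (simp add: vec_eq_iff veronese_vector_def mult.commute)
    also have "\<dots> = \<tau> (\<chi> j. u' j) (?b *s (\<chi> j. v' j) + (?a / of_nat d) *s (\<chi> j. u' j))"
      using d_ge_2 by (simp add: tangent_vector_add tangent_vector_scale tangent_self vector_smult_assoc add.commute)
    finally show ?thesis unfolding on_tangent_def by blast
  qed
qed

lemma veronese_proportional:
  fixes u v :: "'a::field ^ 'k"
  assumes "\<phi> u = c *s \<phi> v" "u \<noteq> 0"
  obtains e where "e \<noteq> 0" "u = e *s v"
proof -
  obtain j where j: "u $ j \<noteq> 0" using assms(2) by (auto simp: vec_eq_iff)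
  have "u $ j ^ (d - 1) * u $ b = c * (v $ j ^ (d - 1) * v $ b)" for b
  proof -
    let ?m = "single j (d - 1) + single b 1"
    have "mdegree ?m = d" using d_ge_2 by simp
    with arg_cong[OF assms(1), of "\<lambda>y. y $ idx ?m"] show ?thesis
      by (simp add: veronese_nth monom_eval_add)
  qed
  then have eq: "u = (c * v $ j ^ (d - 1) / u $ j ^ (d - 1)) *s v"
    using j by (simp add: vec_eq_iff field_simps)
  moreover have "c * v $ j ^ (d - 1) / u $ j ^ (d - 1) \<noteq> 0"
    using assms(2) eq by (metis vec.scale_zero_left)
  ultimately show ?thesis by (rule that[rotated])
qed

lemma pt_veronese_eq_iff:
  fixes u v :: "'a::field ^ 'k"
  assumes "u \<noteq> 0" "v \<noteq> 0"
  shows "pt (\<phi> u) = pt (\<phi> v) \<longleftrightarrow> pt u = pt v"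
proof
  assume "pt (\<phi> u) = pt (\<phi> v)"
  then obtain c where "\<phi> u = c *s \<phi> v" using assms by (auto elim: pt_eqD)
  then obtain e where "e \<noteq> 0" "u = e *s v" using assms(1) by (rule veronese_proportional)
  then show "pt u = pt v" by (simp add: pt_scale)
next
  assume "pt u = pt v"
  then obtain c where "c \<noteq> 0" "u = c *s v" using assms(1) by (rule pt_eqD)
  then show "pt (\<phi> u) = pt (\<phi> v)" by (simp add: veronese_scale pt_scale)
qed

lemma other_point:
  obtains v :: "'a::field ^ 'k" where "v \<noteq> 0" "pt v \<noteq> pt u"
proof -
  have "card (UNIV :: 'k set) \<noteq> 1" using two_variables by simp
  then obtain i j :: 'k where ij: "i \<noteq> j" by (metis UNIV_I card_1_singleton_iff is_singletonI' is_singleton_altdef UNIV_not_empty)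
  have ne: "axis i 1 \<noteq> (0 :: 'a ^ 'k)" "axis j 1 \<noteq> (0 :: 'a ^ 'k)" by (auto simp: axis_eq_0_iff)
  have "pt (axis i 1 :: 'a ^ 'k) \<noteq> pt (axis j 1)"
  proof
    assume "pt (axis i 1 :: 'a ^ 'k) = pt (axis j 1)"
    then obtain c where "axis i 1 = c *s (axis j 1 :: 'a ^ 'k)" using ne by (auto elim: pt_eqD)
    from arg_cong[OF this, of "\<lambda>v. v $ i"] ij show False by (simp add: axis_def)
  qed
  with ne that show ?thesis by metis
qed

lemma union_of_secant_lines:
  fixes X' :: "('a::field ^ 'm) set set"
  defines "X' \<equiv> \<Union>{proj_span {x1, x2} | x1 x2. x1 \<in> X \<and> x2 \<in> X \<and> x1 \<noteq> x2}"
  shows "X' = {pt y | y. y \<noteq> 0 \<and> on_secant y}"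
proof (intro equalityI subsetI)
  fix p assume "p \<in> X'"
  then obtain x1 x2 where x: "x1 \<in> X" "x2 \<in> X" "p \<in> proj_span {x1, x2}" unfolding X'_def by blast
  from x(1,2) obtain u v where "x1 = pt (\<phi> u)" "x2 = pt (\<phi> v)" by (metis veronese_varietyE)
  with x(3) obtain z a b where "p = pt z" "z \<noteq> 0" "z = a *s \<phi> u + b *s \<phi> v"
    by (auto simp only: proj_span_pair)
  then show "p \<in> {pt y | y. y \<noteq> 0 \<and> on_secant y}" unfolding on_secant_def by blast
next
  have on_X: "pt (\<phi> u) \<in> X'" if u: "u \<noteq> 0" for u :: "'a ^ 'k"
  proof -
    obtain v :: "'a ^ 'k" where v: "v \<noteq> 0" "pt v \<noteq> pt u" by (rule other_point)
    have "\<phi> u = 1 *s \<phi> u + 0 *s \<phi> v" by simp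
    then have "pt (\<phi> u) \<in> proj_span {pt (\<phi> u), pt (\<phi> v)}"
      using u unfolding proj_span_pair by (metis (mono_tags, lifting) mem_Collect_eq veronese_eq_0_iff)
    moreover have "pt (\<phi> u) \<noteq> pt (\<phi> v)" using pt_veronese_eq_iff[OF u v(1)] v(2) by metis
    moreover have "pt (\<phi> u) \<in> X" "pt (\<phi> v) \<in> X" using u v by simp_all
    ultimately show ?thesis unfolding X'_def by blast
  qed
  fix p :: "('a ^ 'm) set" assume "p \<in> {pt y | y. y \<noteq> 0 \<and> on_secant y}"
  then obtain y a b u v where y: "p = pt y" "y \<noteq> 0" "y = a *s \<phi> u + b *s \<phi> v"
    unfolding on_secant_def by blast
  show "p \<in> X'"
  proof (cases "u = 0 \<or> v = 0 \<or> pt (\<phi> u) = pt (\<phi> v)")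
    case True
    have "\<exists>c w. y = c *s \<phi> w"
    proof -
      consider "u = 0" | "v = 0" | "u \<noteq> 0" "v \<noteq> 0" "pt (\<phi> u) = pt (\<phi> v)" using True by blast
      then show ?thesis
      proof cases
        case 3
        then obtain c where "\<phi> u = c *s \<phi> v" by (auto elim: pt_eqD)
        then have "y = (a * c + b) *s \<phi> v" using y(3) by (simp add: vec_eq_iff algebra_simps)
        then show ?thesis by blast
      qed (use y(3) in auto)
    qed
    then obtain c w where cw: "y = c *s \<phi> w" by blast
    with y(2) have "c \<noteq> 0" "w \<noteq> 0" by auto
    then show ?thesis using on_X[of w] y(1) cw by (simp add: pt_scale)
  next
    case False
    have "p \<in> proj_span {pt (\<phi> u), pt (\<phi> v)}" using y unfolding proj_span_pair by blast
    moreover have "pt (\<phi> u) \<in> X" "pt (\<phi> v) \<in> X" "pt (\<phi> u) \<noteq> pt (\<phi> v)" using False by simp_all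
    ultimately show ?thesis unfolding X'_def by blast
  qed
qed

lemma det3_homogeneous:
  assumes "\<And>a b. homogeneous 1 (M a b)"
  shows "homogeneous (1 + (1 + 1)) (det3 M :: ('a::comm_ring_1, 'm) mpoly)"
  unfolding det3_def
  by (intro homogeneous_add homogeneous_diff homogeneous_mult assms)

text \<open>
  The minors of the catalecticant matrices vanish on the secant lines and hence on their closure. On
  the other hand, tangent vectors are limits of the secant vectors \<open>(\<phi> (u + s w) - \<phi> u) / s\<close>, and a form
  that vanishes for all \<open>s \<noteq> 0\<close> also vanishes for \<open>s = 0\<close>.
\<close>

theorem secant_variety_eq:
  "secant_variety (X :: ('a::{alg_closed_field, field_char_0} ^ 'm) set set) =
     {pt y | y. y \<noteq> 0 \<and> (on_secant y \<or> on_tangent y)}"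
proof (intro equalityI subsetI)
  let ?A = "{pt y | y :: 'a ^ 'm. y \<noteq> 0 \<and> on_secant y}"
  have sub: "?A \<subseteq> proj_space" by auto
  {
    fix p :: "('a ^ 'm) set" assume "p \<in> secant_variety X"
    then have p: "p \<in> zariski closure_of ?A" unfolding secant_variety_def union_of_secant_lines .
    then have "p \<in> proj_space" using closure_of_subset_topspace[of zariski ?A] by auto
    then obtain q where q: "q \<noteq> 0" "p = pt q" by (rule proj_spaceE)
    have "on_secant q \<or> on_tangent q"
    proof (rule catalecticant_imp_on_secant_or_tangent)
      fix e and \<alpha> \<beta> :: "nat \<Rightarrow> 'k monom"
      assume deg: "e = 1 \<or> e = 2" "\<And>a. mdegree (\<alpha> a) = e" "\<And>b. mdegree (\<beta> b) = d - e"
      then have degd: "mdegree (\<alpha> a + \<beta> b) = d" for a b using d_ge_2 by auto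
      let ?F = "det3 (\<lambda>a b. var (idx (\<alpha> a + \<beta> b))) :: ('a, 'm) mpoly"
      have hom: "homogeneous (1 + (1 + 1)) ?F" by (rule det3_homogeneous) simp
      have eval: "mpoly_eval ?F y = det3 (\<lambda>a b. y $ idx (\<alpha> a + \<beta> b))" for y
        by (simp add: det3_def)
      have "zariski closure_of ?A \<subseteq> {p \<in> proj_space. vanishes_at ?F p}"
      proof (rule closure_of_minimal[OF _ closedin_zariski_vanishing[OF hom]], safe)
        fix y assume "on_secant (y :: 'a ^ 'm)"
        then obtain a b u v where y: "y = a *s \<phi> u + b *s \<phi> v" unfolding on_secant_def by blast
        have "y $ idx (\<alpha> i + \<beta> j) = (a * monom_eval (($) u) (\<alpha> i)) * monom_eval (($) u) (\<beta> j) +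
          (b * monom_eval (($) v) (\<alpha> i)) * monom_eval (($) v) (\<beta> j)" for i j
          by (simp only: y vector_add_component vector_smult_component veronese_nth[OF degd] monom_eval_add mult.assoc)
        then show "vanishes_at ?F (pt y)"
          unfolding vanishes_at_pt[OF hom] eval by (simp only: det3_rank_two)
      qed (use sub in auto)
      with p q have "vanishes_at ?F (pt q)" by blast
      then show "det3 (\<lambda>a b. q $ idx (\<alpha> a + \<beta> b)) = 0" unfolding vanishes_at_pt[OF hom] eval .
    qed
    with q show "p \<in> {pt y | y. y \<noteq> 0 \<and> (on_secant y \<or> on_tangent y)}" by blast
  next
    fix p :: "('a ^ 'm) set" assume "p \<in> {pt y | y. y \<noteq> 0 \<and> (on_secant y \<or> on_tangent y)}"
    then obtain y where y: "p = pt y" "y \<noteq> 0" "on_secant y \<or> on_tangent y" by blast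
    have "p \<in> zariski closure_of ?A"
    proof (cases "on_secant y")
      case True
      then show ?thesis using y closure_of_subset[of ?A zariski] sub by auto
    next
      case False
      with y(3) obtain u w where uw: "y = \<tau> u w" unfolding on_tangent_def by blast
      show ?thesis
      proof (rule in_zariski_closureI[OF _ sub])
        show "p \<in> proj_space" using y by simp
        fix F t assume hom: "homogeneous t F" and van: "\<And>q. q \<in> ?A \<Longrightarrow> vanishes_at F q"
        \<comment> \<open>the difference quotient of the curve \<open>\<phi> (u + T w)\<close>, which is a polynomial in \<open>T\<close>\<close>
        define c where "c i = poly_shift 1 (veronese_curve mon u w i)" for i
        have c: "veronese_curve mon u w i = pCons (\<phi> u $ i) (c i)" for i
          by (rule poly_eqI) (simp add: coeff_pCons c_def coeff_poly_shift coeff_veronese_curve_0 split: nat.split)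
        have "mpoly_eval F (\<chi> i. poly (c i) s) = 0" if s: "s \<noteq> 0" for s
        proof -
          have eq: "(\<chi> i. poly (c i) s) = (1 / s) *s \<phi> (u + s *s w) + (- 1 / s) *s \<phi> u"
          proof -
            have "\<phi> (u + s *s w) $ i = \<phi> u $ i + s * poly (c i) s" for i
              using arg_cong[OF poly_veronese_curve[of mon u w s], of "\<lambda>y. y $ i"] by (simp add: c)
            then show ?thesis using s by (simp add: vec_eq_iff field_simps)
          qed
          show ?thesis
          proof (cases "(\<chi> i. poly (c i) s) = 0")
            case True
            obtain v :: "'a ^ 'k" where v: "v \<noteq> 0" by (rule other_point[of 0])
            have "\<phi> v = 1 *s \<phi> v + 0 *s \<phi> v" by simp
            then have "on_secant (\<phi> v)" unfolding on_secant_def by blast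
            moreover have "\<phi> v \<noteq> 0" using v by simp
            ultimately have "pt (\<phi> v) \<in> ?A" by blast
            from van[OF this] have "mpoly_eval F 0 = 0" by (simp add: vanishes_at_def vec.span_zero)
            with True show ?thesis by simp
          next
            case False
            then have "pt (\<chi> i. poly (c i) s) \<in> ?A" using eq unfolding on_secant_def by blast
            from van[OF this] show ?thesis by (simp only: vanishes_at_pt[OF hom])
          qed
        qed
        then have "along c F = 0" by (intro poly_eq_0_if_zero_cofinitely) (simp add: poly_along)
        then have "mpoly_eval F (\<chi> i. coeff (c i) 0) = 0" using coeff_along_0[of c F] by simp
        moreover have "(\<chi> i. coeff (c i) 0) = y"
          by (simp add: vec_eq_iff uw c_def coeff_poly_shift)
        ultimately show "vanishes_at F p" using y by (simp add: vanishes_at_pt[OF hom])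
      qed
    qed
    then show "p \<in> secant_variety X" unfolding secant_variety_def union_of_secant_lines .
  }
qed

end

section \<open>Linear sections\<close>

lemma mpoly_pullback_eq: "mpoly_pullback A = compose (\<lambda>i. \<Sum>j\<in>UNIV. single (single j 1) (A $ i $ j))"
  unfolding mpoly_pullback_def by (rule ext) simp

lemma mpoly_eval_pullback: "mpoly_eval (mpoly_pullback A F) v = mpoly_eval F (A *v v)"
  by (simp add: mpoly_pullback_eq mpoly_eval_compose matrix_vector_mult_def)

lemma mpoly_pullback_simps [simp]:
  "mpoly_pullback A (F + G) = mpoly_pullback A F + mpoly_pullback A G"
  "mpoly_pullback A (F - G) = mpoly_pullback A F - mpoly_pullback A G"
  "mpoly_pullback A (F * G) = mpoly_pullback A F * mpoly_pullback A G"
  "mpoly_pullback A (F ^ n) = mpoly_pullback A F ^ n"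
  "mpoly_pullback A (mpoly_const c) = mpoly_const c"
  "mpoly_pullback A (mpoly_scale c F) = mpoly_scale c (mpoly_pullback A F)"
  by (simp_all add: mpoly_pullback_eq coeff_const.subst_add coeff_const.subst_diff coeff_const.subst_mult
      coeff_const.subst_power mpoly_scale_def)

lemma homogeneous_pullback:
  assumes "homogeneous t F"
  shows "homogeneous t (mpoly_pullback A F)"
proof -
  have "graded mdegree (t * 1) (mpoly_pullback A F)"
    unfolding mpoly_pullback_eq
    by (rule graded_compose) (use assms in \<open>auto intro!: graded_sum graded_single\<close>)
  then show ?thesis by (simp add: homogeneous_iff_graded)
qed

lemma mpoly_pullback_left_inverse:
  fixes A :: "'a::field_char_0 ^ 'c::finite ^ 'm::finite"
  assumes "B ** A = mat 1"
  shows "mpoly_pullback A (mpoly_pullback B G) = G"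
proof -
  have "mpoly_pullback A (mpoly_pullback B G) - G = 0"
  proof (rule mpoly_zero_if_eval_zero)
    fix v
    have "B *v (A *v v) = v" by (simp add: matrix_vector_mul_assoc assms)
    then show "mpoly_eval (mpoly_pullback A (mpoly_pullback B G) - G) v = 0"
      by (simp add: mpoly_eval_pullback)
  qed
  then show ?thesis by simp
qed

definition linear_points :: "'a::field ^ 'c::finite ^ 'm::finite \<Rightarrow> ('a ^ 'm) set set" where
  "linear_points A = {pt (A *v v) | v. v \<noteq> 0}"

lemma inj_matrix_eq_0: "inj ((*v) A) \<Longrightarrow> A *v v = 0 \<longleftrightarrow> v = (0 :: 'a::field ^ 'c::finite)"
  by (metis injD matrix_vector_mult_0_right)

lemma pullback_vanishing_ideal:
  fixes A :: "'a::field_char_0 ^ 'c::finite ^ 'm::finite"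
  shows "G \<in> vanishing_ideal (linear_points A) \<longleftrightarrow> mpoly_pullback A G = 0"
proof
  assume G: "G \<in> vanishing_ideal (linear_points A)"
  show "mpoly_pullback A G = 0"
  proof (rule mpoly_zero_if_eval_zero)
    fix v :: "'a ^ 'c"
    obtain v' :: "'a ^ 'c" where v': "v' \<noteq> 0" "v \<noteq> 0 \<Longrightarrow> v' = v"
      by (metis one_neq_zero vec_eq_iff vec_lambda_beta zero_index)
    then have "vanishes_at G (pt (A *v v'))" using G by (auto simp: vanishing_ideal_def linear_points_def)
    moreover have "A *v v \<in> pt (A *v v')"
      using v' by (cases "v = 0") (auto simp: vec.span_zero vec.span_base)
    ultimately show "mpoly_eval (mpoly_pullback A G) v = 0"
      by (simp add: mpoly_eval_pullback vanishes_at_def)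
  qed
next
  assume zero: "mpoly_pullback A G = 0"
  have "mpoly_eval G (c *s (A *v v)) = 0" for c v
    using arg_cong[OF zero, of "\<lambda>F. mpoly_eval F (c *s v)"]
    by (simp add: mpoly_eval_pullback vector_scalar_commute)
  then show "G \<in> vanishing_ideal (linear_points A)"
    by (auto simp: vanishing_ideal_def linear_points_def vanishes_at_def pt_def')
qed

text \<open>
  The ideal of the intersection with a linear subspace can be computed after restriction to the
  subspace, since polynomials on the subspace extend.
\<close>

lemma scheme_inter_linear_iff:
  fixes A :: "'a::field_char_0 ^ 'c::finite ^ 'm::finite"
  shows "F \<in> scheme_inter I (vanishing_ideal (linear_points A)) \<longleftrightarrow>
    (\<exists>F1\<in>I. mpoly_pullback A F = mpoly_pullback A F1)"
proof
  assume "F \<in> scheme_inter I (vanishing_ideal (linear_points A))"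
  then show "\<exists>F1\<in>I. mpoly_pullback A F = mpoly_pullback A F1"
    by (auto simp: scheme_inter_def pullback_vanishing_ideal)
next
  assume "\<exists>F1\<in>I. mpoly_pullback A F = mpoly_pullback A F1"
  then obtain F1 where F1: "F1 \<in> I" "mpoly_pullback A F = mpoly_pullback A F1" by blast
  then have "F - F1 \<in> vanishing_ideal (linear_points A)" by (simp add: pullback_vanishing_ideal)
  moreover have "F = F1 + (F - F1)" by simp
  ultimately show "F \<in> scheme_inter I (vanishing_ideal (linear_points A))"
    using F1(1) unfolding scheme_inter_def by blast
qed

lemma scheme_inter_linearI:
  fixes A :: "'a::field_char_0 ^ 'c::finite ^ 'm::finite"
  assumes inj: "inj ((*v) A)" and Q: "Q1 \<in> vanishing_ideal Y" "Q2 \<in> vanishing_ideal Y"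
    and F: "mpoly_pullback A F = mpoly_pullback A Q1 * G1 + mpoly_pullback A Q2 * G2"
  shows "F \<in> scheme_inter (vanishing_ideal Y) (vanishing_ideal (linear_points A))"
proof -
  from inj obtain B where B: "B ** A = mat 1" by (metis matrix_left_invertible_injective)
  have "mpoly_pullback A F = mpoly_pullback A (Q1 * mpoly_pullback B G1 + Q2 * mpoly_pullback B G2)"
    by (simp add: F mpoly_pullback_left_inverse[OF B])
  moreover have "Q1 * mpoly_pullback B G1 + Q2 * mpoly_pullback B G2 \<in> vanishing_ideal Y"
    using Q by (intro vanishing_ideal_add vanishing_ideal_mult)
  ultimately show ?thesis unfolding scheme_inter_linear_iff by blast
qed

lemma subspace_vanishing_ideal: "mpoly.subspace (vanishing_ideal A)"
  by (rule mpoly.subspaceI) (auto intro: vanishing_ideal_add vanishing_ideal_scale)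

lemma subspace_scheme_inter:
  "mpoly.subspace I \<Longrightarrow> mpoly.subspace J \<Longrightarrow> mpoly.subspace (scheme_inter I J)"
  unfolding scheme_inter_def by (rule mpoly.subspace_sums)

lemma vanishing_ideals_subset_scheme_inter:
  fixes Y Z :: "('a::field ^ 'm::finite) set set"
  shows
  "vanishing_ideal Y \<subseteq> scheme_inter (vanishing_ideal Y) (vanishing_ideal Z)"
  "vanishing_ideal Z \<subseteq> scheme_inter (vanishing_ideal Y) (vanishing_ideal Z)"
proof -
  have "F = F + 0" "F = 0 + F" for F :: "('a, 'm) mpoly" by simp_all
  then show "vanishing_ideal Y \<subseteq> scheme_inter (vanishing_ideal Y) (vanishing_ideal Z)"
    "vanishing_ideal Z \<subseteq> scheme_inter (vanishing_ideal Y) (vanishing_ideal Z)"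
    unfolding scheme_inter_def using vanishing_ideal_zero[of Y] vanishing_ideal_zero[of Z] by blast+
qed

subsection \<open>Hilbert functions\<close>

lemma subspace_homogeneous: "mpoly.subspace {F. homogeneous t F}"
  by (rule mpoly.subspaceI) (auto intro: homogeneous_add homogeneous_scale)

lemma homogeneous_span_monomials:
  "{F :: ('a::field, 'm::finite) mpoly. homogeneous t F} \<subseteq> mpoly.span ((\<lambda>m. single m 1) ` {m. mdegree m = t})"
proof safe
  fix F :: "('a, 'm) mpoly" assume F: "homogeneous t F"
  have "F = (\<Sum>m\<in>keys F. mpoly_scale (lookup F m) (single m 1))"
    by (subst mpoly_sum_singles) (simp add: mpoly_scale_def mpoly_const_def mult_single)
  also have "\<dots> \<in> mpoly.span ((\<lambda>m. single m 1) ` {m. mdegree m = t})"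
    using F by (intro mpoly.span_sum mpoly.span_scale mpoly.span_base) (auto simp: homogeneous_def)
  finally show "F \<in> mpoly.span ((\<lambda>m. single m 1) ` {m. mdegree m = t})" .
qed

lemma independent_homogeneous_card:
  fixes B :: "('a::field, 'm::finite) mpoly set"
  assumes "mpoly.independent B" "B \<subseteq> {F. homogeneous t F}"
  shows "finite B" "card B \<le> mpoly.dim {F :: ('a, 'm) mpoly. homogeneous t F}"
proof -
  obtain C where C: "C \<subseteq> {F :: ('a, 'm) mpoly. homogeneous t F}" "mpoly.independent C"
    "{F. homogeneous t F} \<subseteq> mpoly.span C" "card C = mpoly.dim {F :: ('a, 'm) mpoly. homogeneous t F}"
    using mpoly.basis_exists by blast
  have fin: "finite ((\<lambda>m :: 'm monom. single m (1 :: 'a)) ` {m. mdegree m = t})"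
    using finite_monomials_of_degree(1) by blast
  have "finite C"
    using mpoly.independent_span_bound[OF fin C(2)] C(1) homogeneous_span_monomials by blast
  from mpoly.independent_span_bound[OF this assms(1)] assms(2) C(3,4)
  show "finite B" "card B \<le> mpoly.dim {F :: ('a, 'm) mpoly. homogeneous t F}" by auto
qed

lemma hilbert_function_ge_2:
  fixes J :: "('a::field, 'm::finite) mpoly set"
  assumes J: "mpoly.subspace J" and e: "homogeneous t e1" "homogeneous t e2"
    and indep: "\<And>a b. mpoly_scale a e1 + mpoly_scale b e2 \<in> J \<Longrightarrow> a = 0 \<and> b = 0"
  shows "2 \<le> hilbert_function J t"
proof -
  let ?U = "{F \<in> J. homogeneous t F}"
  obtain B where B: "B \<subseteq> ?U" "mpoly.independent B" "?U \<subseteq> mpoly.span B" "card B = mpoly.dim ?U"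
    using mpoly.basis_exists by blast
  have span: "mpoly.span B \<subseteq> J" using B(1) J by (intro mpoly.span_minimal) auto
  have 2: "e2 \<notin> mpoly.span B"
  proof
    assume "e2 \<in> mpoly.span B"
    then have "mpoly_scale 0 e1 + mpoly_scale 1 e2 \<in> J" using span by (auto simp: mpoly_scale_def mpoly_const_def)
    from indep[OF this] show False by simp
  qed
  have 1: "e1 \<notin> mpoly.span (insert e2 B)"
  proof
    assume "e1 \<in> mpoly.span (insert e2 B)"
    then obtain k where "e1 - mpoly_scale k e2 \<in> mpoly.span B" unfolding mpoly.span_insert by blast
    then have "mpoly_scale 1 e1 + mpoly_scale (- k) e2 \<in> J"
      using span by (auto simp: mpoly_scale_def mpoly_const_def single_uminus)
    from indep[OF this] show False by simp
  qed
  have "mpoly.independent (insert e1 (insert e2 B))"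
    using 1 2 B(2) by (simp add: mpoly.independent_insert mpoly.span_base)
  note bound = independent_homogeneous_card[OF this, of t]
  have "e1 \<notin> insert e2 B" "e2 \<notin> B" using 1 2 by (auto simp: mpoly.span_base)
  then have "card B + 2 \<le> mpoly.dim {F :: ('a, 'm) mpoly. homogeneous t F}"
    using bound e B(1) by auto
  then show ?thesis unfolding hilbert_function_def using B(4) by simp
qed

lemma hilbert_function_le_card:
  fixes J :: "('a::field, 'm::finite) mpoly set"
  assumes E: "finite E" "E \<subseteq> {F. homogeneous t F}"
    and gen: "\<And>F. homogeneous t F \<Longrightarrow> \<exists>G\<in>mpoly.span E. F - G \<in> J"
  shows "hilbert_function J t \<le> card E"
proof -
  let ?U = "{F \<in> J. homogeneous t F}"
  obtain B where B: "B \<subseteq> ?U" "mpoly.independent B" "?U \<subseteq> mpoly.span B" "card B = mpoly.dim ?U"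
    using mpoly.basis_exists by blast
  have fin: "finite B" using independent_homogeneous_card(1)[OF B(2), of t] B(1) by blast
  have "{F. homogeneous t F} \<subseteq> mpoly.span (E \<union> B)"
  proof safe
    fix F :: "('a, 'm) mpoly" assume F: "homogeneous t F"
    then obtain G where G: "G \<in> mpoly.span E" "F - G \<in> J" using gen by blast
    have "homogeneous t G" using G(1) mpoly.span_minimal[OF E(2) subspace_homogeneous] by auto
    then have "F - G \<in> ?U" using F G(2) by (simp add: homogeneous_diff)
    then have "F - G \<in> mpoly.span (E \<union> B)" using B(3) mpoly.span_mono[of B "E \<union> B"] by auto
    moreover have "G \<in> mpoly.span (E \<union> B)" using G(1) mpoly.span_mono[of E "E \<union> B"] by auto
    ultimately show "F \<in> mpoly.span (E \<union> B)" using mpoly.span_add by fastforce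
  qed
  then have "mpoly.dim {F :: ('a, 'm) mpoly. homogeneous t F} \<le> card (E \<union> B)"
    using E(1) fin by (intro mpoly.dim_le_card) auto
  also have "\<dots> \<le> card E + card B" by (rule card_Un_le)
  finally show ?thesis unfolding hilbert_function_def using B(4) by simp
qed

lemma scheme_length_le:
  assumes "\<And>t. t \<ge> t0 \<Longrightarrow> hilbert_function J t \<le> k"
  shows "scheme_length J \<le> enat k"
proof -
  have "scheme_length J \<le> limsup (\<lambda>t. enat (hilbert_function J t))"
    unfolding scheme_length_def by (rule Liminf_le_Limsup) simp
  also have "\<dots> \<le> enat k"
    by (rule Limsup_bounded) (use assms in \<open>auto simp: eventually_sequentially\<close>)
  finally show ?thesis .
qed

lemma scheme_length_ge:
  assumes "\<And>t. t \<ge> t0 \<Longrightarrow> k \<le> hilbert_function J t"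
  shows "enat k \<le> scheme_length J"
  unfolding scheme_length_def
  by (rule Liminf_bounded) (use assms in \<open>auto simp: eventually_sequentially\<close>)

subsection \<open>Monomial ideals in the restriction\<close>

text \<open>
  A monomial ideal contains a polynomial as soon as it contains its monomials; two generators suffice for
  the ideals on a line that occur here.
\<close>

lemma mpoly_in_monomial_ideal:
  fixes G :: "('a::comm_ring_1, 'c) mpoly"
  assumes "\<And>m. m \<in> keys G \<Longrightarrow> (\<exists>m'. m = a + m') \<or> (\<exists>m'. m = b + m')"
  shows "\<exists>H1 H2. G = single a 1 * H1 + single b 1 * H2"
proof -
  let ?P = "\<lambda>G. \<exists>H1 H2. G = single a 1 * H1 + single b (1::'a) * H2"
  have "?P (\<Sum>m\<in>S. single m (lookup G m))"
    if "finite S" "S \<subseteq> keys G" for S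
    using that
  proof (induction S)
    case empty
    show ?case by (intro exI[of _ 0]) simp
  next
    case (insert m S)
    then obtain H1 H2 where H: "(\<Sum>m\<in>S. single m (lookup G m)) =
        single a 1 * H1 + single b 1 * H2" by auto
    let ?c = "lookup G m"
    consider m' where "m = a + m'" | m' where "m = b + m'" using assms[of m] insert.prems by auto
    then have "\<exists>K1 K2. single m ?c = single a 1 * K1 + single b 1 * K2"
    proof cases
      case 1
      then have "single m ?c = single a 1 * single m' ?c + single b 1 * 0"
        by (simp add: mult_single)
      then show ?thesis by blast
    next
      case 2
      then have "single m ?c = single a 1 * 0 + single b 1 * single m' ?c"
        by (simp add: mult_single)
      then show ?thesis by blast
    qed
    then obtain K1 K2 where "single m ?c = single a 1 * K1 + single b 1 * K2" by blast
    with H insert.hyps have "(\<Sum>m\<in>insert m S. single m (lookup G m)) =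
        single a 1 * (K1 + H1) + single b 1 * (K2 + H2)"
      by (simp add: algebra_simps)
    then show ?case by blast
  qed
  from this[of "keys G"] show ?thesis using mpoly_sum_singles[of G] by simp
qed

text \<open>
  Along lines in direction \<open>j\<close>, the coefficient of degree \<open>e\<close> is the sum of the terms with exponent \<open>e\<close> of
  the \<open>j\<close>-th variable, as a function of the other variables; so these terms vanish by independence of
  the monomials.
\<close>

lemma no_exponent_if_coeff_zero:
  fixes G :: "('a::field_char_0, 'c::finite) mpoly"
  assumes zero: "\<And>g. coeff (along (\<lambda>i. if i = j then [:0, 1:] else [:g i:]) G) e = 0"
    and "m0 \<in> keys G"
  shows "lookup m0 j \<noteq> e"
proof
  assume m0: "lookup m0 j = e"
  let ?S = "{m \<in> keys G. lookup m j = e}"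
  have "(\<Sum>m\<in>?S. lookup G m * monom_eval g m) = 0" for g
  proof -
    let ?R = "\<lambda>m. \<Prod>i\<in>UNIV - {j}. g i ^ lookup m i"
    have split: "monom_eval f m = f j ^ lookup m j * (\<Prod>i\<in>UNIV - {j}. f i ^ lookup m i)"
      for f :: "'c \<Rightarrow> 'b::comm_ring_1" and m
      unfolding monom_eval_def by (rule prod.remove) auto
    have "monom_eval (\<lambda>i. if i = j then [:0, 1:] else [:g i:]) m = monom 1 (lookup m j) * [:?R m:]" for m
    proof -
      have "(\<Prod>i\<in>UNIV - {j}. (if i = j then [:0, 1:] else [:g i:]) ^ lookup m i) =
          (\<Prod>i\<in>UNIV - {j}. [:g i ^ lookup m i:])"
        by (intro prod.cong) (auto simp: poly_const_pow)
      also have "\<dots> = [:?R m:]" by (induction rule: infinite_finite_induct) (auto simp: one_pCons[symmetric] pCons_one)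
      finally show ?thesis unfolding split[of "\<lambda>i. if i = j then [:0, 1:] else [:g i:]"] by (simp add: monom_altdef)
    qed
    then have "coeff (along (\<lambda>i. if i = j then [:0, 1:] else [:g i:]) G) e =
       (\<Sum>m\<in>keys G. if lookup m j = e then lookup G m * ?R m else 0)"
      unfolding mpoly_subst_def coeff_sum
      by (intro sum.cong) (auto simp: mult.commute[of "monom _ _"] smult_monom)
    also have "\<dots> = (\<Sum>m\<in>?S. lookup G m * ?R m)"
      by (simp add: sum.inter_filter)
    finally have "(\<Sum>m\<in>?S. lookup G m * ?R m) = 0" using zero by simp
    moreover have "(\<Sum>m\<in>?S. lookup G m * monom_eval g m) = g j ^ e * (\<Sum>m\<in>?S. lookup G m * ?R m)"
      by (simp add: sum_distrib_left split mult_ac)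
    ultimately show ?thesis by simp
  qed
  from monom_functions_independent[OF _ this, of m0] have "lookup G m0 = 0"
    using assms(2) m0 by simp
  with assms(2) show False by (simp add: in_keys_iff)
qed

section \<open>Lines through a point of the Veronese variety\<close>

lemma monom_dvd_iff:
  fixes a m :: "'k monom"
  shows "(\<exists>m'. m = a + m') \<longleftrightarrow> (\<forall>i. lookup a i \<le> lookup m i)"
proof
  assume "\<forall>i. lookup a i \<le> lookup m i"
  then have "m = a + (m - a)" by (intro poly_mapping_eqI) (simp add: lookup_add lookup_minus)
  then show "\<exists>m'. m = a + m'" ..
qed (auto simp: lookup_add)

lemma mdegree_2: "mdegree (m :: 2 monom) = lookup m 1 + lookup m 2"
  by (simp add: mdegree_def sum_2)

lemma monom_2_eqI:
  "lookup m 1 = lookup m' 1 \<Longrightarrow> lookup m 2 = lookup m' 2 \<Longrightarrow> m = (m' :: 2 monom)"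
proof (rule poly_mapping_eqI)
  fix i :: 2
  assume "lookup m 1 = lookup m' 1" "lookup m 2 = lookup m' 2"
  then show "lookup m i = lookup m' i" using exhaust_2[of i] by auto
qed

definition line_matrix :: "'a::field ^ 'm::finite \<Rightarrow> 'a ^ 'm \<Rightarrow> 'a ^ 2 ^ 'm" where
  "line_matrix x y = (\<chi> i j. if j = 1 then x $ i else y $ i)"

lemma line_matrix_mult: "line_matrix x y *v v = v $ 1 *s x + v $ 2 *s y"
  by (simp add: vec_eq_iff line_matrix_def matrix_vector_mult_def sum_2 mult.commute)

definition plane :: "'a::field ^ 'm::finite \<Rightarrow> 'a ^ 'm \<Rightarrow> ('a ^ 'm) set" where
  "plane x y = {z. \<exists>a b. z = a *s x + b *s y}"

lemma plane_commute: "plane x y = plane y x"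
  unfolding plane_def by (metis add.commute)

lemma plane_left: "x \<in> plane x y"
proof -
  have "x = 1 *s x + 0 *s y" by simp
  then show ?thesis unfolding plane_def by blast
qed

lemma plane_right: "y \<in> plane x y"
  using plane_left[of y x] plane_commute[of x y] by simp

lemma plane_exchange:
  assumes "b \<noteq> 0" and q: "q = a *s x + b *s y"
  shows "plane x q = plane x y"
proof -
  have comb: "c *s x + e *s q = (c + e * a) *s x + (e * b) *s y" for c e
    by (simp add: q vec_eq_iff algebra_simps)
  have "(\<exists>c e. z = c *s x + e *s q) \<longleftrightarrow> (\<exists>c e. z = c *s x + e *s y)" for z
  proof
    assume "\<exists>c e. z = c *s x + e *s y"
    then obtain c e where "z = c *s x + e *s y" by blast
    then have "z = (c - e / b * a) *s x + (e / b) *s q" unfolding comb using assms(1) by simp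
    then show "\<exists>c e. z = c *s x + e *s q" by blast
  qed (use comb in blast)
  then show ?thesis unfolding plane_def by simp
qed

definition independent_pair :: "'a::field ^ 'm::finite \<Rightarrow> 'a ^ 'm \<Rightarrow> bool" where
  "independent_pair x y \<longleftrightarrow> (\<forall>a b. a *s x + b *s y = 0 \<longrightarrow> a = 0 \<and> b = 0)"

lemma independent_pairI:
  assumes "x \<noteq> 0" "y \<noteq> 0" "pt x \<noteq> pt y"
  shows "independent_pair x y"
  unfolding independent_pair_def
proof (intro allI impI)
  fix a b assume eq: "a *s x + b *s y = 0"
  show "a = 0 \<and> b = 0"
  proof (cases "a = 0")
    case True
    then show ?thesis using eq assms(2) by simp
  next
    case False
    have "x = (- b / a) *s y"
      using eq False by (simp add: vec_eq_iff divide_simps add_eq_0_iff mult.commute)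
    moreover from this have "- b / a \<noteq> 0" using assms(1) by auto
    ultimately have "pt x = pt y" by (metis pt_scale)
    with assms(3) show ?thesis by simp
  qed
qed

lemma inj_line_matrix:
  assumes "independent_pair x y"
  shows "inj ((*v) (line_matrix x y))"
proof (rule injI)
  fix v w assume "line_matrix x y *v v = line_matrix x y *v w"
  then have "(v $ 1 - w $ 1) *s x + (v $ 2 - w $ 2) *s y = 0"
    by (simp add: line_matrix_mult algebra_simps vec_eq_iff)
  with assms have "v $ 1 - w $ 1 = 0 \<and> v $ 2 - w $ 2 = 0" unfolding independent_pair_def by blast
  then show "v = w" by (simp add: vec_eq_iff forall_2)
qed

lemma pt_line_in_linear_points:
  fixes x y :: "'a::field ^ 'm::finite"
  assumes "independent_pair x y" "a \<noteq> 0 \<or> b \<noteq> 0"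
  shows "pt (a *s x + b *s y) \<in> linear_points (line_matrix x y)"
proof -
  define v :: "'a ^ 2" where "v = (\<chi> i. if i = 1 then a else b)"
  have v: "v $ 1 = a" "v $ 2 = b" by (simp_all add: v_def)
  have "line_matrix x y *v v = a *s x + b *s y" by (simp add: line_matrix_mult v)
  moreover have "v \<noteq> 0" using assms(2) v by auto
  ultimately show ?thesis unfolding linear_points_def by (metis (mono_tags, lifting) mem_Collect_eq)
qed

lemma linear_points_line_matrix:
  assumes "independent_pair x y"
  shows "linear_points (line_matrix x y) = {pt z | z. z \<noteq> 0 \<and> z \<in> plane x y}"
proof (intro equalityI subsetI)
  fix p assume "p \<in> linear_points (line_matrix x y)"
  then obtain v where v: "v \<noteq> 0" "p = pt (line_matrix x y *v v)" by (auto simp: linear_points_def)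
  then have "line_matrix x y *v v \<noteq> 0" using inj_matrix_eq_0[OF inj_line_matrix[OF assms]] by simp
  with v show "p \<in> {pt z | z. z \<noteq> 0 \<and> z \<in> plane x y}"
    using line_matrix_mult[of x y v] unfolding plane_def by blast
next
  fix p assume "p \<in> {pt z | z. z \<noteq> 0 \<and> z \<in> plane x y}"
  then obtain z a b where z: "p = pt z" "z \<noteq> 0" "z = a *s x + b *s y" unfolding plane_def by blast
  then have "a \<noteq> 0 \<or> b \<noteq> 0" by auto
  then show "p \<in> linear_points (line_matrix x y)"
    using pt_line_in_linear_points[OF assms] z by simp
qed

lemma independent_pair_exchange:
  assumes xy: "independent_pair x y" and b: "b \<noteq> 0" and q: "q = a *s x + b *s y"
  shows "independent_pair x q"
proof -
  have "c *s x + e *s q = (c + e * a) *s x + (e * b) *s y" for c e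
    by (simp add: q vec_eq_iff algebra_simps)
  then show ?thesis using xy b unfolding independent_pair_def by fastforce
qed

lemma pullback_line_var: "mpoly_pullback (line_matrix x y) (var i) = mpoly_const (x $ i) * var 1 + mpoly_const (y $ i) * var 2"
  by (simp add: mpoly_pullback_eq sum_2 line_matrix_def mpoly_const_def var_def mult_single coeff_const.subst_single
      coeff_const.h_one)

lemma pullback_line_quadric:
  "mpoly_pullback (line_matrix x y) (quadric i j k l) =
     mpoly_const (x $ i * x $ j - x $ k * x $ l) * (var 1 * var 1) +
     mpoly_const (x $ i * y $ j + y $ i * x $ j - (x $ k * y $ l + y $ k * x $ l)) * (var 1 * var 2) +
     mpoly_const (y $ i * y $ j - y $ k * y $ l) * (var 2 * var 2)"
proof -
  have const_diff: "mpoly_const (a - b) = (mpoly_const a - mpoly_const b :: ('a, 2) mpoly)" for a b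
    by (simp add: mpoly_const_def single_diff)
  show ?thesis
    by (simp add: quadric_def pullback_line_var const_diff coeff_const.h_add coeff_const.h_mult algebra_simps)
qed

lemma along_pullback_line:
  "along p (mpoly_pullback (line_matrix x y) F) = along (\<lambda>i. smult (x $ i) (p 1) + smult (y $ i) (p 2)) F"
  by (simp add: mpoly_pullback_eq coeff_poly.subst_compose coeff_poly.subst_add coeff_poly.subst_single
      sum_2 line_matrix_def)

lemma exponent_2_pullback_line:
  fixes F :: "('a::field_char_0, 'm::finite) mpoly"
  assumes "\<And>c. coeff (along (\<lambda>i. [:c * x $ i, y $ i:]) F) e = 0"
    and "m \<in> keys (mpoly_pullback (line_matrix x y) F)"
  shows "lookup m 2 \<noteq> e"
proof (rule no_exponent_if_coeff_zero[OF _ assms(2)])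
  fix g :: "2 \<Rightarrow> 'a"
  show "coeff (along (\<lambda>i. if i = 2 then [:0, 1:] else [:g i:]) (mpoly_pullback (line_matrix x y) F)) e = 0"
    using assms(1)[of "g 1"] by (simp add: along_pullback_line mult.commute)
qed

lemma exponent_1_pullback_line:
  fixes F :: "('a::field_char_0, 'm::finite) mpoly"
  assumes "\<And>c. mpoly_eval F (c *s y) = 0"
    and "m \<in> keys (mpoly_pullback (line_matrix x y) F)"
  shows "lookup m 1 \<noteq> 0"
proof (rule no_exponent_if_coeff_zero[OF _ assms(2)])
  fix g :: "2 \<Rightarrow> 'a"
  show "coeff (along (\<lambda>i. if i = 1 then [:0, 1:] else [:g i:]) (mpoly_pullback (line_matrix x y) F)) 0 = 0"
    using assms(1)[of "g 2"] by (simp add: coeff_along_0 mpoly_eval_pullback line_matrix_mult)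
qed

text \<open>
  The ideal restricts to the line as the ideal of a quadratic monomial; for \<open>j = 1\<close> this defines two
  points, for \<open>j = 2\<close> a double point. In each degree from two on, all but two monomials are multiples of the
  quadratic monomial, and these two form a basis of the coordinate ring.
\<close>

lemma scheme_on_line:
  fixes A :: "'a::field_char_0 ^ 2 ^ 'm::finite" and j :: 2
  defines "\<mu> \<equiv> single j 1 + single 2 1"
  assumes inj: "inj ((*v) A)" and Q: "Q \<in> vanishing_ideal Y" "mpoly_pullback A Q = mpoly_const c * (var j * var 2)" "c \<noteq> 0"
    and dvd: "\<And>F m. F \<in> vanishing_ideal Y \<Longrightarrow> m \<in> keys (mpoly_pullback A F) \<Longrightarrow> \<exists>m'. m = \<mu> + m'"
  shows "F \<in> scheme_inter (vanishing_ideal Y) (vanishing_ideal (linear_points A)) \<longleftrightarrow>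
      (\<forall>m\<in>keys (mpoly_pullback A F). \<exists>m'. m = \<mu> + m')" (is "?in F")
    and "scheme_length (scheme_inter (vanishing_ideal Y) (vanishing_ideal (linear_points A))) = 2"
proof -
  let ?J = "scheme_inter (vanishing_ideal Y) (vanishing_ideal (linear_points A))"
  have iff: "F \<in> ?J \<longleftrightarrow> (\<forall>m\<in>keys (mpoly_pullback A F). \<exists>m'. m = \<mu> + m')" for F
  proof
    assume "F \<in> ?J"
    then show "\<forall>m\<in>keys (mpoly_pullback A F). \<exists>m'. m = \<mu> + m'"
      unfolding scheme_inter_linear_iff using dvd by auto
  next
    assume "\<forall>m\<in>keys (mpoly_pullback A F). \<exists>m'. m = \<mu> + m'"
    then obtain H1 H2 where "mpoly_pullback A F = single \<mu> 1 * H1 + single \<mu> 1 * H2"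
      using mpoly_in_monomial_ideal[of "mpoly_pullback A F" \<mu> \<mu>] by blast
    moreover have "single \<mu> 1 = var j * (var 2 :: ('a, 2) mpoly)"
      by (simp add: \<mu>_def var_def mult_single)
    moreover have "mpoly_const c * mpoly_const (1 / c) = (1 :: ('a, 2) mpoly)"
      using Q(3) by (simp add: mpoly_const_def mult_single)
    then have "var j * var 2 = mpoly_pullback A Q * (mpoly_const (1 / c) :: ('a, 2) mpoly)"
      unfolding Q(2) by (simp add: mult_ac)
    ultimately have "mpoly_pullback A F = mpoly_pullback A Q * (mpoly_const (1 / c) * (H1 + H2)) + mpoly_pullback A Q * 0"
      by (simp add: algebra_simps)
    then show "F \<in> ?J" by (rule scheme_inter_linearI[OF inj Q(1) Q(1)])
  qed
  then show "?in F" .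
  from inj obtain B where B: "B ** A = mat 1" by (metis matrix_left_invertible_injective)
  define m2 where "m2 t = (if j = 1 then single 2 t else single 1 (t - 1) + single (2::2) 1)" for t :: nat
  define m1 where "m1 t = single (1::2) t" for t :: nat
  have j: "j = 1 \<or> j = 2" by (rule exhaust_2)
  have deg: "mdegree (m1 t) = t" "mdegree (m2 t) = t" if "t \<ge> 2" for t
    using that by (auto simp: m1_def m2_def)
  have ne: "m1 t \<noteq> m2 t" if "t \<ge> 2" for t
  proof
    assume "m1 t = m2 t"
    from arg_cong[OF this, of "\<lambda>m. lookup m 2"] show False
      using that by (auto simp: m1_def m2_def lookup_add lookup_single when_def split: if_splits)
  qed
  have dvd_iff: "(\<exists>m'. m = \<mu> + m') \<longleftrightarrow> m \<noteq> m1 t \<and> m \<noteq> m2 t" if m: "mdegree m = t" and "t \<ge> 2" for m t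
  proof -
    have "m = m1 t \<longleftrightarrow> lookup m 2 = 0"
    proof
      assume "m = m1 t"
      then show "lookup m 2 = 0" by (simp add: m1_def lookup_single)
    next
      assume "lookup m 2 = 0"
      with m show "m = m1 t" by (intro monom_2_eqI) (simp_all add: m1_def lookup_single mdegree_2)
    qed
    moreover have "m = m2 t \<longleftrightarrow> (if j = 1 then lookup m 1 = 0 else lookup m 2 = 1)"
    proof
      assume "m = m2 t"
      then show "if j = 1 then lookup m 1 = 0 else lookup m 2 = 1"
        by (simp add: m2_def lookup_add lookup_single)
    next
      assume "if j = 1 then lookup m 1 = 0 else lookup m 2 = 1"
      with m that(2) show "m = m2 t"
        by (intro monom_2_eqI) (auto simp: m2_def lookup_add lookup_single mdegree_2 split: if_splits)
    qed
    moreover have "(\<exists>m'. m = \<mu> + m') \<longleftrightarrow>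
        (if j = 1 then lookup m 1 \<ge> 1 \<and> lookup m 2 \<ge> 1 else lookup m 2 \<ge> 2)"
      unfolding monom_dvd_iff forall_2 using j by (auto simp: \<mu>_def lookup_add lookup_single when_def)
    ultimately show ?thesis by auto
  qed
  define e1 where "e1 t = mpoly_pullback B (single (m1 t) 1)" for t
  define e2 where "e2 t = mpoly_pullback B (single (m2 t) 1)" for t
  have hom: "homogeneous t (e1 t)" "homogeneous t (e2 t)" if "t \<ge> 2" for t
    using deg[OF that] by (simp_all add: e1_def e2_def homogeneous_pullback homogeneous_single)
  have Ae: "mpoly_pullback A (e1 t) = single (m1 t) 1" "mpoly_pullback A (e2 t) = single (m2 t) 1" for t
    by (simp_all add: e1_def e2_def mpoly_pullback_left_inverse[OF B])
  have subspace: "mpoly.subspace ?J" by (intro subspace_scheme_inter subspace_vanishing_ideal)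
  have "2 \<le> hilbert_function ?J t" if t: "t \<ge> 2" for t
  proof (rule hilbert_function_ge_2[OF subspace hom[OF t]])
    fix a b assume ab: "mpoly_scale a (e1 t) + mpoly_scale b (e2 t) \<in> ?J"
    let ?G = "mpoly_pullback A (mpoly_scale a (e1 t) + mpoly_scale b (e2 t))"
    have G: "lookup ?G m = (if m = m1 t then a else 0) + (if m = m2 t then b else 0)" for m
      by (simp add: Ae lookup_add mpoly_scale_lookup lookup_single when_def)
    have "m1 t \<notin> keys ?G" "m2 t \<notin> keys ?G"
      using ab iff dvd_iff[OF deg(1)[OF t] t] dvd_iff[OF deg(2)[OF t] t] by blast+
    then show "a = 0 \<and> b = 0"
      using ne[OF t] unfolding in_keys_iff G by auto
  qed
  then have ge: "enat 2 \<le> scheme_length ?J" by (rule scheme_length_ge)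
  have "hilbert_function ?J t \<le> card {e1 t, e2 t}" if t: "t \<ge> 2" for t
  proof (rule hilbert_function_le_card)
    show "{e1 t, e2 t} \<subseteq> {F. homogeneous t F}" using hom[OF t] by simp
    fix F :: "('a, 'm) mpoly" assume F: "homogeneous t F"
    let ?G = "mpoly_pullback A F"
    let ?E = "mpoly_scale (lookup ?G (m1 t)) (e1 t) + mpoly_scale (lookup ?G (m2 t)) (e2 t)"
    show "\<exists>E\<in>mpoly.span {e1 t, e2 t}. F - E \<in> ?J"
    proof
      show "?E \<in> mpoly.span {e1 t, e2 t}" by (intro mpoly.span_add mpoly.span_scale mpoly.span_base) auto
      show "F - ?E \<in> ?J" unfolding iff
      proof
        fix m assume m: "m \<in> keys (mpoly_pullback A (F - ?E))"
        have eq: "lookup (mpoly_pullback A (F - ?E)) m =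
            lookup ?G m - (if m = m1 t \<or> m = m2 t then lookup ?G m else 0)"
          using ne[OF t] by (auto simp: Ae lookup_add lookup_minus mpoly_scale_lookup lookup_single when_def)
        have "homogeneous t (mpoly_pullback A (F - ?E))"
          using F hom[OF t] by (intro homogeneous_pullback homogeneous_diff homogeneous_add homogeneous_scale)
        with m have "mdegree m = t" by (simp add: homogeneous_def)
        moreover have "m \<noteq> m1 t \<and> m \<noteq> m2 t" using m eq by (auto simp: in_keys_iff)
        ultimately show "\<exists>m'. m = \<mu> + m'" using dvd_iff t by blast
      qed
    qed
  qed simp
  moreover have "card {e1 t, e2 t} \<le> 2" for t by (simp add: card_insert_if)
  ultimately have "hilbert_function ?J t \<le> 2" if "t \<ge> 2" for t using that le_trans by blast
  then have "scheme_length ?J \<le> enat 2" by (rule scheme_length_le)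
  with ge show "scheme_length ?J = 2" by (simp add: numeral_eq_enat)
qed

context veronese_monomials
begin

lemma quadric_off_X:
  assumes "y \<noteq> 0" "pt y \<notin> X"
  obtains i j k l where "mon i + mon j = mon k + mon l" "y $ i * y $ j - y $ k * y $ l \<noteq> 0"
  using veronese_variety_cut_out_by_quadrics[OF assms(1)] assms(2) by (metis right_minus_eq)

text \<open>
  A form vanishing on \<open>X\<close> vanishes at both points of \<open>X\<close> on the line, so its restriction is divisible by
  \<open>s t\<close>. Conversely, a quadric that does not vanish at \<open>q\<close> restricts to a nonzero multiple of \<open>s t\<close>.
\<close>

lemma secant_line_section:
  fixes u v :: "'a::{alg_closed_field, field_char_0} ^ 'k"
  assumes indep: "independent_pair (\<phi> u) (\<phi> v)"
    and q: "q \<noteq> 0" "pt q \<notin> X" "q = a *s \<phi> u + b *s \<phi> v"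
  defines "A \<equiv> line_matrix (\<phi> u) (\<phi> v)"
  shows "F \<in> scheme_inter (vanishing_ideal X) (vanishing_ideal (linear_points A)) \<longleftrightarrow>
      (\<forall>m\<in>keys (mpoly_pullback A F). \<exists>m'. m = (single 1 1 + single 2 1) + m')" (is ?th1)
    and "scheme_length (scheme_inter (vanishing_ideal X) (vanishing_ideal (linear_points A))) = 2" (is ?th2)
proof -
  obtain i j k l where rel: "mon i + mon j = mon k + mon l" and Qq: "q $ i * q $ j - q $ k * q $ l \<noteq> 0"
    by (rule quadric_off_X[OF q(1,2)])
  define c where "c = \<phi> u $ i * \<phi> v $ j + \<phi> v $ i * \<phi> u $ j - (\<phi> u $ k * \<phi> v $ l + \<phi> v $ k * \<phi> u $ l)"
  have uu: "\<phi> u $ i * \<phi> u $ j - \<phi> u $ k * \<phi> u $ l = 0" for u :: "'a ^ 'k"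
    using veronese_vector_quadric[OF rel, of u] by simp
  have "q $ i * q $ j - q $ k * q $ l = a * a * (\<phi> u $ i * \<phi> u $ j - \<phi> u $ k * \<phi> u $ l) + a * b * c +
      b * b * (\<phi> v $ i * \<phi> v $ j - \<phi> v $ k * \<phi> v $ l)"
    by (simp add: q(3) c_def algebra_simps)
  with Qq have c: "c \<noteq> 0" by (auto simp: uu)
  have pull: "mpoly_pullback A (quadric i j k l) = mpoly_const c * (var 1 * var 2)"
    unfolding A_def pullback_line_quadric uu c_def by (simp add: mpoly_const_def)
  have dvd: "\<exists>m'. m = single 1 1 + single 2 1 + m'"
    if F: "F \<in> vanishing_ideal X" and m: "m \<in> keys (mpoly_pullback A F)" for F :: "('a, 'm) mpoly" and m
  proof -
    have "lookup m 1 \<noteq> 0"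
      by (rule exponent_1_pullback_line[OF _ m[unfolded A_def]]) (rule vanishes_on_veronese[OF F])
    moreover have "lookup m 2 \<noteq> 0"
    proof (rule exponent_2_pullback_line[OF _ m[unfolded A_def]])
      fix c
      have "(\<chi> i. c * \<phi> u $ i) = c *s \<phi> u" by (simp add: vec_eq_iff)
      then show "coeff (along (\<lambda>i. [:c * \<phi> u $ i, \<phi> v $ i:]) F) 0 = 0"
        using vanishes_on_veronese[OF F, of c u] by (simp add: coeff_along_0)
    qed
    ultimately show ?thesis unfolding monom_dvd_iff forall_2 by (auto simp: lookup_add lookup_single when_def)
  qed
  have inj: "inj ((*v) A)" unfolding A_def by (rule inj_line_matrix[OF indep])
  note thms = scheme_on_line[where j = 1, OF inj quadric_in_ideal[OF rel] pull c dvd]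
  show ?th1 ?th2 by (rule thms, assumption, assumption)+
qed

text \<open>
  Here a form vanishing on \<open>X\<close> vanishes to second order at \<open>\<phi> u\<close>, so its restriction is divisible by \<open>t\<^sup>2\<close>.
\<close>

lemma tangent_line_section:
  fixes u w :: "'a::{alg_closed_field, field_char_0} ^ 'k"
  assumes indep: "independent_pair (\<phi> u) (\<tau> u w)" and q: "\<tau> u w \<noteq> 0" "pt (\<tau> u w) \<notin> X"
  defines "A \<equiv> line_matrix (\<phi> u) (\<tau> u w)"
  shows "F \<in> scheme_inter (vanishing_ideal X) (vanishing_ideal (linear_points A)) \<longleftrightarrow>
      (\<forall>m\<in>keys (mpoly_pullback A F). \<exists>m'. m = (single 2 1 + single 2 1) + m')" (is ?th1)
    and "scheme_length (scheme_inter (vanishing_ideal X) (vanishing_ideal (linear_points A))) = 2" (is ?th2)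
    and "\<exists>Q c. Q \<in> vanishing_ideal X \<and> mpoly_pullback A Q = mpoly_const c * (var 2 * var 2) \<and> c \<noteq> 0" (is ?th3)
proof -
  obtain i j k l where rel: "mon i + mon j = mon k + mon l"
    and Qq: "\<tau> u w $ i * \<tau> u w $ j - \<tau> u w $ k * \<tau> u w $ l \<noteq> 0" (is "?c \<noteq> 0")
    by (rule quadric_off_X[OF q])
  have pull: "mpoly_pullback A (quadric i j k l) = mpoly_const ?c * (var 2 * var 2)"
    unfolding A_def pullback_line_quadric
    using veronese_vector_quadric[OF rel, of u] tangent_vector_quadric[OF rel, of u w]
    by (simp add: mpoly_const_def)
  have dvd: "\<exists>m'. m = single 2 1 + single 2 1 + m'"
    if F: "F \<in> vanishing_ideal X" and m: "m \<in> keys (mpoly_pullback A F)" for F :: "('a, 'm) mpoly" and m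
  proof -
    have "lookup m 2 \<noteq> 0"
    proof (rule exponent_2_pullback_line[OF _ m[unfolded A_def]])
      fix c
      have "(\<chi> i. c * \<phi> u $ i) = c *s \<phi> u" by (simp add: vec_eq_iff)
      then show "coeff (along (\<lambda>i. [:c * \<phi> u $ i, \<tau> u w $ i:]) F) 0 = 0"
        using vanishes_on_veronese[OF F, of c u] by (simp add: coeff_along_0)
    qed
    moreover have "lookup m 2 \<noteq> 1"
    proof (rule exponent_2_pullback_line[OF _ m[unfolded A_def]])
      fix c
      show "coeff (along (\<lambda>i. [:c * \<phi> u $ i, \<tau> u w $ i:]) F) 1 = 0"
        using sum_pderiv_eq_coeff_along[of F "c *s \<phi> u" "\<tau> u w"] derivative_along_tangent_vanishes[OF F, of c u w]
        by simp
    qed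
    ultimately show ?thesis unfolding monom_dvd_iff forall_2 by (auto simp: lookup_add lookup_single when_def)
  qed
  have inj: "inj ((*v) A)" unfolding A_def by (rule inj_line_matrix[OF indep])
  note thms = scheme_on_line[where j = 2, OF inj quadric_in_ideal[OF rel] pull Qq dvd]
  show ?th1 ?th2 by (rule thms, assumption, assumption)+
  show ?th3 using quadric_in_ideal[OF rel] pull Qq by blast
qed

text \<open>
  A line through \<open>\<phi> u\<close> and \<open>q\<close> that is neither secant nor tangent meets \<open>X\<close> in a reduced point. The
  restrictions of the quadrics to the line are combinations of the two forms \<open>s t\<close> and \<open>t\<^sup>2\<close>; if they
  span a space of dimension one, a further zero gives a secant line, or a double zero a tangent line.
\<close>

lemma transversal_line_section:
  fixes u :: "'a::{alg_closed_field, field_char_0} ^ 'k"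
  assumes "u \<noteq> 0" and q: "q \<noteq> 0" "pt q \<notin> X"
    and not_secant: "\<not> (\<exists>v a b. q = a *s \<phi> u + b *s \<phi> v)" and not_tangent: "\<not> (\<exists>w. q = \<tau> u w)"
  shows "scheme_length (scheme_inter (vanishing_ideal X) (vanishing_ideal (linear_points (line_matrix (\<phi> u) q)))) \<le> 1"
proof -
  have indep: "independent_pair (\<phi> u) q"
  proof (rule independent_pairI)
    show "pt (\<phi> u) \<noteq> pt q" using q(2) veronese_in_X[of u] assms(1) by metis
  qed (use assms in auto)
  define A where "A = line_matrix (\<phi> u) q"
  have inj: "inj ((*v) A)" unfolding A_def by (rule inj_line_matrix[OF indep])
  define Bf where "Bf i j k l = \<phi> u $ i * q $ j + q $ i * \<phi> u $ j - (\<phi> u $ k * q $ l + q $ k * \<phi> u $ l)" for i j k l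
  define Cf where "Cf i j k l = q $ i * q $ j - q $ k * q $ l" for i j k l
  have pull: "mpoly_pullback A (quadric i j k l) = mpoly_const (Bf i j k l) * (var 1 * var 2) +
     mpoly_const (Cf i j k l) * (var 2 * var 2)" if "mon i + mon j = mon k + mon l" for i j k l
    unfolding A_def pullback_line_quadric Bf_def Cf_def using veronese_vector_quadric[OF that, of u]
    by (simp add: mpoly_const_def)
  obtain i j k l i' j' k' l' where rel: "mon i + mon j = mon k + mon l" "mon i' + mon j' = mon k' + mon l'"
    and \<delta>: "Bf i j k l * Cf i' j' k' l' - Bf i' j' k' l' * Cf i j k l \<noteq> 0"
  proof (rule ccontr)
    assume "\<not> thesis"
    with that have dep: "Bf i j k l * Cf i' j' k' l' = Bf i' j' k' l' * Cf i j k l"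
      if "mon i + mon j = mon k + mon l" "mon i' + mon j' = mon k' + mon l'" for i j k l i' j' k' l'
      using that by fastforce
    have "\<exists>i j k l. mon i + mon j = mon k + mon l \<and> Bf i j k l \<noteq> 0"
    proof (rule ccontr)
      assume *: "\<not> ?thesis"
      have "\<exists>w. q = \<tau> u w"
      proof (rule tangent_cut_out_by_quadrics[OF assms(1)])
        fix i j k l assume "mon i + mon j = mon k + mon l"
        with * have "Bf i j k l = 0" by blast
        then show "\<phi> u $ i * q $ j + q $ i * \<phi> u $ j = \<phi> u $ k * q $ l + q $ k * \<phi> u $ l"
          unfolding Bf_def by (rule eq_iff_diff_eq_0[THEN iffD2])
      qed
      with not_tangent show False by blast
    qed
    then obtain i' j' k' l' where rel': "mon i' + mon j' = mon k' + mon l'" and "Bf i' j' k' l' \<noteq> 0" by blast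
    define \<alpha> where "\<alpha> = Bf i' j' k' l'"
    define \<beta> where "\<beta> = Cf i' j' k' l'"
    have \<alpha>: "\<alpha> \<noteq> 0" using \<open>Bf i' j' k' l' \<noteq> 0\<close> by (simp add: \<alpha>_def)
    \<comment> \<open>the common zero other than \<open>\<phi> u\<close> of the proportional forms \<open>B s t + C t\<^sup>2\<close>\<close>
    define y where "y = - \<beta> *s \<phi> u + \<alpha> *s q"
    have "y \<noteq> 0" using indep \<alpha> unfolding independent_pair_def y_def by blast
    moreover have "y $ i * y $ j = y $ k * y $ l" if rel: "mon i + mon j = mon k + mon l" for i j k l
    proof -
      have "y $ i * y $ j - y $ k * y $ l =
        \<beta> * \<beta> * (\<phi> u $ i * \<phi> u $ j - \<phi> u $ k * \<phi> u $ l) + \<alpha> * (\<alpha> * Cf i j k l - \<beta> * Bf i j k l)"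
        by (simp add: y_def Bf_def Cf_def algebra_simps)
      also have "\<dots> = 0"
        using veronese_vector_quadric[OF rel, of u] dep[OF rel rel'] by (simp add: \<alpha>_def \<beta>_def mult.commute)
      finally show ?thesis by simp
    qed
    ultimately have "pt y \<in> X" by (rule veronese_variety_cut_out_by_quadrics)
    then obtain v where "pt y = pt (\<phi> v)" by (rule veronese_varietyE)
    then obtain e where e: "y = e *s \<phi> v" using \<open>y \<noteq> 0\<close> by (rule pt_eqD)
    have "q = (\<beta> / \<alpha>) *s \<phi> u + (e / \<alpha>) *s \<phi> v"
    proof -
      have "\<alpha> *s q = \<beta> *s \<phi> u + e *s \<phi> v" using e by (simp add: y_def vec_eq_iff algebra_simps)
      then have "q = (1 / \<alpha>) *s (\<beta> *s \<phi> u + e *s \<phi> v)" using \<alpha> by (metis divide_self vec.scale_one vector_smult_assoc times_divide_eq_left mult_1)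
      then show ?thesis by (simp add: vector_add_ldistrib vector_smult_assoc)
    qed
    with not_secant show False by blast
  qed
  let ?J = "scheme_inter (vanishing_ideal X) (vanishing_ideal (linear_points A))"
  define D where "D = Bf i j k l * Cf i' j' k' l' - Bf i' j' k' l' * Cf i j k l"
  define Q1 where "Q1 = mpoly_scale (Cf i' j' k' l' / D) (quadric i j k l) - mpoly_scale (Cf i j k l / D) (quadric i' j' k' l')"
  define Q2 where "Q2 = mpoly_scale (Bf i j k l / D) (quadric i' j' k' l') - mpoly_scale (Bf i' j' k' l' / D) (quadric i j k l)"
  have Q: "Q1 \<in> vanishing_ideal X" "Q2 \<in> vanishing_ideal X"
    unfolding Q1_def Q2_def using rel by (auto intro!: vanishing_ideal_diff vanishing_ideal_scale quadric_in_ideal)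
  have comb: "mpoly_scale a (mpoly_const b * F + mpoly_const c * G) - mpoly_scale a' (mpoly_const b' * F + mpoly_const c' * G)
      = mpoly_scale (a * b - a' * b') F + mpoly_scale (a * c - a' * c') G" for a b c a' b' c' and F G :: "('a, 2) mpoly"
  proof -
    have const_diff: "mpoly_const (a - b) = (mpoly_const a - mpoly_const b :: ('a, 2) mpoly)" for a b
      by (simp add: mpoly_const_def single_diff)
    show ?thesis by (simp add: mpoly_scale_def const_diff coeff_const.h_mult algebra_simps)
  qed
  have pullQ: "mpoly_pullback A Q1 = var 1 * var 2" "mpoly_pullback A Q2 = var 2 * var 2"
  proof -
    have "Cf i' j' k' l' / D * Bf i j k l - Cf i j k l / D * Bf i' j' k' l' = 1"
      "Cf i' j' k' l' / D * Cf i j k l - Cf i j k l / D * Cf i' j' k' l' = 0"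
      "Bf i j k l / D * Bf i' j' k' l' - Bf i' j' k' l' / D * Bf i j k l = 0"
      "Bf i j k l / D * Cf i' j' k' l' - Bf i' j' k' l' / D * Cf i j k l = 1"
      using \<delta> by (simp_all add: D_def divide_simps mult.commute)
    then show "mpoly_pullback A Q1 = var 1 * var 2" "mpoly_pullback A Q2 = var 2 * var 2"
      unfolding Q1_def Q2_def mpoly_pullback_simps pull[OF rel(1)] pull[OF rel(2)] comb
      by (simp_all only:) (simp_all add: mpoly_scale_def mpoly_const_def)
  qed
  have "hilbert_function ?J t \<le> 1" if t: "t \<ge> 2" for t
  proof -
    obtain b where b: "\<phi> u $ b \<noteq> 0" using assms(1) veronese_eq_0_iff[of u] by (metis vec_eq_iff zero_index)
    define e where "e = mpoly_scale (1 / \<phi> u $ b ^ t) (var b ^ t)"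
    have "homogeneous (t * 1) (var b ^ t :: ('a, 'm) mpoly)" by (rule homogeneous_power) simp
    then have e: "homogeneous t e" "mpoly_eval e (\<phi> u) = 1"
      using b by (simp_all add: e_def homogeneous_scale)
    have "hilbert_function ?J t \<le> card {e}"
    proof (rule hilbert_function_le_card)
      fix F :: "('a, 'm) mpoly" assume F: "homogeneous t F"
      define F' where "F' = F - mpoly_scale (mpoly_eval F (\<phi> u)) e"
      have F': "homogeneous t F'" using F e(1) by (simp add: F'_def homogeneous_diff homogeneous_scale)
      have "mpoly_eval F' (\<phi> u) = 0" using e(2) by (simp add: F'_def)
      then have zero: "mpoly_eval F' (c *s \<phi> u) = 0" for c by (simp add: mpoly_eval_homogeneous[OF F'])
      let ?a = "single 1 1 + single 2 1 :: 2 monom"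
        and ?b = "single 2 1 + single 2 1 :: 2 monom"
      have "\<exists>H1 H2. mpoly_pullback A F' = single ?a 1 * H1 + single ?b 1 * H2"
      proof (rule mpoly_in_monomial_ideal)
        fix m assume m: "m \<in> keys (mpoly_pullback A F')"
        have "lookup m 2 \<noteq> 0"
        proof (rule exponent_2_pullback_line[OF _ m[unfolded A_def]])
          fix c
          have "(\<chi> i. c * \<phi> u $ i) = c *s \<phi> u" by (simp add: vec_eq_iff)
          then show "coeff (along (\<lambda>i. [:c * \<phi> u $ i, q $ i:]) F') 0 = 0"
            using zero[of c] by (simp add: coeff_along_0)
        qed
        moreover have "mdegree m = t" using homogeneous_pullback[OF F', of A] m by (simp add: homogeneous_def)
        ultimately show "(\<exists>m'. m = ?a + m') \<or> (\<exists>m'. m = ?b + m')"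
          unfolding monom_dvd_iff forall_2 using t by (auto simp: lookup_add lookup_single when_def mdegree_2)
      qed
      then obtain H1 H2 where "mpoly_pullback A F' = single ?a 1 * H1 + single ?b 1 * H2" by blast
      then have "mpoly_pullback A F' = mpoly_pullback A Q1 * H1 + mpoly_pullback A Q2 * H2"
        unfolding pullQ by (simp add: var_def mult_single)
      then have "F' \<in> ?J" by (rule scheme_inter_linearI[OF inj Q])
      then show "\<exists>G\<in>mpoly.span {e}. F - G \<in> ?J"
        unfolding F'_def by (intro bexI) (auto intro: mpoly.span_scale mpoly.span_base)
    qed (use e in auto)
    then show ?thesis by simp
  qed
  then have "scheme_length ?J \<le> enat 1" by (rule scheme_length_le)
  then show ?thesis by (simp add: A_def one_enat_def)
qed

end

section \<open>Secant loci\<close>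

lemma proj_from_pt: "proj_from (pt x) (pt y) = plane x y"
  by (simp add: proj_from_def span_union_pts plane_def)

lemma cone_over_line:
  assumes "q \<noteq> 0" "S \<noteq> {}" and S: "\<And>x. x \<in> S \<Longrightarrow> \<exists>y. x = pt y \<and> plane q y = L"
  shows "cone_over (pt q) (proj_from (pt q) ` S) = {pt z | z. z \<noteq> 0 \<and> z \<in> L}"
proof -
  have "proj_from (pt q) ` S = {L}"
    using assms(2) S by (force simp: proj_from_pt)
  then have cone: "cone_over (pt q) (proj_from (pt q) ` S) = insert (pt q) {p \<in> proj_space. p \<noteq> pt q \<and> proj_from (pt q) p = L}"
    by (simp add: cone_over_def)
  from assms(2) S obtain y where L: "L = plane q y" by blast
  show ?thesis unfolding cone
  proof (intro equalityI subsetI)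
    fix p assume "p \<in> insert (pt q) {p \<in> proj_space. p \<noteq> pt q \<and> proj_from (pt q) p = L}"
    then show "p \<in> {pt z | z. z \<noteq> 0 \<and> z \<in> L}"
    proof
      assume "p = pt q"
      then show ?thesis using assms(1) plane_left[of q y] unfolding L by blast
    next
      assume "p \<in> {p \<in> proj_space. p \<noteq> pt q \<and> proj_from (pt q) p = L}"
      then have "p \<in> proj_space" "proj_from (pt q) p = L" by auto
      moreover from this obtain z where "z \<noteq> 0" "p = pt z" by (auto elim: proj_spaceE)
      ultimately show ?thesis using plane_right[of z q] by (auto simp: proj_from_pt)
    qed
  next
    fix p assume "p \<in> {pt z | z. z \<noteq> 0 \<and> z \<in> L}"
    then obtain z a b where z: "p = pt z" "z \<noteq> 0" "z = a *s q + b *s y" unfolding L plane_def by blast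
    show "p \<in> insert (pt q) {p \<in> proj_space. p \<noteq> pt q \<and> proj_from (pt q) p = L}"
    proof (cases "b = 0")
      case True
      then have "p = pt q" using z pt_scale[of a q] by (cases "a = 0") auto
      then show ?thesis by simp
    next
      case False
      then show ?thesis using z plane_exchange[OF False z(3)] by (auto simp: proj_from_pt L)
    qed
  qed
qed

text \<open>
  With a left inverse \<open>B\<close> of \<open>A\<close>, the linear forms \<open>y\<^sub>i - (A B y)\<^sub>i\<close> vanish on the subspace, and their
  common zeros are the fixed vectors of \<open>A B\<close>.
\<close>

lemma zero_locus_linear_points:
  fixes A :: "'a::field_char_0 ^ 'c::finite ^ 'm::finite"
  assumes "inj ((*v) A)"
  shows "zero_locus (vanishing_ideal (linear_points A)) \<subseteq> linear_points A"
proof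
  fix p assume p: "p \<in> zero_locus (vanishing_ideal (linear_points A))"
  then have "p \<in> proj_space" by (simp add: zero_locus_def)
  then obtain y where y: "y \<noteq> 0" "p = pt y" by (rule proj_spaceE)
  from assms obtain B where B: "B ** A = mat 1" by (metis matrix_left_invertible_injective)
  have "y $ i = (A *v (B *v y)) $ i" for i
  proof -
    let ?F = "var i - mpoly_pullback B (mpoly_pullback A (var i))"
    have "?F \<in> vanishing_ideal (linear_points A)"
      by (simp add: pullback_vanishing_ideal mpoly_pullback_left_inverse[OF B])
    then have "vanishes_at ?F p" using p by (simp add: zero_locus_def)
    then have "mpoly_eval ?F y = 0" using y by (simp add: vanishes_at_def vec.span_base)
    then show ?thesis by (simp add: mpoly_eval_pullback)
  qed
  then have Ay: "y = A *v (B *v y)" by (simp add: vec_eq_iff)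
  then have "B *v y \<noteq> 0" using y(1) by (metis matrix_vector_mult_0_right)
  moreover have "p = pt (A *v (B *v y))" unfolding y(2) using Ay by (rule arg_cong)
  ultimately show "p \<in> linear_points A" unfolding linear_points_def by blast
qed

context veronese_monomials
begin

lemma off_X_not_multiple:
  fixes q :: "'a::field ^ 'm"
  assumes "q \<noteq> 0" "pt q \<notin> X"
  shows "q \<noteq> c *s \<phi> v"
proof
  assume q: "q = c *s \<phi> v"
  then have "c \<noteq> 0" "v \<noteq> 0" using assms(1) by auto
  then show False using assms(2) q pt_scale[of c "\<phi> v"] by simp
qed

lemma off_X_independent:
  fixes u :: "'a::field ^ 'k"
  assumes "q \<noteq> 0" "pt q \<notin> X" "u \<noteq> 0"
  shows "independent_pair (\<phi> u) q"
proof (rule independent_pairI)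
  show "pt (\<phi> u) \<noteq> pt q" using assms veronese_in_X[of u] by metis
qed (use assms in auto)

lemma off_X_secant:
  fixes u v :: "'a::field ^ 'k"
  assumes "q \<noteq> 0" "pt q \<notin> X" and q: "q = a *s \<phi> u + b *s \<phi> v"
  shows "a \<noteq> 0" "b \<noteq> 0" "u \<noteq> 0" "v \<noteq> 0" "independent_pair (\<phi> u) (\<phi> v)"
proof -
  note nm = off_X_not_multiple[OF assms(1,2)]
  show a: "a \<noteq> 0" using nm[of b v] q by auto
  show b: "b \<noteq> 0" using nm[of a u] q by auto
  show u: "u \<noteq> 0" using nm[of b v] q by auto
  show v: "v \<noteq> 0" using nm[of a u] q by auto
  have "pt (\<phi> u) \<noteq> pt (\<phi> v)"
  proof
    assume "pt (\<phi> u) = pt (\<phi> v)"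
    moreover have "\<phi> u \<noteq> 0" using u by simp
    ultimately obtain c where "\<phi> u = c *s \<phi> v" by (rule pt_eqD)
    then have "q = (a * c + b) *s \<phi> v" using q by (simp add: vec_eq_iff algebra_simps)
    with nm show False by blast
  qed
  then show "independent_pair (\<phi> u) (\<phi> v)" using u v by (intro independent_pairI) simp_all
qed

text \<open>
  Secant and tangent lines meet \<open>X\<close> in length two, and all other lines through a point of \<open>X\<close> and \<open>q\<close> in
  length one.
\<close>

theorem secant_locus_eq:
  fixes q :: "'a::{alg_closed_field, field_char_0} ^ 'm"
  assumes q: "q \<noteq> 0" "pt q \<notin> X"
  shows "secant_locus X (pt q) =
    {pt (\<phi> u) | u. u \<noteq> 0 \<and> ((\<exists>v a b. q = a *s \<phi> u + b *s \<phi> v) \<or> (\<exists>w. q = \<tau> u w))}" (is "_ = ?R")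
proof -
  have line: "proj_span {pt q, pt (\<phi> u)} = linear_points (line_matrix (\<phi> u) q)" if "u \<noteq> 0" for u
    using proj_span_pair[of "\<phi> u" q] linear_points_line_matrix[OF off_X_independent[OF q that]]
    by (simp add: insert_commute plane_def)
  show ?thesis
  proof (intro equalityI subsetI)
    fix x assume "x \<in> secant_locus X (pt q)"
    then have x: "x \<in> X" and len: "2 \<le> scheme_length (scheme_inter (vanishing_ideal X) (vanishing_ideal (proj_span {pt q, x})))"
      by (simp_all add: secant_locus_def)
    from x obtain u where u: "u \<noteq> 0" "x = pt (\<phi> u)" by (rule veronese_varietyE)
    have "(\<exists>v a b. q = a *s \<phi> u + b *s \<phi> v) \<or> (\<exists>w. q = \<tau> u w)"
    proof (rule ccontr)
      assume "\<not> ?thesis"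
      then have "scheme_length (scheme_inter (vanishing_ideal X) (vanishing_ideal (linear_points (line_matrix (\<phi> u) q)))) \<le> 1"
        using transversal_line_section[OF u(1) q] by blast
      then have "(2 :: enat) \<le> 1" using len unfolding u(2) line[OF u(1)] by (rule order_trans[rotated])
      then show False by (simp add: one_enat_def numeral_eq_enat)
    qed
    with u show "x \<in> ?R" by blast
  next
    fix x assume "x \<in> ?R"
    then obtain u where u: "u \<noteq> 0" "x = pt (\<phi> u)"
      and st: "(\<exists>v a b. q = a *s \<phi> u + b *s \<phi> v) \<or> (\<exists>w. q = \<tau> u w)" by blast
    have "scheme_length (scheme_inter (vanishing_ideal X) (vanishing_ideal (linear_points (line_matrix (\<phi> u) q)))) = 2"
      using st
    proof
      assume "\<exists>v a b. q = a *s \<phi> u + b *s \<phi> v"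
      then obtain v a b where qq: "q = a *s \<phi> u + b *s \<phi> v" by blast
      note sec = off_X_secant[OF q qq]
      show ?thesis
        using secant_line_section(2)[OF sec(5) q qq] plane_exchange[OF sec(2) qq]
        by (simp add: linear_points_line_matrix[OF sec(5)]
            linear_points_line_matrix[OF independent_pair_exchange[OF sec(5,2) qq]])
    next
      assume "\<exists>w. q = \<tau> u w"
      then obtain w where qq: "q = \<tau> u w" by blast
      then show ?thesis using tangent_line_section(2)[of u w] off_X_independent[OF q u(1)] q by simp
    qed
    then show "x \<in> secant_locus X (pt q)" using u line by (simp add: secant_locus_def)
  qed
qed

subsection \<open>Veronese embeddings of degree at least three\<close>

lemma separating_form:
  fixes u z :: "'a::field ^ 'k"
  assumes "z \<noteq> 0" "pt u \<noteq> pt z"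
  obtains h where "homogeneous 1 h" "mpoly_eval h u = 0" "mpoly_eval h z \<noteq> 0"
proof (cases "u = 0")
  case True
  obtain j where "z $ j \<noteq> 0" using assms(1) by (auto simp: vec_eq_iff)
  with True show ?thesis by (intro that[of "var j"]) simp_all
next
  case False
  then obtain h where "homogeneous 1 h" "vanishes_at h (pt u)" "\<not> vanishes_at h (pt z)"
    using separating_linear_form[of "pt u" "pt z"] assms by auto
  then show ?thesis by (intro that[of h]) (simp_all add: vanishes_at_pt)
qed

lemma coeff_along_linear_form:
  assumes "homogeneous 1 h"
  shows "coeff (along (\<lambda>j. [:u $ j, w $ j:]) h) (Suc 0) = mpoly_eval h w"
  using assms
proof (induction rule: mpoly_homogeneous_induct)
  case (single m c)
  then have "mdegree m = Suc 0" by simp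
  then obtain j m' where m: "m = single j 1 + m'" "mdegree m' = 0" by (rule monom_split_mdegree)
  then have "m' = 0" by (simp add: mdegree_eq_0_iff)
  then show ?case by (simp add: m coeff_poly.subst_single)
qed (simp_all add: coeff_poly.subst_add)

lemma functional_tangent_product:
  assumes "homogeneous d (g * h)" "homogeneous 1 h" "mpoly_eval h u = 0"
  shows "functional (\<tau> u w) (g * h) = mpoly_eval g u * mpoly_eval h w"
  using assms(1,3) coeff_along_linear_form[OF assms(2)]
  by (simp add: functional_tangent coeff_poly.subst_mult coeff_1_mult coeff_along_0)

lemma functional_tangent_double:
  assumes "homogeneous d (g * h)" "mpoly_eval g u = 0" "mpoly_eval h u = 0"
  shows "functional (\<tau> u w) (g * h) = 0"
  using assms by (simp add: functional_tangent coeff_poly.subst_mult coeff_1_mult coeff_along_0)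

lemma functional_secant:
  assumes "homogeneous d f" "q = a *s \<phi> u + b *s \<phi> v"
  shows "functional q f = a * mpoly_eval f u + b * mpoly_eval f v"
  using assms by (simp add: functional_add_left functional_scale_left functional_veronese)

lemma homogeneous_product3:
  assumes "d \<ge> 3" "homogeneous 1 h1" "homogeneous 1 h2" "homogeneous 1 h3" "homogeneous 1 h"
  shows "homogeneous d (h1 * h2 * h ^ (d - 3) * h3 :: ('a::comm_ring_1, 'k) mpoly)"
proof -
  have "homogeneous (1 + 1 + (d - 3) * 1 + 1) (h1 * h2 * h ^ (d - 3) * h3)"
    by (intro homogeneous_mult homogeneous_power assms)
  moreover have "1 + 1 + (d - 3) * 1 + 1 = d" using assms(1) by simp
  ultimately show ?thesis by (simp only:)
qed

lemma off_X_tangent: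
  fixes u w :: "'a::field ^ 'k"
  assumes "\<tau> u w \<noteq> 0" "pt (\<tau> u w) \<notin> X"
  shows "u \<noteq> 0" "w \<noteq> 0" "pt u \<noteq> pt w"
proof -
  show u: "u \<noteq> 0" using assms(1) by auto
  have nm: "w \<noteq> c *s u" for c
  proof
    assume "w = c *s u"
    then have "\<tau> u w = (c * of_nat d) *s \<phi> u" by (simp add: tangent_vector_scale tangent_self vector_smult_assoc)
    then show False using off_X_not_multiple[OF assms] by blast
  qed
  show w: "w \<noteq> 0" using nm[of 0] by auto
  show "pt u \<noteq> pt w"
  proof
    assume "pt u = pt w"
    then obtain c where "w = c *s u" using w by (metis pt_eqD)
    with nm show False by blast
  qed
qed

text \<open>
  For \<open>d \<ge> 3\<close> there are enough forms of degree \<open>d\<close>, namely products of three linear forms times a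
  power, to separate two length two subschemes with different supports; so a point lies on at most
  one secant or tangent line.
\<close>

lemma secant_unique:
  fixes q :: "'a::field_char_0 ^ 'm"
  assumes d3: "d \<ge> 3" and q: "q \<noteq> 0" "pt q \<notin> X" "q = a *s \<phi> u + b *s \<phi> v"
    and z: "z \<noteq> 0" "pt u \<noteq> pt z" "pt v \<noteq> pt z"
  shows "\<not> (\<exists>z' a' b'. q = a' *s \<phi> z + b' *s \<phi> z')" "\<not> (\<exists>w. q = \<tau> z w)"
proof -
  obtain h1 where h1: "homogeneous 1 h1" "mpoly_eval h1 u = 0" "mpoly_eval h1 z \<noteq> 0"
    by (rule separating_form[OF z(1,2)])
  obtain h2 where h2: "homogeneous 1 h2" "mpoly_eval h2 v = 0" "mpoly_eval h2 z \<noteq> 0"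
    by (rule separating_form[OF z(1,3)])
  let ?g = "h1 * h2 * h1 ^ (d - 3)"
  have g: "mpoly_eval ?g z \<noteq> 0" using h1 h2 by simp
  have zero: "functional q (?g * h3) = 0" if "homogeneous 1 h3" for h3
    using functional_secant[OF homogeneous_product3[OF d3 h1(1) h2(1) that h1(1)] q(3)] h1(2) h2(2) by simp
  show "\<not> (\<exists>z' a' b'. q = a' *s \<phi> z + b' *s \<phi> z')"
  proof
    assume "\<exists>z' a' b'. q = a' *s \<phi> z + b' *s \<phi> z'"
    then obtain z' a' b' where qz: "q = a' *s \<phi> z + b' *s \<phi> z'" by blast
    note sec = off_X_secant[OF q(1,2) qz]
    have "pt z' \<noteq> pt z"
    proof
      assume "pt z' = pt z"
      then obtain c where "z' = c *s z" using sec(4) by (rule pt_eqD)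
      then have "\<phi> z' = c ^ d *s \<phi> z" by (simp add: veronese_scale)
      then have "q = (a' + b' * c ^ d) *s \<phi> z" using qz by (simp add: vec_eq_iff algebra_simps)
      then show False using off_X_not_multiple[OF q(1,2)] by blast
    qed
    then obtain h3 where h3: "homogeneous 1 h3" "mpoly_eval h3 z' = 0" "mpoly_eval h3 z \<noteq> 0"
      by (rule separating_form[OF z(1)])
    have "functional q (?g * h3) = a' * (mpoly_eval ?g z * mpoly_eval h3 z)"
      using functional_secant[OF homogeneous_product3[OF d3 h1(1) h2(1) h3(1) h1(1)] qz] h3(2) by simp
    with zero[OF h3(1)] g h3(3) sec(1) show False by simp
  qed
  show "\<not> (\<exists>w. q = \<tau> z w)"
  proof
    assume "\<exists>w. q = \<tau> z w"
    then obtain w where qw: "q = \<tau> z w" by blast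
    note tan = off_X_tangent[of z w]
    have "w \<noteq> 0" "pt z \<noteq> pt w" using tan q(1,2) qw by auto
    then obtain h3 where h3: "homogeneous 1 h3" "mpoly_eval h3 z = 0" "mpoly_eval h3 w \<noteq> 0"
      by (rule separating_form)
    have "functional q (?g * h3) = mpoly_eval ?g z * mpoly_eval h3 w"
      unfolding qw by (rule functional_tangent_product[OF homogeneous_product3[OF d3 h1(1) h2(1) h3(1) h1(1)] h3(1,2)])
    with zero[OF h3(1)] g h3(3) show False by simp
  qed
qed

text \<open>
  The functional \<open>\<tau> z w\<close> takes a nonzero value on a product of a form not vanishing at \<open>z\<close> and a linear
  form \<open>h3\<close> that vanishes at \<open>z\<close> but not at \<open>w\<close>. The first factor is chosen such that the functionals
  of secant and tangent lines through the other point \<open>\<phi> y\<close> vanish on the product.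
\<close>

lemma tangent_unique:
  fixes z w :: "'a::field_char_0 ^ 'k"
  assumes d3: "d \<ge> 3" and q: "\<tau> z w \<noteq> 0" "pt (\<tau> z w) \<notin> X" and y: "y \<noteq> 0" "pt y \<noteq> pt z"
  shows "\<not> (\<exists>v a b. \<tau> z w = a *s \<phi> y + b *s \<phi> v)" "\<not> (\<exists>w'. \<tau> z w = \<tau> y w')"
proof -
  note tan = off_X_tangent[OF q]
  obtain h1 where h1: "homogeneous 1 h1" "mpoly_eval h1 y = 0" "mpoly_eval h1 z \<noteq> 0"
    by (rule separating_form[OF tan(1) y(2)])
  obtain h3 where h3: "homogeneous 1 h3" "mpoly_eval h3 z = 0" "mpoly_eval h3 w \<noteq> 0"
    by (rule separating_form[OF tan(2,3)])
  show "\<not> (\<exists>v a b. \<tau> z w = a *s \<phi> y + b *s \<phi> v)"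
  proof
    assume "\<exists>v a b. \<tau> z w = a *s \<phi> y + b *s \<phi> v"
    then obtain v a b where qv: "\<tau> z w = a *s \<phi> y + b *s \<phi> v" by blast
    obtain h2 where h2: "homogeneous 1 h2" "mpoly_eval h2 v * mpoly_eval h3 v = 0" "mpoly_eval h2 z \<noteq> 0"
    proof (cases "pt v = pt z")
      case True
      have "v \<noteq> 0" using off_X_secant(4)[OF q qv] .
      with True obtain c where "v = c *s z" by (auto elim: pt_eqD)
      then have "mpoly_eval h3 v = 0" using h3(2) by (simp add: mpoly_eval_homogeneous[OF h3(1)])
      then show ?thesis using h1(1,3) by (intro that[of h1]) simp_all
    next
      case False
      then obtain h2 where "homogeneous 1 h2" "mpoly_eval h2 v = 0" "mpoly_eval h2 z \<noteq> 0"
        by (rule separating_form[OF tan(1)])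
      then show ?thesis by (intro that[of h2]) simp_all
    qed
    let ?g = "h1 * h2 * h1 ^ (d - 3)"
    note hom = homogeneous_product3[OF d3 h1(1) h2(1) h3(1) h1(1)]
    have "functional (\<tau> z w) (?g * h3) = mpoly_eval ?g z * mpoly_eval h3 w"
      by (rule functional_tangent_product[OF hom h3(1,2)])
    moreover have "functional (\<tau> z w) (?g * h3) = 0"
      using functional_secant[OF hom qv] h1(2) h2(2) by (auto simp: mult_ac)
    ultimately show False using h1(3) h2(3) h3(3) by simp
  qed
  show "\<not> (\<exists>w'. \<tau> z w = \<tau> y w')"
  proof
    assume "\<exists>w'. \<tau> z w = \<tau> y w'"
    then obtain w' where qw: "\<tau> z w = \<tau> y w'" by blast
    obtain j where j: "z $ j \<noteq> 0" using tan(1) by (auto simp: vec_eq_iff)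
    let ?g = "h1 * h1 * var j ^ (d - 3)"
    note hom = homogeneous_product3[OF d3 h1(1) h1(1) h3(1) homogeneous_var(1)[of j]]
    have "functional (\<tau> z w) (?g * h3) = mpoly_eval ?g z * mpoly_eval h3 w"
      by (rule functional_tangent_product[OF hom h3(1,2)])
    moreover have eq: "?g * h3 = h1 * (h1 * var j ^ (d - 3) * h3)" by (simp add: mult_ac)
    have "functional (\<tau> z w) (?g * h3) = 0"
      unfolding qw eq by (rule functional_tangent_double) (use hom h1(2) in \<open>simp_all add: eq\<close>)
    ultimately show False using h1(3) h3(3) j by simp
  qed
qed

lemma secant_locus_secant:
  fixes q :: "'a::{alg_closed_field, field_char_0} ^ 'm"
  assumes d3: "d \<ge> 3" and q: "q \<noteq> 0" "pt q \<notin> X" "q = a *s \<phi> u + b *s \<phi> v"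
  shows "secant_locus X (pt q) = {pt (\<phi> u), pt (\<phi> v)}"
proof -
  note sec = off_X_secant[OF q]
  have "pt (\<phi> z) \<in> {pt (\<phi> u), pt (\<phi> v)}"
    if "z \<noteq> 0" "(\<exists>v a b. q = a *s \<phi> z + b *s \<phi> v) \<or> (\<exists>w. q = \<tau> z w)" for z
    using secant_unique[OF d3 q that(1)] that pt_veronese_eq_iff[OF sec(3) that(1)] pt_veronese_eq_iff[OF sec(4) that(1)]
    by auto
  moreover have "q = b *s \<phi> v + a *s \<phi> u" using q(3) by (simp add: add.commute)
  ultimately show ?thesis unfolding secant_locus_eq[OF q(1,2)] using sec(3,4) q(3) by blast
qed

lemma secant_locus_tangent:
  fixes z w :: "'a::{alg_closed_field, field_char_0} ^ 'k"
  assumes d3: "d \<ge> 3" and q: "\<tau> z w \<noteq> 0" "pt (\<tau> z w) \<notin> X"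
  shows "secant_locus X (pt (\<tau> z w)) = {pt (\<phi> z)}"
proof -
  note tan = off_X_tangent[OF q]
  have "pt (\<phi> y) = pt (\<phi> z)"
    if "y \<noteq> 0" "(\<exists>v a b. \<tau> z w = a *s \<phi> y + b *s \<phi> v) \<or> (\<exists>w'. \<tau> z w = \<tau> y w')" for y
    using tangent_unique[OF d3 q that(1)] that pt_veronese_eq_iff[OF that(1) tan(1)] by auto
  then show ?thesis unfolding secant_locus_eq[OF q] using tan(1) by blast
qed

lemma secant_scheme_secant:
  fixes q :: "'a::{alg_closed_field, field_char_0} ^ 'm"
  assumes d3: "d \<ge> 3" and q: "q \<noteq> 0" "pt q \<notin> X" "q = a *s \<phi> u + b *s \<phi> v"
  shows "secant_scheme X (pt q) =
    scheme_inter (vanishing_ideal X) (vanishing_ideal (linear_points (line_matrix (\<phi> u) (\<phi> v))))"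
proof -
  note sec = off_X_secant[OF q]
  have "plane (\<phi> u) q = plane (\<phi> u) (\<phi> v)" by (rule plane_exchange[OF sec(2) q(3)])
  moreover have "plane (\<phi> v) q = plane (\<phi> v) (\<phi> u)"
    by (rule plane_exchange[OF sec(1), of q b]) (use q(3) in \<open>simp add: add.commute\<close>)
  ultimately have planes: "plane q (\<phi> u) = plane (\<phi> u) (\<phi> v)" "plane q (\<phi> v) = plane (\<phi> u) (\<phi> v)"
    by (simp_all add: plane_commute)
  have "cone_over (pt q) (proj_from (pt q) ` {pt (\<phi> u), pt (\<phi> v)}) = {pt z | z. z \<noteq> 0 \<and> z \<in> plane (\<phi> u) (\<phi> v)}"
    by (rule cone_over_line[OF q(1)]) (use planes in auto)
  then show ?thesis
    unfolding secant_scheme_def secant_locus_secant[OF assms] linear_points_line_matrix[OF sec(5)] by simp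
qed

lemma secant_scheme_tangent:
  fixes z w :: "'a::{alg_closed_field, field_char_0} ^ 'k"
  assumes d3: "d \<ge> 3" and q: "\<tau> z w \<noteq> 0" "pt (\<tau> z w) \<notin> X"
  shows "secant_scheme X (pt (\<tau> z w)) =
    scheme_inter (vanishing_ideal X) (vanishing_ideal (linear_points (line_matrix (\<phi> z) (\<tau> z w))))"
proof -
  note tan = off_X_tangent[OF q]
  have "cone_over (pt (\<tau> z w)) (proj_from (pt (\<tau> z w)) ` {pt (\<phi> z)}) =
      {pt y | y. y \<noteq> 0 \<and> y \<in> plane (\<phi> z) (\<tau> z w)}"
    by (rule cone_over_line[OF q(1)]) (use plane_commute in auto)
  then show ?thesis
    unfolding secant_scheme_def secant_locus_tangent[OF assms] linear_points_line_matrix[OF off_X_independent[OF q tan(1)]]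
    by simp
qed

theorem two_distinct_points_secant:
  fixes q :: "'a::{alg_closed_field, field_char_0} ^ 'm"
  assumes d3: "d \<ge> 3" and q: "q \<noteq> 0" "pt q \<notin> X" "q = a *s \<phi> u + b *s \<phi> v"
  shows "two_distinct_points (secant_scheme X (pt q))"
proof -
  note sec = off_X_secant[OF q]
  let ?A = "line_matrix (\<phi> u) (\<phi> v)"
  let ?J = "scheme_inter (vanishing_ideal X) (vanishing_ideal (linear_points ?A))"
  have "?J = vanishing_ideal {pt (\<phi> u), pt (\<phi> v)}"
  proof (intro equalityI subsetI)
    fix F assume "F \<in> ?J"
    then obtain F1 F2 where F: "F = F1 + F2" "F1 \<in> vanishing_ideal X" "F2 \<in> vanishing_ideal (linear_points ?A)"
      unfolding scheme_inter_def by blast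
    have "{pt (\<phi> u), pt (\<phi> v)} \<subseteq> X" using sec by simp
    moreover have "{pt (\<phi> u), pt (\<phi> v)} \<subseteq> linear_points ?A"
      using pt_line_in_linear_points[OF sec(5), of 1 0] pt_line_in_linear_points[OF sec(5), of 0 1] by simp
    ultimately have "F1 \<in> vanishing_ideal {pt (\<phi> u), pt (\<phi> v)}" "F2 \<in> vanishing_ideal {pt (\<phi> u), pt (\<phi> v)}"
      using F(2,3) vanishing_ideal_antimono by (meson subsetD)+
    then show "F \<in> vanishing_ideal {pt (\<phi> u), pt (\<phi> v)}" unfolding F(1) by (rule vanishing_ideal_add)
  next
    fix F assume F: "F \<in> vanishing_ideal {pt (\<phi> u), pt (\<phi> v)}"
    then have zero: "mpoly_eval F (c *s \<phi> u) = 0" "mpoly_eval F (c *s \<phi> v) = 0" for c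
      by (auto simp: vanishing_ideal_def vanishes_at_def pt_def')
    show "F \<in> ?J" unfolding secant_line_section(1)[OF sec(5) q]
    proof
      fix m assume m: "m \<in> keys (mpoly_pullback ?A F)"
      have "lookup m 1 \<noteq> 0" by (rule exponent_1_pullback_line[OF _ m]) (rule zero)
      moreover have "lookup m 2 \<noteq> 0"
      proof (rule exponent_2_pullback_line[OF _ m])
        fix c
        have "(\<chi> i. c * \<phi> u $ i) = c *s \<phi> u" by (simp add: vec_eq_iff)
        then show "coeff (along (\<lambda>i. [:c * \<phi> u $ i, \<phi> v $ i:]) F) 0 = 0"
          using zero(1)[of c] by (simp add: coeff_along_0)
      qed
      ultimately show "\<exists>m'. m = single 1 1 + single 2 1 + m'"
        unfolding monom_dvd_iff forall_2 by (auto simp: lookup_add lookup_single when_def)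
    qed
  qed
  moreover have "pt (\<phi> u) \<noteq> pt (\<phi> v)"
  proof
    assume "pt (\<phi> u) = pt (\<phi> v)"
    moreover have "\<phi> u \<noteq> 0" using sec(3) by simp
    ultimately obtain c where "\<phi> u = c *s \<phi> v" by (rule pt_eqD)
    then have "1 *s \<phi> u + (- c) *s \<phi> v = 0" by (simp add: vec_eq_iff)
    then show False using sec(5) unfolding independent_pair_def by (metis one_neq_zero)
  qed
  ultimately show ?thesis
    unfolding two_distinct_points_def secant_scheme_secant[OF assms] same_subscheme_def
    using sec(3,4) by (intro bexI[of _ "pt (\<phi> u)"] bexI[of _ "pt (\<phi> v)"]) auto
qed

text \<open>
  The scheme is given on the tangent line by \<open>t\<^sup>2\<close>. It is not reduced because the square of a linear form
  that restricts to \<open>t\<close> lies in the ideal, but no multiple of the form itself by a power of a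
  coordinate not vanishing at the point does.
\<close>

theorem double_point_tangent:
  fixes z w :: "'a::{alg_closed_field, field_char_0} ^ 'k"
  assumes d3: "d \<ge> 3" and q: "\<tau> z w \<noteq> 0" "pt (\<tau> z w) \<notin> X"
  shows "double_point (secant_scheme X (pt (\<tau> z w)))"
proof -
  note tan = off_X_tangent[OF q]
  note indep = off_X_independent[OF q tan(1)]
  define A where "A = line_matrix (\<phi> z) (\<tau> z w)"
  let ?J = "scheme_inter (vanishing_ideal X) (vanishing_ideal (linear_points A))"
  have inj: "inj ((*v) A)" unfolding A_def by (rule inj_line_matrix[OF indep])
  note sect = tangent_line_section[OF indep q, folded A_def]
  have scheme: "secant_scheme X (pt (\<tau> z w)) = ?J" unfolding A_def by (rule secant_scheme_tangent[OF assms])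
  have zin: "pt (\<phi> z) \<in> linear_points A" using pt_line_in_linear_points[OF indep, of 1 0] by (simp add: A_def)
  have "zero_locus ?J = {pt (\<phi> z)}"
  proof (intro equalityI subsetI)
    fix p assume "p \<in> {pt (\<phi> z)}"
    then have p: "p = pt (\<phi> z)" by simp
    have "vanishes_at F (pt (\<phi> z))" if "F \<in> ?J" for F
    proof -
      obtain F1 F2 where F: "F = F1 + F2" "F1 \<in> vanishing_ideal X" "F2 \<in> vanishing_ideal (linear_points A)"
        using \<open>F \<in> ?J\<close> unfolding scheme_inter_def by blast
      then have "vanishes_at F1 (pt (\<phi> z))" "vanishes_at F2 (pt (\<phi> z))"
        using zin tan(1) veronese_in_X[of z] by (auto simp: vanishing_ideal_def simp del: veronese_in_X)
      then show ?thesis by (simp add: F(1) vanishes_at_def)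
    qed
    then show "p \<in> zero_locus ?J" using tan(1) by (simp add: zero_locus_def p)
  next
    fix p assume p: "p \<in> zero_locus ?J"
    then have "p \<in> zero_locus (vanishing_ideal (linear_points A))"
      using vanishing_ideals_subset_scheme_inter(2)[of "linear_points A" X] by (auto simp: zero_locus_def)
    then have "p \<in> linear_points A" using zero_locus_linear_points[OF inj] by blast
    then obtain v where v: "v \<noteq> 0" "p = pt (A *v v)" by (auto simp: linear_points_def)
    obtain Q c where Q: "Q \<in> vanishing_ideal X" "mpoly_pullback A Q = mpoly_const c * (var 2 * var 2)" "c \<noteq> 0"
      using sect(3) by blast
    have "vanishes_at Q p" using p Q(1) vanishing_ideals_subset_scheme_inter(1)[of X "linear_points A"]
      by (auto simp: zero_locus_def)
    then have "mpoly_eval Q (A *v v) = 0" using v by (simp add: vanishes_at_def vec.span_base)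
    then have "c * (v $ 2 * v $ 2) = 0" using Q(2) mpoly_eval_pullback[of A Q v] by simp
    then have v2: "v $ 2 = 0" using Q(3) by simp
    then have "v $ 1 \<noteq> 0" using v(1) by (auto simp: vec_eq_iff forall_2)
    moreover have "A *v v = v $ 1 *s \<phi> z" by (simp add: A_def line_matrix_mult v2)
    ultimately show "p \<in> {pt (\<phi> z)}" using v(2) pt_scale by simp
  qed
  moreover have "scheme_length ?J = 2" by (rule sect(2))
  moreover have "\<not> reduced_subscheme ?J"
  proof
    assume reduced: "reduced_subscheme ?J"
    from inj obtain B where B: "B ** A = mat 1" by (metis matrix_left_invertible_injective)
    define F where "F = mpoly_pullback B (var 2)"
    have AF: "mpoly_pullback A F = var 2" by (simp add: F_def mpoly_pullback_left_inverse[OF B])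
    have "mpoly_pullback A (F ^ 2) = single (single 2 1 + single 2 1) 1"
      by (simp add: AF power2_eq_square var_def mult_single)
    then have "\<forall>m\<in>keys (mpoly_pullback A (F ^ 2)). \<exists>m'. m = single 2 1 + single 2 1 + m'"
      by (auto intro!: exI[of _ 0])
    then have "F ^ 2 \<in> ?J" by (rule sect(1)[THEN iffD2])
    then have "F ^ 2 \<in> saturation ?J"
      unfolding saturation_def by (auto simp: mdegree_eq_0_iff intro!: exI[of _ 0])
    then have "F \<in> saturation ?J" using reduced unfolding reduced_subscheme_def by blast
    then obtain k where k: "\<And>m. mdegree m = k \<Longrightarrow> single m 1 * F \<in> ?J" unfolding saturation_def by blast
    obtain i where i: "\<phi> z $ i \<noteq> 0" using tan(1) veronese_eq_0_iff[of z] by (metis vec_eq_iff zero_index)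
    have "single (single i k) 1 = (var i ^ k :: ('a, 'm) mpoly)"
    proof (induction k)
      case (Suc k)
      have "single (single i (Suc k)) 1 =
          var i * (single (single i k) 1 :: ('a, 'm) mpoly)"
        by (simp add: var_def mult_single flip: single_add)
      with Suc show ?case by simp
    qed simp
    then have "var i ^ k * F \<in> ?J" using k[of "single i k"] by simp
    then have "\<forall>m\<in>keys (mpoly_pullback A (var i ^ k * F)). \<exists>m'. m = single 2 1 + single 2 1 + m'"
      by (rule sect(1)[THEN iffD1])
    then obtain H1 H2 where H: "mpoly_pullback A (var i ^ k * F) =
        single (single 2 1 + single 2 1) 1 * H1 +
        single (single 2 1 + single 2 1) 1 * H2"
      using mpoly_in_monomial_ideal[of "mpoly_pullback A (var i ^ k * F)"
          "single 2 1 + single 2 1" "single 2 1 + single 2 1"] by blast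
    have "single (single 2 1 + single 2 1) 1 = var 2 * (var 2 :: ('a, 2) mpoly)"
      by (simp add: var_def mult_single)
    then have eq: "mpoly_pullback A (var i ^ k) * var 2 = var 2 * (var 2 * (H1 + H2))"
      using H by (simp add: AF algebra_simps)
    \<comment> \<open>compare the linear terms along the line through \<open>(1, 0)\<close> in direction \<open>(0, 1)\<close>\<close>
    define p where "p = (\<lambda>j::2. if j = 1 then [:1:] else [:0, 1 :: 'a:])"
    have "coeff (along p (mpoly_pullback A (var i ^ k) * var 2)) 1 = coeff (along p (var 2 * (var 2 * (H1 + H2)))) 1"
      by (simp only: eq)
    moreover have "coeff (along p (var 2 * (var 2 * (H1 + H2)))) 1 = 0"
      by (simp add: coeff_poly.subst_mult coeff_poly.subst_var coeff_1_mult p_def)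
    moreover have "coeff (along p (mpoly_pullback A (var i ^ k) * var 2)) 1 = mpoly_eval (mpoly_pullback A (var i ^ k)) (\<chi> j. coeff (p j) 0)"
      by (simp add: coeff_poly.subst_mult coeff_poly.subst_var coeff_1_mult coeff_along_0 p_def)
    moreover have "A *v (\<chi> j. coeff (p j) 0) = \<phi> z"
      by (simp add: A_def line_matrix_mult p_def)
    ultimately show False using i by (simp only: mpoly_eval_pullback) simp
  qed
  ultimately show ?thesis unfolding double_point_def scheme by blast
qed

end

section \<open>Dimensions\<close>

context veronese_monomials
begin

lemma prime_on_forms_veronese_image:
  fixes W :: "('a::field_char_0 ^ 'k) set"
  assumes W: "vec.subspace W" and "v \<in> W" "v \<noteq> 0"
  shows "prime_on_forms {pt (\<phi> y) | y. y \<in> W \<and> y \<noteq> 0}"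
proof (rule prime_on_formsI_curves)
  show "{pt (\<phi> y) | y. y \<in> W \<and> y \<noteq> 0} \<noteq> {}" using assms by blast
  show "{pt (\<phi> y) | y. y \<in> W \<and> y \<noteq> 0} \<subseteq> proj_space" by auto
  fix p p' assume "p \<in> {pt (\<phi> y) | y. y \<in> W \<and> y \<noteq> 0}" "p' \<in> {pt (\<phi> y) | y. y \<in> W \<and> y \<noteq> 0}"
  then obtain y y' where y: "y \<in> W" "y \<noteq> 0" "p = pt (\<phi> y)" "y' \<in> W" "p' = pt (\<phi> y')" by blast
  let ?c = "veronese_curve mon y (y' - y)"
  note c = poly_veronese_curve[of mon y "y' - y"]
  have "(\<chi> i. poly (?c i) 0) \<noteq> 0" "p = pt (\<chi> i. poly (?c i) 0)" "p' = pt (\<chi> i. poly (?c i) 1)"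
    unfolding c using y by simp_all
  moreover have "pt (\<chi> i. poly (?c i) r) \<in> {pt (\<phi> y) | y. y \<in> W \<and> y \<noteq> 0}" if "(\<chi> i. poly (?c i) r) \<noteq> 0" for r
  proof -
    have "y + r *s (y' - y) \<in> W"
      using y W by (intro vec.subspace_add vec.subspace_scale vec.subspace_diff)
    then show ?thesis using that unfolding c by auto
  qed
  ultimately show "\<exists>c s t. (\<chi> i. poly (c i) s) \<noteq> 0 \<and> p = pt (\<chi> i. poly (c i) s) \<and> p' = pt (\<chi> i. poly (c i) t) \<and>
      (\<forall>r. (\<chi> i. poly (c i) r) \<noteq> 0 \<longrightarrow> pt (\<chi> i. poly (c i) r) \<in> {pt (\<phi> y) | y. y \<in> W \<and> y \<noteq> 0})"
    by blast
qed

lemma growth_le_veronese_image: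
  fixes M :: "'a::field_char_0 ^ 'p::finite ^ 'k"
  assumes S: "\<And>p. p \<in> S \<Longrightarrow> \<exists>v. p = pt (\<phi> (M *v v))"
  shows "growth_le S (CARD('p) - 1)"
proof -
  define \<psi> where "\<psi> i = monom_eval (\<lambda>j. mpoly_pullback M (var j)) (mon i)" for i
  have eval: "(\<chi> i. mpoly_eval (\<psi> i) v) = \<phi> (M *v v)" for v
    using mpoly_eval_pullback[of M "var _" v]
    by (simp add: vec_eq_iff \<psi>_def mpoly_eval_def eval.subst_monom_eval veronese_vector_def)
  let ?r = "CARD('p) - 1"
  show ?thesis
  proof (rule growth_le_parametrized[where \<psi> = \<psi> and M = "\<lambda>t. {m. mdegree m = t * d}" and C = "d ^ ?r"])
    fix p assume "p \<in> S"
    then show "\<exists>v. p = pt (\<chi> i. mpoly_eval (\<psi> i) v)" unfolding eval by (rule S)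
  next
    fix t
    show "finite {m :: 'p monom. mdegree m = t * d}" by (rule finite_monomials_of_degree)
    have "card {m :: 'p monom. mdegree m = t * d} \<le> (t * d + 1) ^ ?r" by (rule finite_monomials_of_degree)
    also have "\<dots> \<le> (d * (t + 1)) ^ ?r" using d_ge_2 by (intro power_mono) (simp_all add: algebra_simps)
    also have "\<dots> = d ^ ?r * (t + 1) ^ ?r" by (rule power_mult_distrib)
    finally show "card {m :: 'p monom. mdegree m = t * d} \<le> d ^ ?r * (t + 1) ^ ?r" .
  next
    fix F :: "('a, 'm) mpoly" and t assume F: "homogeneous t F"
    have "graded mdegree (d * 1) (\<psi> i)" for i
      using graded_monom_eval[of mdegree 1 "\<lambda>j. mpoly_pullback M (var j)" "mon i"]
        homogeneous_pullback[OF homogeneous_var(1), of M]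
      by (simp add: \<psi>_def homogeneous_iff_graded)
    then have "graded mdegree (t * d) (compose \<psi> F)" using F by (intro graded_compose) simp_all
    then show "keys (compose \<psi> F) \<subseteq> {m. mdegree m = t * d}" by (auto simp: graded_def)
  qed
qed

end

definition flag :: "(nat \<Rightarrow> 'k::finite) \<Rightarrow> nat \<Rightarrow> ('a::field ^ 'k) set" where
  "flag e j = {v. \<forall>i<CARD('k). j < i \<longrightarrow> v $ e i = 0}"

lemma subspace_flag: "vec.subspace (flag e j)"
  by (rule vec.subspaceI) (auto simp: flag_def)

lemma flag_mono: "i \<le> j \<Longrightarrow> flag e i \<subseteq> flag e j"
  by (auto simp: flag_def)

lemma axis_in_flag:
  assumes "bij_betw e {..<CARD('k)} (UNIV :: 'k::finite set)" "j < CARD('k)"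
  shows "axis (e j) 1 \<in> flag e j"
  using assms by (auto simp: flag_def axis_def bij_betw_def inj_on_def)

context veronese_monomials
begin

text \<open>
  The upper bound counts the forms of degree \<open>t d\<close> in the variables; the images of the coordinate flag form a
  chain of the same length.
\<close>

theorem krull_dim_X: "krull_dim (X :: ('a::field_char_0 ^ 'm) set set) = int (CARD('k) - 1)"
proof -
  obtain e :: "nat \<Rightarrow> 'k" where e: "bij_betw e {..<CARD('k)} UNIV"
    using ex_bij_betw_nat_finite[OF finite_class.finite_UNIV] by (metis atLeast0LessThan)
  let ?B = "\<lambda>j. {pt (\<phi> y) | y. y \<in> (flag e j :: ('a ^ 'k) set) \<and> y \<noteq> 0}"
  show ?thesis
  proof (rule krull_dim_eqI[where B = ?B])
    have "\<phi> u = \<phi> (mat 1 *v u)" for u :: "'a ^ 'k" by simp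
    then show "growth_le (X :: ('a ^ 'm) set set) (CARD('k) - 1)"
      by (intro growth_le_veronese_image[of _ "mat 1"]) (metis veronese_varietyE)
    show "(X :: ('a ^ 'm) set set) \<subseteq> proj_space" by (rule X_subset_proj_space)
    have small: "j < CARD('k)" if "j \<le> CARD('k) - 1" for j using that two_variables by linarith
    fix j assume "j \<le> CARD('k) - 1"
    from axis_in_flag[OF e small[OF this]] show "prime_on_forms (?B j)"
      by (intro prime_on_forms_veronese_image[OF subspace_flag]) (auto simp: axis_eq_0_iff)
    show "?B j \<subseteq> X" by auto
  next
    fix j
    have "flag e j \<subseteq> (flag e (Suc j) :: ('a ^ 'k) set)" by (rule flag_mono) simp
    then show "?B j \<subseteq> ?B (Suc j)" by blast
    assume j: "j < CARD('k) - 1"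
    let ?i = "idx (single (e (Suc j)) d)"
    have val: "\<phi> y $ ?i = y $ e (Suc j) ^ d" for y :: "'a ^ 'k" by (simp add: veronese_nth)
    have "vanishes_at (var ?i) (pt (\<phi> y))" if "y \<in> flag e j" for y :: "'a ^ 'k"
    proof -
      have "Suc j < CARD('k)" using j by linarith
      with that have "y $ e (Suc j) = 0" by (simp add: flag_def)
      then show ?thesis using d_ge_2 by (simp add: vanishes_at_pt[OF homogeneous_var(1)] val)
    qed
    then have "var ?i \<in> vanishing_ideal (?B j)" unfolding vanishing_ideal_def by blast
    moreover have "var ?i \<notin> vanishing_ideal (?B (Suc j))"
    proof -
      let ?y = "axis (e (Suc j)) 1 :: 'a ^ 'k"
      have "Suc j < CARD('k)" using j by linarith
      from axis_in_flag[OF e this] have "pt (\<phi> ?y) \<in> ?B (Suc j)" using axis_eq_0_iff[of "e (Suc j)" "1::'a"] by auto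
      moreover have "\<not> vanishes_at (var ?i) (pt (\<phi> ?y))"
        by (simp add: vanishes_at_pt[OF homogeneous_var(1)] val axis_def)
      ultimately show ?thesis unfolding vanishing_ideal_def by blast
    qed
    ultimately show "\<exists>F t. homogeneous t F \<and> F \<in> vanishing_ideal (?B j) \<and> F \<notin> vanishing_ideal (?B (Suc j))"
      using homogeneous_var(1) by blast
  qed
qed

lemma krull_dim_veronese_line:
  fixes z w :: "'a::field_char_0 ^ 'k"
  assumes indep: "independent_pair z w"
  shows "krull_dim {pt (\<phi> y) | y. y \<in> plane z w \<and> y \<noteq> 0} = 1"
proof -
  let ?S = "{pt (\<phi> y) | y. y \<in> plane z w \<and> y \<noteq> 0}"
  let ?B = "\<lambda>j::nat. if j = 0 then {pt (\<phi> z)} else ?S"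
  have comb: "a = 0 \<and> b = 0" if "a *s z + b *s w = 0" for a b using indep that by (auto simp: independent_pair_def)
  have z: "z \<noteq> 0" using comb[of 1 0] by auto
  have w: "w \<noteq> 0" using comb[of 0 1] by auto
  have zw: "pt z \<noteq> pt w"
  proof
    assume "pt z = pt w"
    then obtain c where "z = c *s w" using z by (rule pt_eqD)
    then have "1 *s z + (- c) *s w = 0" by (simp add: vec_eq_iff)
    then show False using comb by (metis one_neq_zero)
  qed
  have sub: "?S \<subseteq> proj_space" by auto
  have "plane z w = vec.span {z, w}"
    by (auto simp: plane_def vec.span_insert vec.span_singleton diff_eq_eq add.commute)
  then have plane: "vec.subspace (plane z w)" by simp
  have "krull_dim ?S = int 1"
  proof (rule krull_dim_eqI[where B = ?B, OF _ sub])
    have "\<exists>v. p = pt (\<phi> (line_matrix z w *v v))" if p: "p \<in> ?S" for p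
    proof -
      obtain a b where "p = pt (\<phi> (a *s z + b *s w))" using p unfolding plane_def by blast
      moreover have "line_matrix z w *v (\<chi> i. if i = 1 then a else b) = a *s z + b *s w" by (simp add: line_matrix_mult)
      ultimately show ?thesis by metis
    qed
    then have "growth_le ?S (CARD(2) - 1)" by (rule growth_le_veronese_image)
    then show "growth_le ?S 1" by simp
    fix j
    show "prime_on_forms (?B j)"
      using prime_on_forms_singleton[of "pt (\<phi> z)"] z prime_on_forms_veronese_image[OF plane plane_left z] by simp
    show "?B j \<subseteq> ?S" using z plane_left[of z w] by auto
  next
    fix j :: nat
    show "?B j \<subseteq> ?B (Suc j)" using z plane_left[of z w] by auto
    assume "j < 1"
    then have j: "j = 0" by simp
    have "pt (\<phi> z) \<noteq> pt (\<phi> w)" using zw pt_veronese_eq_iff[OF z w] by simp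
    then obtain F where F: "homogeneous 1 F" "vanishes_at F (pt (\<phi> z))" "\<not> vanishes_at F (pt (\<phi> w))"
      using separating_linear_form[of "pt (\<phi> z)" "pt (\<phi> w)"] z w by auto
    have "pt (\<phi> w) \<in> ?S" using w plane_right[of w z] by blast
    with F j show "\<exists>F t. homogeneous t F \<and> F \<in> vanishing_ideal (?B j) \<and> F \<notin> vanishing_ideal (?B (Suc j))"
      by (intro exI[of _ F] exI[of _ 1]) (auto simp: vanishing_ideal_def)
  qed
  then show ?thesis by simp
qed

end

section \<open>Quadratic Veronese embeddings\<close>

locale quadratic_veronese = veronese_monomials mon 2 for mon :: "'m::finite \<Rightarrow> 'k::finite monom"
begin

lemma coordinates:
  obtains a b where "mon i = single a 1 + single b 1"
proof -
  have "mdegree (mon i) = Suc (Suc 0)" by simp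
  then obtain a m where m: "mon i = single a 1 + m" "mdegree m = Suc 0" by (rule monom_split_mdegree)
  from m(2) obtain b m' where "m = single b 1 + m'" "mdegree m' = 0" by (rule monom_split_mdegree)
  with m show ?thesis by (intro that[of a b]) (simp add: mdegree_eq_0_iff)
qed

lemma coordinates_nth:
  assumes "mon i = single a 1 + single b 1"
  shows "\<phi> u $ i = u $ a * u $ b" "\<tau> u w $ i = u $ a * w $ b + w $ a * u $ b"
    "veronese_curve mon u w i = [:\<phi> u $ i, \<tau> u w $ i, \<phi> w $ i:]"
  by (simp_all add: veronese_vector_def tangent_vector_def veronese_curve_def assms monom_eval_add coeff_1_mult)

text \<open>
  For degree two, \<open>\<phi>\<close> is a quadratic map and \<open>\<tau>\<close> is its polarisation.
\<close>

lemma veronese_combination: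
  "\<phi> (s *s z + t *s w) = (s * s) *s \<phi> z + (s * t) *s \<tau> z w + (t * t) *s \<phi> w"
proof (simp add: vec_eq_iff, rule allI)
  fix i
  obtain a b where "mon i = single a 1 + single b 1" by (rule coordinates)
  note comps = coordinates_nth[OF this]
  show "\<phi> (s *s z + t *s w) $ i = s * s * \<phi> z $ i + s * t * \<tau> z w $ i + t * t * \<phi> w $ i"
    by (simp add: comps algebra_simps)
qed

lemma tangent_commute: "\<tau> z w = \<tau> w z"
proof (simp add: vec_eq_iff, rule allI)
  fix i
  obtain a b where "mon i = single a 1 + single b 1" by (rule coordinates)
  note comps = coordinates_nth[OF this]
  show "\<tau> z w $ i = \<tau> w z $ i" by (simp add: comps mult.commute add.commute)
qed

text \<open>A sum of two squares is a product: \<open>a u\<^sup>2 + b v\<^sup>2 = (\<alpha> u + \<beta> v) (\<alpha> u - \<beta> v)\<close> with \<open>\<alpha>\<^sup>2 = a\<close> and \<open>\<beta>\<^sup>2 = - b\<close>.\<close>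

lemma secant_imp_tangent:
  fixes y :: "'a::{alg_closed_field, field_char_0} ^ 'm"
  assumes "on_secant y"
  shows "on_tangent y"
proof -
  obtain a b u v where y: "y = a *s \<phi> u + b *s \<phi> v" using assms unfolding on_secant_def by blast
  obtain \<alpha> where \<alpha>: "\<alpha> * \<alpha> = a" using nth_root_exists[of 2 a] by (auto simp: power2_eq_square)
  obtain \<beta> where \<beta>: "\<beta> * \<beta> = - b" using nth_root_exists[of 2 "- b"] by (auto simp: power2_eq_square)
  have "y = \<tau> (\<alpha> *s u + \<beta> *s v) ((1 / 2) *s (\<alpha> *s u - \<beta> *s v))"
  proof (simp add: vec_eq_iff, rule allI)
    fix i
    obtain c e where "mon i = single c 1 + single e 1" by (rule coordinates)
    note comps = coordinates_nth[OF this]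
    have ab: "a = \<alpha> * \<alpha>" "b = - (\<beta> * \<beta>)" using \<alpha> \<beta> by simp_all
    show "y $ i = \<tau> (\<alpha> *s u + \<beta> *s v) ((1 / 2) *s (\<alpha> *s u - \<beta> *s v)) $ i"
      unfolding y ab by (simp add: comps field_simps)
  qed
  then show ?thesis unfolding on_tangent_def by blast
qed

lemma secant_variety_eq_tangent_variety:
  "secant_variety (X :: ('a::{alg_closed_field, field_char_0} ^ 'm) set set) = tangent_variety X"
  unfolding secant_variety_eq tangent_variety_eq using secant_imp_tangent unfolding on_tangent_def by blast

lemma functional_tangent_linear:
  fixes z w :: "'a::comm_ring_1 ^ 'k"
  assumes "homogeneous 1 h" "homogeneous 1 g"
  shows "functional (\<tau> z w) (h * g) = mpoly_eval h z * mpoly_eval g w + mpoly_eval h w * mpoly_eval g z"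
proof -
  have "homogeneous 2 (h * g)" using homogeneous_mult[OF assms] by (simp add: numeral_2_eq_2)
  then show ?thesis
    using coeff_along_linear_form[OF assms(1)] coeff_along_linear_form[OF assms(2)]
    by (simp add: functional_tangent coeff_poly.subst_mult coeff_1_mult coeff_along_0)
qed

lemma functional_secant_linear:
  assumes "homogeneous 1 h" "homogeneous 1 g" "q = a *s \<phi> u + b *s \<phi> v"
  shows "functional q (h * g) = a * (mpoly_eval h u * mpoly_eval g u) + b * (mpoly_eval h v * mpoly_eval g v)"
proof -
  have "homogeneous 2 (h * g)" using homogeneous_mult[OF assms(1,2)] by (simp add: numeral_2_eq_2)
  from functional_secant[OF this assms(3)] show ?thesis by simp
qed

text \<open>
  Suppose that \<open>q\<close> lies on a secant or tangent line through \<open>\<phi> y\<close>. For a linear form \<open>g\<close> that vanishes at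
  the other point of the secant, or at \<open>y\<close> for a tangent, the linear functional \<open>h \<mapsto> q (h g)\<close> is a
  nonzero multiple of evaluation at \<open>y\<close>; since \<open>q = \<tau> z w\<close>, it is also a combination of the evaluations
  at \<open>z\<close> and \<open>w\<close>. Conversely, for \<open>y = s z + t w\<close> the line through \<open>q\<close> and \<open>\<phi> y\<close> also contains
  \<open>\<phi> (s z - t w)\<close>, or is tangent if \<open>s t = 0\<close>.
\<close>

lemma secant_locus_conic:
  fixes z w :: "'a::{alg_closed_field, field_char_0} ^ 'k"
  assumes q: "\<tau> z w \<noteq> 0" "pt (\<tau> z w) \<notin> X"
  shows "secant_locus X (pt (\<tau> z w)) = {pt (\<phi> y) | y. y \<in> plane z w \<and> y \<noteq> 0}"
proof -
  let ?q = "\<tau> z w"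
  have "y \<in> plane z w" if y: "y \<noteq> 0" "(\<exists>v a b. ?q = a *s \<phi> y + b *s \<phi> v) \<or> (\<exists>w'. ?q = \<tau> y w')" for y
  proof -
    have "\<exists>g c. homogeneous 1 g \<and> c \<noteq> 0 \<and> (\<forall>j. functional ?q (var j * g) = c * y $ j)"
      using y(2)
    proof
      assume "\<exists>v a b. ?q = a *s \<phi> y + b *s \<phi> v"
      then obtain v a b where qv: "?q = a *s \<phi> y + b *s \<phi> v" by blast
      note sec = off_X_secant[OF q qv]
      have "pt v \<noteq> pt y"
      proof
        assume "pt v = pt y"
        then have "pt (\<phi> v) = pt (\<phi> y)" using pt_veronese_eq_iff[OF sec(4) y(1)] by simp
        moreover have "\<phi> v \<noteq> 0" using sec(4) by simp
        ultimately obtain c where "\<phi> v = c *s \<phi> y" by (rule pt_eqD)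
        then have "(- c) *s \<phi> y + 1 *s \<phi> v = 0" by (simp add: vec_eq_iff)
        then show False using sec(5) unfolding independent_pair_def by (metis one_neq_zero)
      qed
      then obtain g where g: "homogeneous 1 g" "mpoly_eval g v = 0" "mpoly_eval g y \<noteq> 0"
        by (rule separating_form[OF y(1)])
      have "\<forall>j. functional ?q (var j * g) = (a * mpoly_eval g y) * y $ j"
        using functional_secant_linear[OF homogeneous_var(1) g(1) qv] g(2) by (simp add: mult_ac)
      with g sec(1) show ?thesis by (metis mult_eq_0_iff)
    next
      assume "\<exists>w'. ?q = \<tau> y w'"
      then obtain w' where qw: "?q = \<tau> y w'" by blast
      have "w' \<noteq> 0" "pt y \<noteq> pt w'" using off_X_tangent[of y w'] q qw by auto
      then obtain g where g: "homogeneous 1 g" "mpoly_eval g y = 0" "mpoly_eval g w' \<noteq> 0" by (rule separating_form)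
      have "\<forall>j. functional ?q (var j * g) = mpoly_eval g w' * y $ j"
        unfolding qw using functional_tangent_linear[OF homogeneous_var(1) g(1)] g(2) by (simp add: mult_ac)
      with g show ?thesis by blast
    qed
    then obtain g c where g: "homogeneous 1 g" "c \<noteq> 0" "\<And>j. functional ?q (var j * g) = c * y $ j" by blast
    have "c * y $ j = z $ j * mpoly_eval g w + w $ j * mpoly_eval g z" for j
      using g(3)[of j] functional_tangent_linear[OF homogeneous_var(1) g(1), of z w j] by simp
    then have "y = (mpoly_eval g w / c) *s z + (mpoly_eval g z / c) *s w"
      using g(2) by (simp add: vec_eq_iff field_simps)
    then show ?thesis unfolding plane_def by blast
  qed
  moreover have "(\<exists>v a b. ?q = a *s \<phi> y + b *s \<phi> v) \<or> (\<exists>w'. ?q = \<tau> y w')" if y: "y \<in> plane z w" "y \<noteq> 0" for y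
  proof -
    obtain s t where st: "y = s *s z + t *s w" using y(1) unfolding plane_def by blast
    have "s \<noteq> 0 \<or> t \<noteq> 0" using y(2) st by auto
    then consider "s = 0" "t \<noteq> 0" | "t = 0" "s \<noteq> 0" | "s \<noteq> 0" "t \<noteq> 0" by blast
    then show ?thesis
    proof cases
      case 1
      then have "?q = \<tau> ((1 / t) *s z) y" using st by (simp add: tangent_vector_scale tangent_commute[of "(1 / t) *s z"] tangent_commute[of z] vector_smult_assoc)
      then show ?thesis using tangent_commute by metis
    next
      case 2
      then have "?q = \<tau> ((1 / s) *s w) y" using st by (simp add: tangent_vector_scale tangent_commute[of "(1 / s) *s w"] tangent_commute[of w] vector_smult_assoc)
      then show ?thesis using tangent_commute by metis
    next
      case 3
      have "\<phi> y + (- 1) *s \<phi> (s *s z + (- t) *s w) = (2 * (s * t)) *s ?q"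
        unfolding st veronese_combination by (simp add: vec_eq_iff algebra_simps)
      then have "?q = (1 / (2 * (s * t))) *s (\<phi> y + (- 1) *s \<phi> (s *s z + (- t) *s w))"
        using 3 by (simp add: vector_smult_assoc)
      then have "?q = (1 / (2 * (s * t))) *s \<phi> y + (1 / (2 * (s * t)) * (- 1)) *s \<phi> (s *s z + (- t) *s w)"
        by (simp only: vector_add_ldistrib vector_smult_assoc)
      then show ?thesis by blast
    qed
  qed
  ultimately show ?thesis unfolding secant_locus_eq[OF q] by blast
qed

lemma tangent_independent:
  fixes z w :: "'a::field ^ 'k"
  assumes q: "\<tau> z w \<noteq> 0" "pt (\<tau> z w) \<notin> X"
  shows "independent_pair z w"
  using off_X_tangent[OF q] by (rule independent_pairI)

text \<open>
  A parametrisation of the plane of the conic in which the point \<open>\<phi> (s z + t w)\<close> of the conic has the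
  coordinates \<open>(s\<^sup>2, s t, t\<^sup>2)\<close>.
\<close>

definition plane_matrix :: "'a::field ^ 'k \<Rightarrow> 'a ^ 'k \<Rightarrow> 'a ^ 3 ^ 'm" where
  "plane_matrix z w = (\<chi> i j. if j = 1 then \<phi> z $ i else if j = 2 then \<tau> z w $ i else \<phi> w $ i)"

lemma plane_matrix_mult: "plane_matrix z w *v v = v $ 1 *s \<phi> z + v $ 2 *s \<tau> z w + v $ 3 *s \<phi> w"
  by (simp add: vec_eq_iff plane_matrix_def matrix_vector_mult_def sum_3 mult.commute)

lemma inj_plane_matrix:
  fixes z w :: "'a::{alg_closed_field, field_char_0} ^ 'k"
  assumes q: "\<tau> z w \<noteq> 0" "pt (\<tau> z w) \<notin> X"
  shows "inj ((*v) (plane_matrix z w))"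
proof (rule injI)
  fix v v' assume "plane_matrix z w *v v = plane_matrix z w *v v'"
  moreover define x where "x = v - v'"
  ultimately have "plane_matrix z w *v x = 0" by (simp add: matrix_vector_mult_diff_distrib)
  then have zero: "x $ 1 *s \<phi> z + x $ 2 *s \<tau> z w + x $ 3 *s \<phi> w = 0" by (simp add: plane_matrix_mult)
  note tan = off_X_tangent[OF q]
  obtain g where g: "homogeneous 1 g" "mpoly_eval g w = 0" "mpoly_eval g z \<noteq> 0"
    using separating_form[OF tan(1), of w] tan(3) by metis
  obtain h where h: "homogeneous 1 h" "mpoly_eval h z = 0" "mpoly_eval h w \<noteq> 0"
    by (rule separating_form[OF tan(2,3)])
  have eval: "functional (\<phi> u) (f * f) = mpoly_eval f u * mpoly_eval f u"
    if "homogeneous 1 f" for f and u :: "'a ^ 'k"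
    using functional_secant_linear[OF that that, of "\<phi> u" 1 u 0 u] by simp
  have F: "x $ 1 * (mpoly_eval f z * mpoly_eval f z) + x $ 2 * (2 * (mpoly_eval f z * mpoly_eval f w))
      + x $ 3 * (mpoly_eval f w * mpoly_eval f w) = 0" if "homogeneous 1 f" for f
    using arg_cong[OF zero, of "\<lambda>y. functional y (f * f)"] eval[OF that] functional_tangent_linear[OF that that]
    by (simp add: functional_add_left functional_scale_left algebra_simps) (simp add: functional_def)
  have x1: "x $ 1 = 0" using F[OF g(1)] g by simp
  have x3: "x $ 3 = 0" using F[OF h(1)] h by simp
  with x1 zero q(1) have "x $ 2 = 0" by simp
  with x1 x3 have "x = 0" by (simp add: vec_eq_iff forall_3)
  then show "v = v'" by (simp add: x_def)
qed

text \<open>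
  The line through \<open>q\<close> and a point \<open>(v\<^sub>1, v\<^sub>2, v\<^sub>3)\<close> of the plane contains the point \<open>(s\<^sup>2, s t, t\<^sup>2)\<close> of the
  conic, where \<open>s\<^sup>2 = v\<^sub>1\<close> and \<open>t\<^sup>2 = v\<^sub>3\<close>, as \<open>q\<close> has the coordinates \<open>(0, 1, 0)\<close>.
\<close>

lemma cone_over_conic:
  fixes z w :: "'a::{alg_closed_field, field_char_0} ^ 'k"
  assumes q: "\<tau> z w \<noteq> 0" "pt (\<tau> z w) \<notin> X"
  shows "cone_over (pt (\<tau> z w)) (proj_from (pt (\<tau> z w)) ` secant_locus X (pt (\<tau> z w))) = linear_points (plane_matrix z w)"
    (is "?C = _")
proof (intro equalityI subsetI)
  let ?A = "plane_matrix z w" and ?q = "\<tau> z w"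
  note inj0 = inj_matrix_eq_0[OF inj_plane_matrix[OF q]]
  have Apt: "pt (a *s \<phi> z + b *s ?q + c *s \<phi> w) \<in> linear_points ?A" if "a *s \<phi> z + b *s ?q + c *s \<phi> w \<noteq> 0" for a b c
  proof -
    define v :: "'a ^ 3" where "v = (\<chi> i. if i = 1 then a else if i = 2 then b else c)"
    have "?A *v v = a *s \<phi> z + b *s ?q + c *s \<phi> w" by (simp add: plane_matrix_mult v_def)
    moreover from this have "v \<noteq> 0" using that inj0[of v] by metis
    ultimately show ?thesis unfolding linear_points_def by (metis (mono_tags, lifting) mem_Collect_eq)
  qed
  {
    fix p assume "p \<in> ?C"
    then consider "p = pt ?q" | x where "x \<in> secant_locus X (pt ?q)" "p \<in> proj_space" "proj_from (pt ?q) p = proj_from (pt ?q) x"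
      unfolding cone_over_def by auto
    then show "p \<in> linear_points ?A"
    proof cases
      case 1
      then show ?thesis using Apt[of 0 1 0] q by simp
    next
      case 2
      from 2(1) obtain y where y: "x = pt (\<phi> y)" "y \<in> plane z w" unfolding secant_locus_conic[OF q] by blast
      then obtain s t where st: "y = s *s z + t *s w" unfolding plane_def by blast
      from 2(2) obtain y' where y': "y' \<noteq> 0" "p = pt y'" by (rule proj_spaceE)
      have "y' \<in> plane ?q (\<phi> y)" using 2(3) plane_right[of y' ?q] unfolding y(1) y'(2) proj_from_pt by simp
      then obtain a b where "y' = a *s ?q + b *s \<phi> y" unfolding plane_def by blast
      then have "y' = (b * (s * s)) *s \<phi> z + (a + b * (s * t)) *s ?q + (b * (t * t)) *s \<phi> w"
        unfolding st veronese_combination by (simp add: vec_eq_iff algebra_simps)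
      then show ?thesis using Apt y' by simp
    qed
  next
    fix p assume "p \<in> linear_points ?A"
    then obtain v where v: "v \<noteq> 0" "p = pt (?A *v v)" unfolding linear_points_def by blast
    obtain s where s: "s * s = v $ 1" using nth_root_exists[of 2 "v $ 1"] by (auto simp: power2_eq_square)
    obtain t where t: "t * t = v $ 3" using nth_root_exists[of 2 "v $ 3"] by (auto simp: power2_eq_square)
    define y where "y = s *s z + t *s w"
    have Av: "?A *v v = (v $ 2 - s * t) *s ?q + 1 *s \<phi> y"
      unfolding y_def veronese_combination plane_matrix_mult s t by (simp add: vec_eq_iff algebra_simps)
    show "p \<in> ?C"
    proof (cases "p = pt ?q")
      case True
      then show ?thesis by (simp add: cone_over_def)
    next
      case False
      have "y \<noteq> 0"
      proof
        assume "y = 0"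
        then have eq: "?A *v v = (v $ 2 - s * t) *s ?q" using Av by simp
        moreover have "?A *v v \<noteq> 0" using inj0 v(1) by simp
        ultimately have "v $ 2 - s * t \<noteq> 0" by auto
        from pt_scale[OF this, of ?q] show False using False unfolding v(2) eq by blast
      qed
      moreover have "y \<in> plane z w" unfolding y_def plane_def by blast
      ultimately have "pt (\<phi> y) \<in> secant_locus X (pt ?q)" unfolding secant_locus_conic[OF q] by blast
      moreover have "proj_from (pt ?q) p = proj_from (pt ?q) (pt (\<phi> y))"
        unfolding v(2) proj_from_pt by (rule plane_exchange[OF _ Av]) simp
      moreover have "p \<in> proj_space" using v inj0 by simp
      ultimately show ?thesis using False unfolding cone_over_def by auto
    qed
  }
qed

end

definition conic_form :: "('a::comm_ring_1, 3) mpoly" where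
  "conic_form = var 2 * var 2 - var 1 * var 3"

lemma homogeneous_conic_form: "homogeneous 2 conic_form"
  unfolding conic_form_def using homogeneous_mult[OF homogeneous_var(1) homogeneous_var(1)]
  by (intro homogeneous_diff) (simp_all add: numeral_2_eq_2)

lemma mpoly_eval_pderiv: "mpoly_eval (mpoly_pderiv j F) v = coeff (along (\<lambda>i. [:v $ i, axis j 1 $ i:]) F) 1"
proof -
  have "(\<Sum>i\<in>UNIV. mpoly_eval (mpoly_pderiv i F) v * axis j 1 $ i) =
      (\<Sum>i\<in>UNIV. if i = j then mpoly_eval (mpoly_pderiv i F) v else 0)"
    by (intro sum.cong) (auto simp: axis_def)
  then show ?thesis unfolding sum_pderiv_eq_coeff_along by simp
qed

lemma conic_form_smooth:
  fixes v :: "'a::field_char_0 ^ 3"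
  assumes "v \<noteq> 0"
  shows "\<exists>j. mpoly_eval (mpoly_pderiv j conic_form) v \<noteq> 0"
proof (rule ccontr)
  assume *: "\<not> ?thesis"
  have pderiv: "mpoly_eval (mpoly_pderiv j conic_form) v =
      2 * v $ 2 * axis j 1 $ 2 - (v $ 1 * axis j 1 $ 3 + axis j 1 $ 1 * v $ 3)" for j
    by (simp add: mpoly_eval_pderiv conic_form_def coeff_poly.subst_diff coeff_poly.subst_mult coeff_1_mult algebra_simps)
  have "v $ 3 = 0" "v $ 2 = 0" "v $ 1 = 0"
    using *[simplified, rule_format, of 1] *[simplified, rule_format, of 2] *[simplified, rule_format, of 3]
    unfolding pderiv by (simp_all add: axis_def)
  then show False using assms by (simp add: vec_eq_iff forall_3)
qed

lemma conic_normal_form: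
  "\<exists>m'. lookup m' 2 \<le> 1 \<and> conic_form dvd (single m 1 - single m' (1 :: 'a::comm_ring_1))"
proof (induction "lookup (m :: 3 monom) 2" arbitrary: m rule: less_induct)
  case less
  show ?case
  proof (cases "lookup m 2 \<le> 1")
    case True
    then show ?thesis by (intro exI[of _ m]) simp
  next
    case False
    then obtain m1 where m1: "m = single 2 1 + m1" by (metis bot_nat_0.not_eq_extremum monom_split_variable zero_le)
    with False have "lookup m1 2 > 0" by (simp add: lookup_add)
    then obtain r where r: "m1 = single 2 1 + r" by (rule monom_split_variable)
    let ?n = "single 1 1 + (single 3 1 + r)"
    have "lookup ?n 2 < lookup m 2" by (simp add: m1 r lookup_add lookup_single)
    from less[OF this] obtain m' where m': "lookup m' 2 \<le> 1"
      "conic_form dvd (single ?n 1 - single m' (1 :: 'a))" by blast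
    have "single m 1 - single ?n (1 :: 'a) = conic_form * single r 1"
      by (simp add: m1 r conic_form_def var_def mult_single left_diff_distrib add.assoc)
    then have "conic_form dvd (single m 1 - single ?n (1 :: 'a))" by simp
    from dvd_add[OF this m'(2)] m'(1) show ?thesis by (intro exI[of _ m']) simp
  qed
qed

text \<open>
  Modulo the conic form, every polynomial is equivalent to one whose monomials have exponent at most
  one in the second variable. The substitution \<open>(s\<^sup>2, s t, t\<^sup>2)\<close> maps distinct monomials of this kind to
  distinct monomials in \<open>s\<close> and \<open>t\<close>, the parity of the degree in \<open>s\<close> being the exponent of the second
  variable.
\<close>

lemma conic_form_dvd:
  fixes G :: "('a::field_char_0, 3) mpoly"
  assumes zero: "\<And>v s t. v $ 1 = s * s \<Longrightarrow> v $ 2 = s * t \<Longrightarrow> v $ 3 = t * t \<Longrightarrow> mpoly_eval G v = 0"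
  shows "conic_form dvd G"
proof -
  let ?N = "\<lambda>H :: ('a, 3) mpoly. \<forall>m\<in>keys H. lookup m 2 \<le> 1"
  have "\<exists>H. ?N H \<and> conic_form dvd (G - H)"
  proof (induction G rule: mpoly_induct)
    case (single m c)
    obtain m' where m': "lookup m' 2 \<le> 1" "conic_form dvd (single m 1 - single m' (1 :: 'a))"
      using conic_normal_form by blast
    have "single m c - single m' c = (single m 1 - single m' 1) * mpoly_const c"
      by (simp add: mpoly_const_def left_diff_distrib mult_single)
    with m'(2) have "conic_form dvd (single m c - single m' c)" by simp
    with m'(1) show ?case by (intro exI[of _ "single m' c"]) simp
  next
    case (add F G)
    then obtain H K where "?N H" "conic_form dvd (F - H)" "?N K" "conic_form dvd (G - K)" by blast
    then have "?N (H + K)" "conic_form dvd (F - H + (G - K))"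
      using Poly_Mapping.keys_add[of H K] by (blast, intro dvd_add)
    then show ?case by (intro exI[of _ "H + K"]) (simp add: algebra_simps)
  qed
  then obtain H where H: "?N H" "conic_form dvd (G - H)" by blast
  then obtain K where K: "G - H = conic_form * K" by (elim dvdE)
  define \<epsilon> :: "3 monom \<Rightarrow> 2 monom" where "\<epsilon> m =
    single 1 (2 * lookup m 1 + lookup m 2) +
    single 2 (lookup m 2 + 2 * lookup m 3)" for m
  have \<epsilon>: "lookup (\<epsilon> m) 1 = 2 * lookup m 1 + lookup m 2"
    "lookup (\<epsilon> m) 2 = lookup m 2 + 2 * lookup m 3" for m
    by (simp_all add: \<epsilon>_def lookup_add lookup_single)
  have inj: "inj_on \<epsilon> (keys H)"
  proof (rule inj_onI)
    fix m m' assume m: "m \<in> keys H" "m' \<in> keys H" "\<epsilon> m = \<epsilon> m'"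
    have eq: "2 * lookup m 1 + lookup m 2 = 2 * lookup m' 1 + lookup m' 2"
      "lookup m 2 + 2 * lookup m 3 = lookup m' 2 + 2 * lookup m' 3"
      using \<epsilon>[of m] \<epsilon>[of m'] m(3) by simp_all
    have le: "lookup m 2 \<le> 1" "lookup m' 2 \<le> 1" using H(1) m by auto
    have all: "lookup m 1 = lookup m' 1" "lookup m 2 = lookup m' 2"
      "lookup m 3 = lookup m' 3"
      using eq le by presburger+
    show "m = m'"
    proof (rule poly_mapping_eqI)
      fix i show "lookup m i = lookup m' i" using all exhaust_3[of i] by auto
    qed
  qed
  have vanish: "(\<Sum>n\<in>\<epsilon> ` keys H. lookup H (inv_into (keys H) \<epsilon> n) * monom_eval g n) = 0" for g
  proof -
    define v :: "'a ^ 3" where "v = (\<chi> i. if i = 1 then g 1 * g 1 else if i = 2 then g 1 * g 2 else g 2 * g 2)"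
    have v: "v $ 1 = g 1 * g 1" "v $ 2 = g 1 * g 2" "v $ 3 = g 2 * g 2" by (simp_all add: v_def)
    have "mpoly_eval (G - H) v = 0" unfolding K by (simp add: conic_form_def v)
    with zero[OF v] have "mpoly_eval H v = 0" by simp
    moreover have "monom_eval (($) v) m = monom_eval g (\<epsilon> m)" for m
    proof -
      have "monom_eval (($) v) m = (g 1 * g 1) ^ lookup m 1 * (g 1 * g 2) ^ lookup m 2 *
          (g 2 * g 2) ^ lookup m 3"
        unfolding monom_eval_def UNIV_3 using v by (simp add: mult.assoc)
      then show ?thesis
        by (simp add: \<epsilon>_def monom_eval_add power_add power_mult_distrib power_mult power2_eq_square mult_ac)
    qed
    ultimately have "(\<Sum>m\<in>keys H. lookup H m * monom_eval g (\<epsilon> m)) = 0"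
      by (simp add: mpoly_eval_def mpoly_subst_def)
    then show ?thesis by (simp add: sum.reindex[OF inj] inv_into_f_f[OF inj])
  qed
  have "keys H = {}"
  proof (rule ccontr)
    assume "keys H \<noteq> {}"
    then obtain m where m: "m \<in> keys H" by blast
    from monom_functions_independent[OF _ vanish, of "\<epsilon> m"] m have "lookup H m = 0"
      by (simp add: inv_into_f_f[OF inj])
    with m show False by (simp add: in_keys_iff)
  qed
  then have "H = 0" by simp
  with H(2) show ?thesis by simp
qed

context quadratic_veronese
begin

lemma coordinates_choice:
  "\<exists>\<alpha> \<beta>. \<forall>i. mon i = single (\<alpha> i) 1 + single (\<beta> i) 1"
proof -
  have "\<forall>i. \<exists>a b. mon i = single a 1 + single b 1"
    using coordinates by blast
  then show ?thesis by metis
qed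

text \<open>
  The restrictions of the quadrics to the plane of the conic are multiples of its equation, by comparison of
  the coefficients of \<open>\<phi> (z + T w)\<close>, a curve of degree two in \<open>T\<close>.
\<close>

lemma pullback_plane_quadric:
  fixes z w :: "'a::field_char_0 ^ 'k"
  assumes rel: "mon i + mon j = mon k + mon l"
  shows "mpoly_pullback (plane_matrix z w) (quadric i j k l) =
    mpoly_const (\<tau> z w $ i * \<tau> z w $ j - \<tau> z w $ k * \<tau> z w $ l) * conic_form"
proof -
  have curve: "veronese_curve mon z w i = [:\<phi> z $ i, \<tau> z w $ i, \<phi> w $ i:]" for i
    by (rule coordinates[of i]) (rule coordinates_nth(3))
  have "[:\<phi> z $ i, \<tau> z w $ i, \<phi> w $ i:] * [:\<phi> z $ j, \<tau> z w $ j, \<phi> w $ j:] =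
      [:\<phi> z $ k, \<tau> z w $ k, \<phi> w $ k:] * [:\<phi> z $ l, \<tau> z w $ l, \<phi> w $ l:]"
    using veronese_curve_quadric[OF rel, of z w] unfolding curve .
  then have rels: "\<phi> z $ i * \<phi> z $ j = \<phi> z $ k * \<phi> z $ l"
    "\<phi> z $ i * \<tau> z w $ j + \<tau> z w $ i * \<phi> z $ j = \<phi> z $ k * \<tau> z w $ l + \<tau> z w $ k * \<phi> z $ l"
    "\<phi> z $ i * \<phi> w $ j + \<tau> z w $ i * \<tau> z w $ j + \<phi> w $ i * \<phi> z $ j =
     \<phi> z $ k * \<phi> w $ l + \<tau> z w $ k * \<tau> z w $ l + \<phi> w $ k * \<phi> z $ l"
    "\<tau> z w $ i * \<phi> w $ j + \<phi> w $ i * \<tau> z w $ j = \<tau> z w $ k * \<phi> w $ l + \<phi> w $ k * \<tau> z w $ l"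
    "\<phi> w $ i * \<phi> w $ j = \<phi> w $ k * \<phi> w $ l"
    by (simp_all add: algebra_simps)
  have "mpoly_pullback (plane_matrix z w) (quadric i j k l) -
    mpoly_const (\<tau> z w $ i * \<tau> z w $ j - \<tau> z w $ k * \<tau> z w $ l) * conic_form = 0"
  proof (rule mpoly_zero_if_eval_zero)
    fix v
    show "mpoly_eval (mpoly_pullback (plane_matrix z w) (quadric i j k l) -
        mpoly_const (\<tau> z w $ i * \<tau> z w $ j - \<tau> z w $ k * \<tau> z w $ l) * conic_form) v = 0"
      using rels by (simp add: mpoly_eval_pullback plane_matrix_mult conic_form_def) algebra
  qed
  then show ?thesis by simp
qed

theorem secant_scheme_conic:
  fixes z w :: "'a::{alg_closed_field, field_char_0} ^ 'k"
  assumes q: "\<tau> z w \<noteq> 0" "pt (\<tau> z w) \<notin> X"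
  shows "smooth_plane_conic (secant_scheme X (pt (\<tau> z w)))"
proof -
  let ?A = "plane_matrix z w" and ?q = "\<tau> z w"
  note inj = inj_plane_matrix[OF q]
  obtain i j k l where rel: "mon i + mon j = mon k + mon l" and c: "?q $ i * ?q $ j - ?q $ k * ?q $ l \<noteq> 0" (is "?c \<noteq> 0")
    by (rule quadric_off_X[OF q])
  have "secant_scheme X (pt ?q) = {F. conic_form dvd mpoly_pullback ?A F}"
    unfolding secant_scheme_def cone_over_conic[OF q]
  proof (intro equalityI subsetI CollectI)
    fix F assume "F \<in> scheme_inter (vanishing_ideal X) (vanishing_ideal (linear_points ?A))"
    then obtain F1 where F1: "F1 \<in> vanishing_ideal X" "mpoly_pullback ?A F = mpoly_pullback ?A F1"
      unfolding scheme_inter_linear_iff by blast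
    show "conic_form dvd mpoly_pullback ?A F" unfolding F1(2)
    proof (rule conic_form_dvd)
      fix v :: "'a ^ 3" and s t assume "v $ 1 = s * s" "v $ 2 = s * t" "v $ 3 = t * t"
      then have "?A *v v = 1 *s \<phi> (s *s z + t *s w)" by (simp add: plane_matrix_mult veronese_combination)
      then show "mpoly_eval (mpoly_pullback ?A F1) v = 0"
        using vanishes_on_veronese[OF F1(1)] by (simp only: mpoly_eval_pullback)
    qed
  next
    fix F assume "F \<in> {F. conic_form dvd mpoly_pullback ?A F}"
    then obtain G where G: "mpoly_pullback ?A F = conic_form * G" by (auto elim: dvdE)
    have "mpoly_const ?c * mpoly_const (1 / ?c) = (1 :: ('a, 3) mpoly)"
      using c by (simp add: mpoly_const_def mult_single)
    then have "mpoly_pullback ?A (quadric i j k l) * mpoly_const (1 / ?c) = conic_form"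
      unfolding pullback_plane_quadric[OF rel] by (simp only: mult.commute[of _ conic_form] mult.assoc mult_1_right)
    then have "mpoly_pullback ?A F = mpoly_pullback ?A (quadric i j k l) * (mpoly_const (1 / ?c) * G) +
        mpoly_pullback ?A (quadric i j k l) * 0"
      unfolding G by (simp add: mult.assoc[symmetric])
    then show "F \<in> scheme_inter (vanishing_ideal X) (vanishing_ideal (linear_points ?A))"
      by (rule scheme_inter_linearI[OF inj quadric_in_ideal[OF rel] quadric_in_ideal[OF rel]])
  qed
  then show ?thesis
    unfolding smooth_plane_conic_def same_subscheme_def
    using inj homogeneous_conic_form conic_form_smooth by (intro exI[of _ ?A] exI[of _ conic_form]) auto
qed

definition tangent_image :: "('a::field ^ 'k) set \<Rightarrow> ('a ^ 'k) set \<Rightarrow> ('a ^ 'm) set set" where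
  "tangent_image U W = {pt (\<tau> u w) | u w. u \<in> U \<and> w \<in> W \<and> \<tau> u w \<noteq> 0}"

lemma prime_on_forms_tangent_image:
  fixes U W :: "('a::field_char_0 ^ 'k) set"
  assumes "vec.subspace U" "vec.subspace W" and ne: "tangent_image U W \<noteq> {}"
  shows "prime_on_forms (tangent_image U W)"
proof (rule prime_on_formsI_curves[OF ne])
  show "tangent_image U W \<subseteq> proj_space" by (auto simp: tangent_image_def)
  fix p p' assume "p \<in> tangent_image U W" "p' \<in> tangent_image U W"
  then obtain u w u' w' where p: "u \<in> U" "w \<in> W" "\<tau> u w \<noteq> 0" "p = pt (\<tau> u w)"
    and p': "u' \<in> U" "w' \<in> W" "p' = pt (\<tau> u' w')" unfolding tangent_image_def by blast
  obtain \<alpha> \<beta> where ab: "\<And>i. mon i = single (\<alpha> i) 1 + single (\<beta> i) 1"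
    using coordinates_choice by blast
  define c where "c i = [:u $ \<alpha> i, u' $ \<alpha> i - u $ \<alpha> i:] * [:w $ \<beta> i, w' $ \<beta> i - w $ \<beta> i:] +
    [:w $ \<alpha> i, w' $ \<alpha> i - w $ \<alpha> i:] * [:u $ \<beta> i, u' $ \<beta> i - u $ \<beta> i:]" for i
  have c: "(\<chi> i. poly (c i) r) = \<tau> (u + r *s (u' - u)) (w + r *s (w' - w))" for r
    by (simp add: vec_eq_iff coordinates_nth(2)[OF ab] c_def algebra_simps)
  have "(\<chi> i. poly (c i) 0) \<noteq> 0" "p = pt (\<chi> i. poly (c i) 0)" "p' = pt (\<chi> i. poly (c i) 1)"
    unfolding c using p p' by simp_all
  moreover have "pt (\<chi> i. poly (c i) r) \<in> tangent_image U W" if "(\<chi> i. poly (c i) r) \<noteq> 0" for r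
  proof -
    have "u + r *s (u' - u) \<in> U" "w + r *s (w' - w) \<in> W"
      using p p' assms(1,2) by (auto intro!: vec.subspace_add vec.subspace_scale vec.subspace_diff)
    then show ?thesis using that unfolding c tangent_image_def by blast
  qed
  ultimately show "\<exists>c s t. (\<chi> i. poly (c i) s) \<noteq> 0 \<and> p = pt (\<chi> i. poly (c i) s) \<and> p' = pt (\<chi> i. poly (c i) t) \<and>
      (\<forall>r. (\<chi> i. poly (c i) r) \<noteq> 0 \<longrightarrow> pt (\<chi> i. poly (c i) r) \<in> tangent_image U W)"
    by blast
qed

text \<open>
  The coordinates of \<open>\<tau> u w\<close> are bilinear in \<open>u\<close> and \<open>w\<close>, so forms of degree \<open>t\<close> pull back to forms of
  bidegree \<open>(t, t)\<close>.
\<close>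

lemma growth_le_tangent_image:
  "growth_le (tangent_image U W :: ('a::field_char_0 ^ 'm) set set) (2 * (CARD('k) - 1))"
proof -
  obtain \<alpha> \<beta> where ab: "\<And>i. mon i = single (\<alpha> i) 1 + single (\<beta> i) 1"
    using coordinates_choice by blast
  define \<psi> :: "'m \<Rightarrow> ('a, 'k + 'k) mpoly" where
    "\<psi> i = var (Inl (\<alpha> i)) * var (Inr (\<beta> i)) + var (Inl (\<beta> i)) * var (Inr (\<alpha> i))" for i
  define wtl :: "('k + 'k) monom \<Rightarrow> nat" where "wtl m = (\<Sum>a\<in>UNIV. lookup m (Inl a))" for m
  define wtr :: "('k + 'k) monom \<Rightarrow> nat" where "wtr m = (\<Sum>a\<in>UNIV. lookup m (Inr a))" for m
  have wt: "wtl (m + m') = wtl m + wtl m'" "wtr (m + m') = wtr m + wtr m'" "wtl 0 = 0" "wtr 0 = 0" for m m'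
    by (simp_all add: wtl_def wtr_def lookup_add sum.distrib)
  have wt1: "wtl (single (Inl a) 1) = 1" "wtl (single (Inr a) 1) = 0"
    "wtr (single (Inl a) 1) = 0" "wtr (single (Inr a) 1) = 1" for a
    by (simp_all add: wtl_def wtr_def lookup_single when_def)
  have \<psi>: "graded wtl 1 (\<psi> i)" "graded wtr 1 (\<psi> i)" for i
    unfolding \<psi>_def var_def mult_single using wt1
    by (auto intro!: graded_add graded_single simp: wt simp del: One_nat_def)
  define M where "M t = {m. wtl m = t \<and> wtr m = t}" for t
  let ?r = "2 * (CARD('k) - 1)"
  have M: "finite (M t) \<and> card (M t) \<le> (t + 1) ^ ?r" for t
  proof -
    obtain k0 :: 'k where True by blast
    let ?J = "{Inl k0, Inr k0}"
    have split: "wtl m = lookup m (Inl k0) + (\<Sum>a\<in>UNIV - {k0}. lookup m (Inl a))"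
      "wtr m = lookup m (Inr k0) + (\<Sum>a\<in>UNIV - {k0}. lookup m (Inr a))" for m
      unfolding wtl_def wtr_def by (rule sum.remove; simp)+
    have "finite (M t) \<and> card (M t) \<le> (t + 1) ^ card (- ?J)"
    proof (rule finite_bounded_monomials)
      fix m m' assume m: "m \<in> M t" "m' \<in> M t"
        "\<And>i. i \<notin> ?J \<Longrightarrow> lookup m i = lookup m' i"
      have "(\<Sum>a\<in>UNIV - {k0}. lookup m (Inl a)) = (\<Sum>a\<in>UNIV - {k0}. lookup m' (Inl a))"
        "(\<Sum>a\<in>UNIV - {k0}. lookup m (Inr a)) = (\<Sum>a\<in>UNIV - {k0}. lookup m' (Inr a))"
        using m(3) by (auto intro!: sum.cong)
      then have "lookup m (Inl k0) = lookup m' (Inl k0)"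
        "lookup m (Inr k0) = lookup m' (Inr k0)"
        using m(1,2) split[of m] split[of m'] by (simp_all add: M_def)
      with m(3) show "m = m'" by (intro poly_mapping_eqI) (metis insertE singletonD)
    next
      fix m i assume m: "m \<in> M t"
      have "lookup m (Inl a) \<le> wtl m" "lookup m (Inr a) \<le> wtr m" for a
        unfolding wtl_def wtr_def by (rule member_le_sum; simp)+
      with m show "lookup m i \<le> t" by (cases i) (auto simp: M_def)
    qed
    moreover have "card (- ?J) = ?r"
    proof -
      have "card (- ?J) = CARD('k + 'k) - card ?J" by (simp add: Compl_eq_Diff_UNIV card_Diff_subset)
      then show ?thesis by (simp add: card_UNIV_sum)
    qed
    ultimately show ?thesis by simp
  qed
  show ?thesis
  proof (rule growth_le_parametrized[where \<psi> = \<psi> and M = M and C = 1])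
    fix p assume "p \<in> (tangent_image U W :: ('a ^ 'm) set set)"
    then obtain u w where p: "p = pt (\<tau> u w)" unfolding tangent_image_def by blast
    define v :: "'a ^ ('k + 'k)" where "v = (\<chi> i. case i of Inl a \<Rightarrow> u $ a | Inr a \<Rightarrow> w $ a)"
    have "(\<chi> i. mpoly_eval (\<psi> i) v) = \<tau> u w"
      by (simp add: vec_eq_iff \<psi>_def v_def coordinates_nth(2)[OF ab] mult.commute)
    with p show "\<exists>v. p = pt (\<chi> i. mpoly_eval (\<psi> i) v)" by metis
  next
    fix t show "finite (M t)" "card (M t) \<le> 1 * (t + 1) ^ ?r" using M[of t] by simp_all
  next
    fix F :: "('a, 'm) mpoly" and t assume F: "homogeneous t F"
    have "graded wtl (t * 1) (compose \<psi> F)" "graded wtr (t * 1) (compose \<psi> F)"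
      by (rule graded_compose[OF wt(1,3) \<psi>(1) F], rule graded_compose[OF wt(2,4) \<psi>(2) F])
    then show "keys (compose \<psi> F) \<subseteq> M t" by (auto simp: graded_def M_def)
  qed
qed

text \<open>
  In degree two, \<open>\<tau> u w\<close> is the product of \<open>u\<close> and \<open>w\<close>. The chain first lets \<open>u\<close> run through a
  coordinate flag while \<open>w\<close> stays on its first line, and then lets \<open>w\<close> run through the flag while
  \<open>u\<close> is arbitrary.
\<close>

theorem krull_dim_tangent_variety:
  "krull_dim (tangent_variety (X :: ('a::field_char_0 ^ 'm) set set)) = 2 * int (CARD('k) - 1)"
proof -
  obtain e :: "nat \<Rightarrow> 'k" where e: "bij_betw e {..<CARD('k)} UNIV"
    using ex_bij_betw_nat_finite[OF finite_class.finite_UNIV] by (metis atLeast0LessThan)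
  define n where "n = CARD('k) - 1"
  have card: "CARD('k) = Suc n" using two_variables by (simp add: n_def)
  have inj: "e i = e j \<longleftrightarrow> i = j" if "i \<le> n" "j \<le> n" for i j
    using e that by (auto simp: bij_betw_def inj_on_def card)
  have tan: "tangent_variety X = (tangent_image UNIV UNIV :: ('a ^ 'm) set set)"
    by (simp add: tangent_variety_eq tangent_image_def)
  let ?B = "\<lambda>l. tangent_image (flag e (min l n)) (flag e (l - n)) :: ('a ^ 'm) set set"
  \<comment> \<open>the product of these two basis vectors lies in the \<open>l\<close>-th set, but not in the preceding ones\<close>
  let ?x = "\<lambda>l. e (min l n)" and ?y = "\<lambda>l. e (l - n)"
  let ?i = "\<lambda>l. idx (single (?x l) 1 + single (?y l) 1)"
  have val: "\<tau> u w $ ?i l = u $ ?x l * w $ ?y l + w $ ?x l * u $ ?y l" for u w :: "'a ^ 'k" and l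
    by (simp add: tangent_nth monom_eval_add coeff_1_mult)
  define G where "G l = \<tau> (axis (?x l) 1) (axis (?y l) 1 :: 'a ^ 'k)" for l
  have G: "G l $ ?i l \<noteq> 0" for l
    unfolding G_def val by (simp add: axis_def)
  have GB: "pt (G l) \<in> ?B l" if "l \<le> 2 * n" for l
  proof -
    have "axis (?x l) 1 \<in> (flag e (min l n) :: ('a ^ 'k) set)" "axis (?y l) 1 \<in> (flag e (l - n) :: ('a ^ 'k) set)"
      using that by (auto intro!: axis_in_flag[OF e] simp: card)
    moreover have "G l \<noteq> 0" using G[of l] by auto
    ultimately show ?thesis unfolding tangent_image_def G_def by blast
  qed
  have "krull_dim (tangent_image UNIV UNIV :: ('a ^ 'm) set set) = int (2 * n)"
  proof (rule krull_dim_eqI[where B = ?B])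
    show "growth_le (tangent_image UNIV UNIV :: ('a ^ 'm) set set) (2 * n)"
      unfolding n_def by (rule growth_le_tangent_image)
    show "(tangent_image UNIV UNIV :: ('a ^ 'm) set set) \<subseteq> proj_space" by (auto simp: tangent_image_def)
    fix l assume "l \<le> 2 * n"
    from GB[OF this] show "prime_on_forms (?B l)"
      by (intro prime_on_forms_tangent_image subspace_flag) blast
    show "?B l \<subseteq> tangent_image UNIV UNIV" unfolding tangent_image_def by blast
  next
    fix l assume l: "l < 2 * n"
    have "flag e (min l n) \<subseteq> (flag e (min (Suc l) n) :: ('a ^ 'k) set)"
      "flag e (l - n) \<subseteq> (flag e (Suc l - n) :: ('a ^ 'k) set)" by (rule flag_mono; simp)+
    then show "?B l \<subseteq> ?B (Suc l)" unfolding tangent_image_def by blast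
    let ?j = "?i (Suc l)"
    have "vanishes_at (var ?j) (pt (\<tau> u w))"
      if u: "u \<in> flag e (min l n)" and w: "w \<in> flag e (l - n)" for u w :: "'a ^ 'k"
    proof -
      have zero: "u $ e i = 0" if "min l n < i" "i \<le> n" for i using u that by (simp add: flag_def card)
      have zero': "w $ e i = 0" if "l - n < i" "i \<le> n" for i using w that by (simp add: flag_def card)
      have "\<tau> u w $ ?j = 0"
      proof (cases "l < n")
        case True
        then show ?thesis unfolding val using zero[of "Suc l"] zero'[of "Suc l"] by simp
      next
        case False
        then show ?thesis unfolding val using zero'[of "Suc l - n"] zero'[of n] l by simp
      qed
      then show ?thesis by (simp add: vanishes_at_pt[OF homogeneous_var(1)])
    qed
    then have "var ?j \<in> vanishing_ideal (?B l)" unfolding vanishing_ideal_def tangent_image_def by blast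
    moreover have "\<not> vanishes_at (var ?j) (pt (G (Suc l)))"
      using G by (simp add: vanishes_at_pt[OF homogeneous_var(1)])
    then have "var ?j \<notin> vanishing_ideal (?B (Suc l))"
      using GB[of "Suc l"] l unfolding vanishing_ideal_def by auto
    ultimately show "\<exists>F t. homogeneous t F \<and> F \<in> vanishing_ideal (?B l) \<and> F \<notin> vanishing_ideal (?B (Suc l))"
      using homogeneous_var(1) by blast
  qed
  then show ?thesis unfolding tan n_def by simp
qed

end

section \<open>The secant stratification\<close>

context veronese_monomials
begin

lemma X_subset_secant_variety: "(X :: ('a::{alg_closed_field, field_char_0} ^ 'm) set set) \<subseteq> secant_variety X"
proof
  fix x :: "('a ^ 'm) set" assume "x \<in> X"
  then obtain u where u: "u \<noteq> 0" "x = pt (\<phi> u)" by (rule veronese_varietyE)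
  have "\<phi> u = 1 *s \<phi> u + 0 *s \<phi> u" by simp
  then have "on_secant (\<phi> u)" unfolding on_secant_def by blast
  moreover have "\<phi> u \<noteq> 0" using u by simp
  ultimately show "x \<in> secant_variety X" using u(2) unfolding secant_variety_eq by blast
qed

lemma secant_locus_empty:
  fixes q :: "('a::{alg_closed_field, field_char_0} ^ 'm) set"
  assumes "q \<in> proj_space" "q \<notin> secant_variety X"
  shows "secant_locus X q = {}"
proof -
  obtain y where y: "y \<noteq> 0" "q = pt y" using assms(1) by (rule proj_spaceE)
  then have "pt y \<notin> X" using assms(2) X_subset_secant_variety by blast
  moreover have "\<not> on_secant y" "\<not> on_tangent y" using assms(2) y unfolding secant_variety_eq by blast+
  ultimately show ?thesis
    unfolding y(2) secant_locus_eq[OF y(1) \<open>pt y \<notin> X\<close>] on_secant_def on_tangent_def by blast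
qed

lemma secant_stratification:
  fixes r :: int
  defines "V \<equiv> (X :: ('a::{alg_closed_field, field_char_0} ^ 'm) set set)"
  assumes dim: "\<And>q. q \<in> secant_variety V - V \<Longrightarrow> krull_dim (secant_locus V q) = r"
    and n: "n = CARD('k) - 1" and r: "0 \<le> r" "r \<noteq> int n"
  shows "proj_space = SL (-1) V \<union> SL r V \<union> V" "SL r V = secant_variety V - V" "SL (int n) V = V"
    "\<And>s. s \<notin> {-1, r, int n} \<Longrightarrow> SL s V = {}"
proof -
  have d: "secant_locus_dim V q = (if q \<in> V then int n else if q \<in> secant_variety V then r else -1)"
    if "q \<in> proj_space" for q
    using krull_dim_X[where 'a = 'a] dim[of q] secant_locus_empty[OF that] that
    by (simp add: secant_locus_dim_def V_def n krull_dim_empty)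
  have V: "V \<subseteq> secant_variety V" unfolding V_def by (rule X_subset_secant_variety)
  have P: "secant_variety V \<subseteq> proj_space" unfolding V_def secant_variety_eq by auto
  have SL: "SL s V = {q \<in> proj_space. (if q \<in> V then int n else if q \<in> secant_variety V then r else -1) = s}" for s
    unfolding SL_def using d by auto
  show "proj_space = SL (-1) V \<union> SL r V \<union> V" "SL r V = secant_variety V - V" "SL (int n) V = V"
    "\<And>s. s \<notin> {-1, r, int n} \<Longrightarrow> SL s V = {}"
    unfolding SL using V P r by (auto split: if_splits)
qed

end

theorem theorem4p3:
  fixes n d N :: nat
    and mon :: "'m::finite \<Rightarrow> 'k::finite monom"
    and X :: "('a::{alg_closed_field, field_char_0} ^ 'm) set set"
  assumes "n \<ge> 2" and "d \<ge> 2"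
    and "N = ((n + d) choose n) - 1"
    and "CARD('k) = n + 1" and "CARD('m) = N + 1"
    and "bij_betw mon UNIV {m. mdegree m = d}"
    and "X = veronese_variety mon"
  shows
    "(d = 2 \<longrightarrow>
        (\<forall>q \<in> secant_variety X - X. smooth_plane_conic (secant_scheme X q)) \<and>
        secant_variety X = tangent_variety X \<and>
        krull_dim (tangent_variety X) = 2 * int n \<and>
        proj_space = SL (-1) X \<union> SL 1 X \<union> X \<and>
        SL 1 X = secant_variety X - X \<and>
        SL (int n) X = X \<and>
        (\<forall>s. -1 \<le> s \<and> s \<le> int n \<and> s \<notin> {-1, 1, int n} \<longrightarrow> SL s X = {}))
   \<and> (d \<ge> 3 \<longrightarrow>
        (\<forall>q \<in> secant_variety X - X.
           (q \<notin> tangent_variety X \<longrightarrow> two_distinct_points (secant_scheme X q)) \<and>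
           (q \<in> tangent_variety X \<longrightarrow> double_point (secant_scheme X q))) \<and>
        proj_space = SL (-1) X \<union> SL 0 X \<union> X \<and>
        SL 0 X = secant_variety X - X \<and>
        SL (int n) X = X \<and>
        (\<forall>s. -1 \<le> s \<and> s \<le> int n \<and> s \<notin> {-1, 0, int n} \<longrightarrow> SL s X = {}))"
proof (intro conjI[of "d = 2 \<longrightarrow> _"] impI)
  have n: "n = CARD('k) - 1" using assms(4) by simp
  have loc: "veronese_monomials mon d"
    by unfold_locales (use assms in auto)
  {
    assume d: "d = 2"
    then interpret quadratic_veronese mon using loc by (simp add: quadratic_veronese_def)
    have conic: "\<exists>z w. q = pt (tangent_vector mon z w) \<and> tangent_vector mon z w \<noteq> 0 \<and> pt (tangent_vector mon z w) \<notin> X"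
      if "q \<in> secant_variety X - X" for q
      using that unfolding assms(7) secant_variety_eq_tangent_variety tangent_variety_eq by auto
    have smooth: "smooth_plane_conic (secant_scheme X q)" if "q \<in> secant_variety X - X" for q
      using conic[OF that] secant_scheme_conic unfolding assms(7) by blast
    have dim: "krull_dim (secant_locus (veronese_variety mon) q) = 1"
      if q: "q \<in> secant_variety (veronese_variety mon) - (veronese_variety mon :: ('a ^ 'm) set set)" for q
    proof -
      obtain z w where zw: "q = pt (tangent_vector mon z w)" "tangent_vector mon z w \<noteq> 0"
        "pt (tangent_vector mon z w) \<notin> veronese_variety mon"
        using conic[of q] q unfolding assms(7) by blast
      show ?thesis
        unfolding zw(1) secant_locus_conic[OF zw(2,3)] by (rule krull_dim_veronese_line[OF tangent_independent[OF zw(2,3)]])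
    qed
    have "(1::int) \<noteq> int n" using assms(1) by simp
    note strata = secant_stratification[OF dim n zero_le_one this, folded assms(7)]
    have "secant_variety X = tangent_variety X" unfolding assms(7) by (rule secant_variety_eq_tangent_variety)
    moreover have "krull_dim (tangent_variety X) = 2 * int n"
      unfolding assms(7) n by (rule krull_dim_tangent_variety)
    ultimately show "(\<forall>q \<in> secant_variety X - X. smooth_plane_conic (secant_scheme X q)) \<and>
        secant_variety X = tangent_variety X \<and>
        krull_dim (tangent_variety X) = 2 * int n \<and>
        proj_space = SL (-1) X \<union> SL 1 X \<union> X \<and>
        SL 1 X = secant_variety X - X \<and>
        SL (int n) X = X \<and>
        (\<forall>s. -1 \<le> s \<and> s \<le> int n \<and> s \<notin> {-1, 1, int n} \<longrightarrow> SL s X = {})"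
      using smooth strata by blast
  next
    assume d: "d \<ge> 3"
    interpret veronese_monomials mon d by (rule loc)
    have tangent: "\<exists>z w. q = pt (tangent_vector mon z w) \<and> tangent_vector mon z w \<noteq> 0 \<and> pt (tangent_vector mon z w) \<notin> X"
      if "q \<in> secant_variety X - X" "q \<in> tangent_variety X" for q
      using that unfolding assms(7) tangent_variety_eq by auto
    have secant: "\<exists>y a b u v. q = pt y \<and> y \<noteq> 0 \<and> pt y \<notin> X \<and> y = a *s veronese_vector mon u + b *s veronese_vector mon v"
      if "q \<in> secant_variety X - X" "q \<notin> tangent_variety X" for q
    proof -
      from that(1) obtain y where y: "q = pt y" "y \<noteq> 0" "on_secant y \<or> on_tangent y" "pt y \<notin> X"
        unfolding assms(7) secant_variety_eq by blast
      moreover have "\<not> on_tangent y" using that(2) y unfolding assms(7) tangent_variety_eq on_tangent_def by blast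
      ultimately show ?thesis unfolding on_secant_def by blast
    qed
    have two: "two_distinct_points (secant_scheme X q)" if "q \<in> secant_variety X - X" "q \<notin> tangent_variety X" for q
      using secant[OF that] two_distinct_points_secant[OF d] unfolding assms(7) by blast
    have double: "double_point (secant_scheme X q)" if "q \<in> secant_variety X - X" "q \<in> tangent_variety X" for q
      using tangent[OF that] double_point_tangent[OF d] unfolding assms(7) by blast
    have dim: "krull_dim (secant_locus (veronese_variety mon) q) = 0"
      if q: "q \<in> secant_variety (veronese_variety mon) - (veronese_variety mon :: ('a ^ 'm) set set)" for q
    proof (cases "q \<in> tangent_variety X")
      case True
      then obtain z w where zw: "q = pt (tangent_vector mon z w)" "tangent_vector mon z w \<noteq> 0"
        "pt (tangent_vector mon z w) \<notin> veronese_variety mon"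
        using tangent[of q] q unfolding assms(7) by blast
      show ?thesis unfolding zw(1) secant_locus_tangent[OF d zw(2,3)]
        using off_X_tangent(1)[OF zw(2,3)] by (intro krull_dim_finite) auto
    next
      case False
      then obtain y a b u v where y: "q = pt y" "y \<noteq> 0" "pt y \<notin> veronese_variety mon"
        "y = a *s veronese_vector mon u + b *s veronese_vector mon v"
        using secant[of q] q unfolding assms(7) by blast
      show ?thesis unfolding y(1) secant_locus_secant[OF d y(2-4)]
        using off_X_secant(3,4)[OF y(2-4)] by (intro krull_dim_finite) auto
    qed
    have "(0::int) \<noteq> int n" using assms(1) by simp
    note strata = secant_stratification[OF dim n order_refl this, folded assms(7)]
    show "(\<forall>q \<in> secant_variety X - X.
           (q \<notin> tangent_variety X \<longrightarrow> two_distinct_points (secant_scheme X q)) \<and>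
           (q \<in> tangent_variety X \<longrightarrow> double_point (secant_scheme X q))) \<and>
        proj_space = SL (-1) X \<union> SL 0 X \<union> X \<and>
        SL 0 X = secant_variety X - X \<and>
        SL (int n) X = X \<and>
        (\<forall>s. -1 \<le> s \<and> s \<le> int n \<and> s \<notin> {-1, 0, int n} \<longrightarrow> SL s X = {})"
      using two double strata by blast
  }
qed

end
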